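(* Let $\mathbb G$ be a homogeneous Carnot group, $p>1$, and assume $\Gamma_p$ is $L_p$-harmonic on $\mathbb G\setminus\{0\}$. Let $\beta\in\mathbb R$ and $N=N_2$. (1) Let $\Omega\subset\mathbb G$ be open; if $\beta+Q<0$ assume also $0\notin\Omega$. Then for every $u\in D^{1,p}_L(\Omega,N^{p+\beta})$, $$\Big(\frac{|Q+\beta|}{p}\Big)^p\int_\Omega|u|^pN^\beta|\nabla_LN|^pd\xi\le\int_\Omega|\nabla_Lu|^pN^{p+\beta}d\xi,$$ in particular $\big(\frac{|Q-p|}{p}\big)^p\int_\Omega\frac{|u|^p}{N^p}|\nabla_LN|^pd\xi\le\int_\Omega|\nabla_Lu|^pd\xi$ for $u\in D^{1,p}_L(\Omega)$. If $\Omega\cup\{0\}$ is a neighbourhood of the origin, the constant $(|Q+\beta|/p)^p$ is sharp. (2) Let $p=Q>1$, $R>0$, $\Omega=\{\xi\in\mathbb G:N(\xi)<R\}$, $\beta<-1$. Then for every $u\in D^{1,p}_L(\Omega,(\ln(R/N))^{p+\beta})$, $$\Big(\frac{|\beta+1|}{p}\Big)^p\int_\Omega\frac{|u|^p}{N^p}\Big(\ln\frac RN\Big)^\beta|\nabla_LN|^pd\xi\le\int_\Omega|\nabla_Lu|^p\Big(\ln\frac RN\Big)^{p+\beta}d\xi,$$ in particular $\big(\frac{p-1}{p}\big)^p\int_\Omega\frac{|u|^p}{(N\ln(R/N))^p}|\nabla_LN|^pd\xi\le\int_\Omega|\nabla_Lu|^pd\xi$ for $u\in D^{1,p}_L(\Omega)$;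 the constant $(|\beta+1|/p)^p$ is sharp.
   Context: A homogeneous Carnot group $\mathbb G=(\mathbb R^N,\circ,\delta_\lambda)$: $\mathbb R^N=\mathbb R^{n_1}\times\dots\times\mathbb R^{n_r}$, $\xi=(\xi^{(1)},\dots,\xi^{(r)})$, $\circ$ is a Lie group law on $\mathbb R^N$ for which the dilations $\delta_\lambda(\xi)=(\lambda\xi^{(1)},\lambda^2\xi^{(2)},\dots,\lambda^r\xi^{(r)})$ ($\lambda>0$) are group automorphisms; for $i=1,\dots,l:=n_1$, $X_i$ is the left-invariant vector field agreeing with $\partial/\partial\xi^{(1)}_i$ at the origin, and $X_1,\dots,X_l$ generate the whole Lie algebra of left-invariant vector fields. $\nabla_L=(X_1,\dots,X_l)^T$, $L_pu=\sum_{i=1}^lX_i(|\nabla_Lu|^{p-2}X_iu)$, and $Q=\sum_{i=1}^r i\,n_i$. $N_2$ is the homogeneous norm, smooth on $\mathbb G\setminus\{0\}$, such that $N_2^{2-Q}$ is a fundamental solution of $-L_2$ at $0$. For $p>1$ and $\xi\ne0$, $\Gamma_p(\xi)=N_2(\xi)^{(p-Q)/(p-1)}$ if $p\ne Q$ and $\Gamma_p(\xi)=-\ln N_2(\xi)$ if $p=Q$. For a weight $w>0$ a.e., $w\in L^1_{loc}(\Omega)$, $D^{1,p}_L(\Omega,w)$ is the closure of $C^\infty_0(\Omega)$ in the norm $(\int_\Omega|\nabla_Lu|^pw\,d\xi)^{1/p}$ and $D^{1,p}_L(\Omega)=D^{1,p}_L(\Omega,1)$. "Sharp" means the constant cannot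 be replaced by any larger one. *)

theory Defs
  imports "HOL-Analysis.Analysis"
begin

text \<open>Points of R^N are vectors of type real^'n; the grading is given by a
degree function deg :: 'n => nat (coordinate i lies in layer deg i).\<close>

fun smoothk :: "nat \<Rightarrow> 'a::real_normed_vector set \<Rightarrow> ('a \<Rightarrow> 'b::real_normed_vector) \<Rightarrow> bool" where
  "smoothk 0 S f = continuous_on S f"
| "smoothk (Suc k) S f = (f differentiable_on S \<and>
      (\<forall>v. smoothk k S (\<lambda>x. frechet_derivative f (at x) v)))"

definition smooth_on :: "'a::real_normed_vector set \<Rightarrow> ('a \<Rightarrow> 'b::real_normed_vector) \<Rightarrow> bool" where
  "smooth_on S f \<longleftrightarrow> (\<forall>k. smoothk k S f)"

definition test_fn :: "('a::euclidean_space) set \<Rightarrow> ('a \<Rightarrow> real) \<Rightarrow> bool" where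
  "test_fn \<Omega> \<phi> \<longleftrightarrow> smooth_on UNIV \<phi> \<and> compact (closure {x. \<phi> x \<noteq> 0})
      \<and> closure {x. \<phi> x \<noteq> 0} \<subseteq> \<Omega>"

definition dil :: "('n::finite \<Rightarrow> nat) \<Rightarrow> real \<Rightarrow> real^'n \<Rightarrow> real^'n" where
  "dil deg t x = (\<chi> i. t ^ deg i * x $ i)"

definition hdim :: "('n::finite \<Rightarrow> nat) \<Rightarrow> real" where
  "hdim deg = real (\<Sum>i\<in>UNIV. deg i)"

definition left_inv :: "(real^'n \<Rightarrow> real^'n \<Rightarrow> real^'n) \<Rightarrow> (real^'n \<Rightarrow> real^'n) \<Rightarrow> bool" where
  "left_inv gmul V \<longleftrightarrow> smooth_on UNIV V \<and>
     (\<forall>x y. V (gmul x y) = frechet_derivative (gmul x) (at y) (V y))"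

text \<open>Lie bracket of vector fields: [V,W] f = V(W f) - W(V f).\<close>
definition lie_bracket :: "(real^'n \<Rightarrow> real^'n) \<Rightarrow> (real^'n \<Rightarrow> real^'n) \<Rightarrow> real^'n \<Rightarrow> real^'n" where
  "lie_bracket V W x = frechet_derivative W (at x) (V x) - frechet_derivative V (at x) (W x)"

definition Xfield :: "(real^'n \<Rightarrow> real^'n \<Rightarrow> real^'n) \<Rightarrow> 'n \<Rightarrow> real^'n \<Rightarrow> real^'n" where
  "Xfield gmul i = (THE V. left_inv gmul V \<and> V 0 = axis i 1)"

inductive_set lie_gen :: "((real^'n \<Rightarrow> real^'n) set) \<Rightarrow> (real^'n \<Rightarrow> real^'n) set"
  for G where
  base: "V \<in> G \<Longrightarrow> V \<in> lie_gen G"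
| zero: "(\<lambda>x. 0) \<in> lie_gen G"
| add: "V \<in> lie_gen G \<Longrightarrow> W \<in> lie_gen G \<Longrightarrow> (\<lambda>x. V x + W x) \<in> lie_gen G"
| scale: "V \<in> lie_gen G \<Longrightarrow> (\<lambda>x. c *\<^sub>R V x) \<in> lie_gen G"
| bracket: "V \<in> lie_gen G \<Longrightarrow> W \<in> lie_gen G \<Longrightarrow> lie_bracket V W \<in> lie_gen G"

definition lie_group_law :: "(real^'n \<Rightarrow> real^'n \<Rightarrow> real^'n) \<Rightarrow> bool" where
  "lie_group_law gmul \<longleftrightarrow>
     (\<forall>x y z. gmul (gmul x y) z = gmul x (gmul y z)) \<and>
     (\<exists>e inv. (\<forall>x. gmul e x = x \<and> gmul x e = x) \<and>
              (\<forall>x. gmul x (inv x) = e \<and> gmul (inv x) x = e) \<and>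
              smooth_on UNIV inv) \<and>
     smooth_on UNIV (\<lambda>(x, y). gmul x y)"

definition carnot_group :: "(real^'n \<Rightarrow> real^'n \<Rightarrow> real^'n) \<Rightarrow> ('n::finite \<Rightarrow> nat) \<Rightarrow> bool" where
  "carnot_group gmul deg \<longleftrightarrow>
     lie_group_law gmul \<and> (\<forall>i. deg i \<ge> 1) \<and>
     (\<forall>t>0. \<forall>x y. dil deg t (gmul x y) = gmul (dil deg t x) (dil deg t y)) \<and>
     (\<forall>V. left_inv gmul V \<longrightarrow> V \<in> lie_gen {Xfield gmul i | i. deg i = 1})"

text \<open>X_i applied to a function, horizontal gradient (components outside the
first layer set to 0, so its Euclidean norm is |nabla_L u|), and L_p.\<close>
definition Xop :: "(real^'n \<Rightarrow> real^'n \<Rightarrow> real^'n) \<Rightarrow> 'n \<Rightarrow> (real^'n \<Rightarrow> real) \<Rightarrow> real^'n \<Rightarrow> real" where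
  "Xop gmul i f x = frechet_derivative f (at x) (Xfield gmul i x)"

definition hgrad :: "(real^'n \<Rightarrow> real^'n \<Rightarrow> real^'n) \<Rightarrow> ('n::finite \<Rightarrow> nat) \<Rightarrow> (real^'n \<Rightarrow> real) \<Rightarrow> real^'n \<Rightarrow> real^'n" where
  "hgrad gmul deg f x = (\<chi> i. if deg i = 1 then Xop gmul i f x else 0)"

definition subLaplacian :: "(real^'n \<Rightarrow> real^'n \<Rightarrow> real^'n) \<Rightarrow> ('n::finite \<Rightarrow> nat) \<Rightarrow> (real^'n \<Rightarrow> real) \<Rightarrow> real^'n \<Rightarrow> real" where
  "subLaplacian gmul deg f x = (\<Sum>i | deg i = 1. Xop gmul i (Xop gmul i f) x)"

definition hom_norm_fund :: "(real^'n \<Rightarrow> real^'n \<Rightarrow> real^'n) \<Rightarrow> ('n::finite \<Rightarrow> nat) \<Rightarrow> (real^'n \<Rightarrow> real) \<Rightarrow> bool" where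
  "hom_norm_fund gmul deg N \<longleftrightarrow>
     continuous_on UNIV N \<and> N 0 = 0 \<and> (\<forall>x. x \<noteq> 0 \<longrightarrow> N x > 0) \<and>
     (\<forall>t>0. \<forall>x. N (dil deg t x) = t * N x) \<and>
     smooth_on (UNIV - {0}) N \<and>
     (\<forall>\<phi>. test_fn UNIV \<phi> \<longrightarrow>
        integrable lebesgue (\<lambda>x. N x powr (2 - hdim deg) * subLaplacian gmul deg \<phi> x) \<and>
        (\<integral>x. N x powr (2 - hdim deg) * (- subLaplacian gmul deg \<phi> x) \<partial>lebesgue) = \<phi> 0)"

definition Gamma_p :: "('n::finite \<Rightarrow> nat) \<Rightarrow> (real^'n \<Rightarrow> real) \<Rightarrow> real \<Rightarrow> real^'n \<Rightarrow> real" where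
  "Gamma_p deg N p x = (if p \<noteq> hdim deg then N x powr ((p - hdim deg) / (p - 1)) else - ln (N x))"

definition Lp_harmonic_on :: "(real^'n \<Rightarrow> real^'n \<Rightarrow> real^'n) \<Rightarrow> ('n::finite \<Rightarrow> nat) \<Rightarrow> real \<Rightarrow> (real^'n) set \<Rightarrow> (real^'n \<Rightarrow> real) \<Rightarrow> bool" where
  "Lp_harmonic_on gmul deg p U f \<longleftrightarrow>
     (\<forall>\<phi>. test_fn U \<phi> \<longrightarrow>
        (\<integral>x. norm (hgrad gmul deg f x) powr (p - 2) *
              (hgrad gmul deg f x \<bullet> hgrad gmul deg \<phi> x) \<partial>lebesgue) = 0)"

definition wint :: "(real^'n) set \<Rightarrow> (real^'n \<Rightarrow> real) \<Rightarrow> ennreal" where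
  "wint \<Omega> f = (\<integral>\<^sup>+ x. indicator \<Omega> x * ennreal (f x) \<partial>lebesgue)"

text \<open>An element of D^{1,p}_L(Omega,w) is represented by a pair (u, g) with g its
horizontal gradient: a limit of test functions phi_k converging a.e. to u with
gradients converging to g in the weighted norm.\<close>
definition Dsp :: "(real^'n \<Rightarrow> real^'n \<Rightarrow> real^'n) \<Rightarrow> ('n::finite \<Rightarrow> nat) \<Rightarrow> real \<Rightarrow> (real^'n) set \<Rightarrow> (real^'n \<Rightarrow> real)
     \<Rightarrow> ((real^'n \<Rightarrow> real) \<times> (real^'n \<Rightarrow> real^'n)) set" where
  "Dsp gmul deg p \<Omega> w = {(u, g). g \<in> borel_measurable lebesgue \<and>
     (\<exists>\<phi>. (\<forall>k. test_fn \<Omega> (\<phi> k)) \<and>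
          (AE x in lebesgue. x \<in> \<Omega> \<longrightarrow> (\<lambda>k. \<phi> k x) \<longlonglongrightarrow> u x) \<and>
          (\<lambda>k. wint \<Omega> (\<lambda>x. norm (hgrad gmul deg (\<phi> k) x - g x) powr p * w x)) \<longlonglongrightarrow> 0)}"

end

theory Submission
  imports Defs
begin

text \<open>
Write \<open>Q\<close> for the homogeneous dimension. Harmonicity of \<open>\<Gamma>\<^sub>p\<close> says that the field
\<open>N\<^bsup>1-Q\<^esup> |\<nabla>N|\<^bsup>p-2\<^esup> \<nabla>N\<close> is weakly divergence free off the origin, in both cases
\<open>p \<noteq> Q\<close> and \<open>p = Q\<close>. Testing this with \<open>F(N) |u|\<^bsup>p\<^esup>\<close>, where \<open>F(s) = s\<^bsup>Q+\<beta>\<^esup>\<close> or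
\<open>F(s) = ln(R/s)\<^bsup>\<beta>+1\<^esup>\<close>, and applying Young's inequality pointwise gives both inequalities
for test functions. If \<open>0 \<in> \<Omega>\<close> then \<open>F\<close> is increasing, so multiplying it by an increasing cutoff
of \<open>N\<close> only adds a term of the favourable sign, and no limit of that term has to be computed.

For sharpness take \<open>u = exp(\<gamma> \<tau>(N)) G(\<tau>(N))\<close> with \<open>\<tau>(s) = - ln s\<close>, \<open>\<gamma> = (Q+\<beta>)/p\<close>, or
\<open>\<tau>(s) = ln(ln(R/s))\<close>, \<open>\<gamma> = -(\<beta>+1)/p\<close>. The two sides become \<open>\<integral> G\<^bsup>p\<^esup> d\<mu>\<close> and
\<open>\<integral> |\<gamma> G + G'|\<^bsup>p\<^esup> d\<mu>\<close> for a measure \<open>\<mu>\<close> on the line whose unit intervals have masses bounded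
above and bounded away from 0; let \<open>G\<close> be a plateau of growing length. The bounds come from the
dilation invariance of \<open>N\<^bsup>-Q\<^esup> |\<nabla>N|\<^bsup>p\<^esup> d\<xi>\<close>. It is not the zero measure: otherwise
\<open>\<nabla>N = 0\<close> off the origin, and a function of \<open>N\<close> that is 1 near 0 would contradict the
fundamental solution property.
\<close>

section \<open>Smooth functions\<close>

text \<open>The weights enter only through a triple (F, w, v) with c w \<le> \<sigma> F' s^(1-Q) and
  F s^(1-Q) = v^(1/p) w^((p-1)/p), where \<sigma> is 1 for increasing and -1 for decreasing F. The
  divergence-free field bounds the integral of c w |u|^p |\<nabla>N|^p by a cross term; Young with
  weight c/p absorbs all of it except the fraction c/p of the main term, and this is the origin of
  the constant (c/p)^p. Two obstacles shape the argument. Harmonicity is available only against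
  smooth functions supported off the origin, so |u|^p is smoothed and integrals are first taken over
  compact sets away from 0, where they are finite. And |\<nabla>N| may vanish, so N^(-Q)
  |\<nabla>N|^p d\<xi> is treated as one measure and pushed forward to the line; polar coordinates
  do not occur. For sharpness, \<gamma> is the exponent for which exp(\<gamma> \<tau>)^p cancels the
  weights on both sides at once. The competitors are test functions, so the constant sequence puts
  them into the Sobolev space.\<close>

lemma smoothk_cong:
  assumes "open S" "\<And>x. x \<in> S \<Longrightarrow> f x = g x"
  shows "smoothk k S (f::'a::real_normed_vector \<Rightarrow> 'b::real_normed_vector) = smoothk k S g"
  using assms(2)
proof (induction k arbitrary: f g)
  case 0
  then show ?case by (simp cong: continuous_on_cong)
next
  case (Suc k)
  have *: "smoothk (Suc k) S g" if fg: "\<And>x. x \<in> S \<Longrightarrow> f x = g x" and f: "smoothk (Suc k) S f" for f g :: "'a \<Rightarrow> 'b"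
  proof -
    have fd: "f differentiable at x" if "x \<in> S" for x
      using f that assms(1) differentiable_on_eq_differentiable_at by auto
    have gd: "(g has_derivative frechet_derivative f (at x)) (at x)" if "x \<in> S" for x
      by (rule has_derivative_transform_within_open[OF _ assms(1) that fg])
        (use fd[OF that] in \<open>simp_all add: frechet_derivative_works\<close>)
    have "g differentiable_on S"
      using gd has_derivative_at_withinI unfolding differentiable_on_def differentiable_def by blast
    moreover have "smoothk k S (\<lambda>x. frechet_derivative g (at x) v)" for v
    proof -
      have "smoothk k S (\<lambda>x. frechet_derivative f (at x) v) = smoothk k S (\<lambda>x. frechet_derivative g (at x) v)"
        by (rule Suc.IH) (use frechet_derivative_at[OF gd] in metis)
      then show ?thesis using f by simp
    qed
    ultimately show ?thesis by simp
  qed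
  show ?case using *[of f g] *[of g f] Suc.prems by metis
qed

text \<open>Lets a computed derivative stand in for \<open>frechet_derivative\<close>, which is
  defined by choice: at points of an open set derivatives are unique, so the two agree.\<close>

lemma smoothk_SucI:
  fixes f :: "'a::real_normed_vector \<Rightarrow> 'b::real_normed_vector"
  assumes "open S" "\<And>x. x \<in> S \<Longrightarrow> (f has_derivative f' x) (at x)"
    and "\<And>v. smoothk k S (\<lambda>x. f' x v)"
  shows "smoothk (Suc k) S f"
proof -
  have "f differentiable_on S"
    using assms(2) has_derivative_at_withinI unfolding differentiable_on_def differentiable_def by blast
  moreover have "smoothk k S (\<lambda>x. frechet_derivative f (at x) v)" for v
    using smoothk_cong[OF assms(1), of "\<lambda>x. frechet_derivative f (at x) v" "\<lambda>x. f' x v" k] assms(3)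
      frechet_derivative_at[OF assms(2)] by metis
  ultimately show ?thesis by simp
qed

lemma smoothk_SucD:
  assumes "open S" "smoothk (Suc k) S f" "x \<in> S"
  shows "(f has_derivative frechet_derivative f (at x)) (at x)"
  using assms by (simp add: differentiable_on_eq_differentiable_at frechet_derivative_works)

lemma smoothk_Suc_imp:
  "smoothk (Suc k) S f \<Longrightarrow> smoothk k S f"
  by (induction k arbitrary: f) (auto intro: differentiable_imp_continuous_on)

lemma smoothk_subset: "smoothk k S f \<Longrightarrow> T \<subseteq> S \<Longrightarrow> smoothk k T f"
  by (induction k arbitrary: f) (auto intro: continuous_on_subset differentiable_on_subset)

lemma smoothk_const: "smoothk k S (\<lambda>x. c)"
  by (induction k arbitrary: c) auto

lemma smoothk_linear:
  assumes "bounded_linear f" "open S" shows "smoothk k S f"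
proof (cases k)
  case 0
  then show ?thesis using assms by (simp add: linear_continuous_on)
next
  case (Suc m)
  show ?thesis unfolding Suc
    by (rule smoothk_SucI[where f'="\<lambda>x. f"])
      (use assms in \<open>auto intro: bounded_linear_imp_has_derivative smoothk_const\<close>)
qed

lemma smoothk_add:
  fixes f g :: "'a::real_normed_vector \<Rightarrow> 'b::real_normed_vector"
  assumes "open S" shows "smoothk k S f \<Longrightarrow> smoothk k S g \<Longrightarrow> smoothk k S (\<lambda>x. f x + g x)"
proof (induction k arbitrary: f g)
  case (Suc k)
  show ?case
    by (rule smoothk_SucI[OF assms has_derivative_add[OF smoothk_SucD smoothk_SucD]])
      (use assms Suc in auto)
qed (simp add: continuous_on_add)

lemma smoothk_mult:
  fixes f g :: "'a::real_normed_vector \<Rightarrow> real"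
  assumes "open S" shows "smoothk k S f \<Longrightarrow> smoothk k S g \<Longrightarrow> smoothk k S (\<lambda>x. f x * g x)"
proof (induction k arbitrary: f g)
  case (Suc k)
  have "smoothk k S (\<lambda>x. f x * frechet_derivative g (at x) v + frechet_derivative f (at x) v * g x)" for v
    using Suc.prems smoothk_Suc_imp[OF Suc.prems(1)] smoothk_Suc_imp[OF Suc.prems(2)]
    by (intro smoothk_add assms Suc.IH) auto
  then show ?case
    by (intro smoothk_SucI[OF assms has_derivative_mult[OF smoothk_SucD smoothk_SucD]])
      (use assms Suc.prems in \<open>auto simp del: smoothk.simps\<close>)
qed (simp add: continuous_on_mult)

text \<open>The outer function lives on the real line, so the chain rule is a product of scalar
  functions and the induction on the outer function closes with \<open>smoothk_mult\<close>.
  Vector-valued inner maps occur only in the linear case,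
  \<open>smoothk_compose_linear\<close>.\<close>

lemma smoothk_compose:
  fixes f :: "'a::real_normed_vector \<Rightarrow> real" and g :: "real \<Rightarrow> real"
  assumes "open S" "open T"
  shows "smoothk k T g \<Longrightarrow> smoothk k S f \<Longrightarrow> f ` S \<subseteq> T \<Longrightarrow> smoothk k S (\<lambda>x. g (f x))"
proof (induction k arbitrary: g)
  case 0
  then show ?case by (auto intro: continuous_on_compose2)
next
  case (Suc k)
  let ?g = "\<lambda>y. frechet_derivative g (at y) 1"
  have "smoothk k S (\<lambda>x. ?g (f x))"
    by (rule Suc.IH) (use Suc.prems smoothk_Suc_imp[OF Suc.prems(2)] in auto)
  then have 1: "smoothk k S (\<lambda>x. ?g (f x) * frechet_derivative f (at x) v)" for v
    using Suc.prems(2) by (intro smoothk_mult assms) auto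
  have 2: "((\<lambda>x. g (f x)) has_derivative (\<lambda>v. ?g (f x) * frechet_derivative f (at x) v)) (at x)" if "x \<in> S" for x
  proof -
    have fx: "f x \<in> T" using that Suc.prems by blast
    have gd: "(g has_derivative frechet_derivative g (at (f x))) (at (f x))"
      using smoothk_SucD[OF assms(2) Suc.prems(1) fx] .
    have fd: "(f has_derivative frechet_derivative f (at x)) (at x)"
      using smoothk_SucD[OF assms(1) Suc.prems(2) that] .
    have lin: "linear (frechet_derivative g (at (f x)))" using gd has_derivative_linear by blast
    have "frechet_derivative g (at (f x)) = (\<lambda>h. ?g (f x) * h)"
    proof
      show "frechet_derivative g (at (f x)) h = ?g (f x) * h" for h
        using linear_scale[OF lin, of h 1] by (simp only: real_scaleR_def mult_1_right mult_1_left mult.commute)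
    qed
    then have "(g has_derivative (\<lambda>h. ?g (f x) * h)) (at (f x))"
      using gd by argo
    from has_derivative_compose[OF fd this] show ?thesis .
  qed
  show ?case by (rule smoothk_SucI[OF assms(1) 2 1])
qed

lemma smoothk_compose_linear:
  fixes f :: "'b::real_normed_vector \<Rightarrow> 'c::real_normed_vector" and L :: "'a::real_normed_vector \<Rightarrow> 'b"
  assumes "bounded_linear L"
  shows "smoothk k UNIV f \<Longrightarrow> smoothk k UNIV (\<lambda>x. f (L x))"
proof (induction k arbitrary: f)
  case 0
  then show ?case using assms by (auto intro: continuous_on_compose2 linear_continuous_on)
next
  case (Suc k)
  show ?case
  proof (rule smoothk_SucI[OF open_UNIV])
    show "((\<lambda>x. f (L x)) has_derivative (\<lambda>v. frechet_derivative f (at (L x)) (L v))) (at x)" for x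
      by (rule has_derivative_compose[OF bounded_linear_imp_has_derivative[OF assms] smoothk_SucD[OF open_UNIV Suc.prems]]) simp
    show "smoothk k UNIV (\<lambda>x. frechet_derivative f (at (L x)) (L v))" for v
      by (rule Suc.IH) (use Suc.prems in auto)
  qed
qed

lemma smoothk_Un:
  fixes f :: "'a::real_normed_vector \<Rightarrow> 'b::real_normed_vector"
  assumes "open S" "open T"
  shows "smoothk k S f \<Longrightarrow> smoothk k T f \<Longrightarrow> smoothk k (S \<union> T) f"
proof (induction k arbitrary: f)
  case 0
  then show ?case using assms by (auto intro: continuous_on_open_Un)
next
  case (Suc k)
  then show ?case using assms by (auto simp: differentiable_on_eq_differentiable_at open_Un)
qed

lemma smooth_on_add:
  fixes f g :: "'a::real_normed_vector \<Rightarrow> 'b::real_normed_vector"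
  shows "open S \<Longrightarrow> smooth_on S f \<Longrightarrow> smooth_on S g \<Longrightarrow> smooth_on S (\<lambda>x. f x + g x)"
  by (simp add: smooth_on_def smoothk_add)

lemma smooth_on_mult:
  fixes f g :: "'a::real_normed_vector \<Rightarrow> real"
  shows "open S \<Longrightarrow> smooth_on S f \<Longrightarrow> smooth_on S g \<Longrightarrow> smooth_on S (\<lambda>x. f x * g x)"
  by (simp add: smooth_on_def smoothk_mult)

lemma smooth_on_const: "smooth_on S (\<lambda>x. c)"
  by (simp add: smooth_on_def smoothk_const)

lemma smooth_on_linear: "bounded_linear f \<Longrightarrow> open S \<Longrightarrow> smooth_on S f"
  by (simp add: smooth_on_def smoothk_linear)

lemma smooth_on_ident: "open S \<Longrightarrow> smooth_on S (\<lambda>x. x)"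
  by (simp add: smooth_on_linear bounded_linear_ident)

lemma smooth_on_compose:
  fixes f :: "'a::real_normed_vector \<Rightarrow> real" and g :: "real \<Rightarrow> real"
  shows "open S \<Longrightarrow> open T \<Longrightarrow> smooth_on T g \<Longrightarrow> smooth_on S f \<Longrightarrow> f ` S \<subseteq> T \<Longrightarrow> smooth_on S (\<lambda>x. g (f x))"
  unfolding smooth_on_def using smoothk_compose by blast

lemma smooth_on_subset: "smooth_on S f \<Longrightarrow> T \<subseteq> S \<Longrightarrow> smooth_on T f"
  unfolding smooth_on_def using smoothk_subset by blast

lemma smooth_on_cong:
  fixes f g :: "'a::real_normed_vector \<Rightarrow> 'b::real_normed_vector"
  shows "open S \<Longrightarrow> (\<And>x. x \<in> S \<Longrightarrow> f x = g x) \<Longrightarrow> smooth_on S f = smooth_on S g"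
  unfolding smooth_on_def using smoothk_cong by blast

lemma smooth_on_diff:
  fixes f g :: "'a::real_normed_vector \<Rightarrow> real"
  assumes "open S" "smooth_on S f" "smooth_on S g"
  shows "smooth_on S (\<lambda>x. f x - g x)"
  using smooth_on_add[OF assms(1,2) smooth_on_mult[OF assms(1) smooth_on_const[of S "-1"] assms(3)]] by simp

lemma smooth_on_has_derivative:
  assumes "open S" "smooth_on S f" "x \<in> S"
  shows "(f has_derivative frechet_derivative f (at x)) (at x)"
  using assms smoothk_SucD[of S 0] unfolding smooth_on_def by blast

lemma smooth_on_frechet_derivative:
  assumes "smooth_on S f"
  shows "smooth_on S (\<lambda>x. frechet_derivative f (at x) v)"
  unfolding smooth_on_def
proof
  fix k show "smoothk k S (\<lambda>x. frechet_derivative f (at x) v)"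
    using assms[unfolded smooth_on_def, rule_format, of "Suc k"] by simp
qed

lemma smooth_on_continuous_on: "smooth_on S f \<Longrightarrow> continuous_on S f"
  unfolding smooth_on_def by (metis smoothk.simps(1))

text \<open>Smoothness is local: the function is zero on the open set \<open>-K\<close>, and U
  together with \<open>-K\<close> covers the space.\<close>

lemma smooth_on_UNIV_of_compact_support:
  fixes f :: "'a::real_normed_vector \<Rightarrow> 'b::real_normed_vector"
  assumes "open U" "smooth_on U f" "closed K" "K \<subseteq> U" "\<And>x. x \<notin> K \<Longrightarrow> f x = 0"
  shows "smooth_on UNIV f"
proof -
  have "smooth_on (-K) f"
    using smooth_on_cong[of "-K" f "\<lambda>_. 0"] assms smooth_on_const by (auto simp: open_Compl)
  then have "smooth_on (U \<union> -K) f"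
    using assms smoothk_Un[of U "-K"] unfolding smooth_on_def by (meson open_Compl)
  moreover have "U \<union> -K = UNIV" using assms by auto
  ultimately show ?thesis by simp
qed

lemma test_fnI:
  fixes f :: "'a::euclidean_space \<Rightarrow> real"
  assumes "open U" "smooth_on U f" "compact K" "K \<subseteq> U" "K \<subseteq> \<Omega>" "\<And>x. x \<notin> K \<Longrightarrow> f x = 0"
  shows "test_fn \<Omega> f"
proof -
  have "closure {x. f x \<noteq> 0} \<subseteq> K"
    by (rule closure_minimal) (use assms compact_imp_closed in auto)
  moreover have "compact (closure {x. f x \<noteq> 0})"
    using calculation assms(3) compact_closure bounded_subset compact_imp_bounded closure_subset
    by (metis order_trans)
  ultimately show ?thesis
    unfolding test_fn_def
    using smooth_on_UNIV_of_compact_support[of U f K] assms compact_imp_closed by blast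
qed

lemma smoothk_realI:
  fixes f f' :: "real \<Rightarrow> real"
  assumes "open S" "\<And>x. x \<in> S \<Longrightarrow> (f has_real_derivative f' x) (at x)" "smoothk k S f'"
  shows "smoothk (Suc k) S f"
proof (rule smoothk_SucI[OF assms(1)])
  show "(f has_derivative (*) (f' x)) (at x)" if "x \<in> S" for x
    using assms(2)[OF that] by (simp add: has_field_derivative_def)
  show "smoothk k S (\<lambda>x. f' x * v)" for v
    by (intro smoothk_mult smoothk_const assms)
qed

lemma smooth_on_powr: "smooth_on {0<..} (\<lambda>x::real. x powr a)"
proof -
  have "smoothk k {0<..} (\<lambda>x::real. x powr a)" for k
  proof (induction k arbitrary: a)
    case 0 then show ?case by (auto intro!: continuous_intros)
  next
    case (Suc k)
    show ?case
      by (rule smoothk_realI[where f'="\<lambda>x. a * x powr (a - 1)"])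
        (auto intro!: smoothk_mult smoothk_const Suc has_real_derivative_powr)
  qed
  then show ?thesis by (simp add: smooth_on_def)
qed

lemma smooth_on_ln: "smooth_on {0<..} (ln :: real \<Rightarrow> real)"
proof -
  have "smoothk k {0<..} (ln :: real \<Rightarrow> real)" for k
  proof (cases k)
    case 0 then show ?thesis by (auto intro!: continuous_intros)
  next
    case (Suc k)
    show ?thesis unfolding Suc
    proof (rule smoothk_realI[where f'="\<lambda>x. x powr (-1)"])
      show "(ln has_real_derivative x powr (-1)) (at x)" if "x \<in> {0<..}" for x
        using that DERIV_ln_divide[of x] by (simp add: powr_minus_divide)
      show "smoothk k {0<..} (\<lambda>x::real. x powr (-1))"
        using smooth_on_powr[of "-1"] unfolding smooth_on_def by blast
    qed simp
  qed
  then show ?thesis by (simp add: smooth_on_def)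
qed

lemma smooth_on_exp: "smooth_on UNIV (exp :: real \<Rightarrow> real)"
proof -
  have "smoothk k UNIV (exp :: real \<Rightarrow> real)" for k
  proof (induction k)
    case 0 then show ?case by (auto intro!: continuous_intros)
  next
    case (Suc k)
    show ?case
      by (rule smoothk_realI[where f'=exp]) (use Suc in \<open>auto intro: DERIV_exp\<close>)
  qed
  then show ?thesis by (simp add: smooth_on_def)
qed

section \<open>A smooth step built from exp(-1/x)\<close>

definition flat :: "nat \<Rightarrow> real \<Rightarrow> real" where
  "flat n x = (if x \<le> 0 then 0 else exp (- (1 / x)) / x ^ n)"

lemma flat_tendsto_0: "(flat n \<longlongrightarrow> 0) (at 0)"
proof -
  have l: "(flat n \<longlongrightarrow> 0) (at_left 0)"
    by (rule tendsto_eventually) (auto simp: eventually_at_filter flat_def)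
  have "((\<lambda>x. (inverse x) ^ n / exp (inverse x)) \<longlongrightarrow> (0::real)) (at_right 0)"
    using filterlim_compose[OF tendsto_power_div_exp_0 filterlim_inverse_at_top_right] .
  then have r: "(flat n \<longlongrightarrow> 0) (at_right 0)"
    by (rule Lim_transform_eventually)
      (auto simp: eventually_at_filter flat_def exp_minus field_simps)
  show ?thesis using l r filterlim_split_at by blast
qed

text \<open>The factor x^(-n) in \<open>flat\<close> makes the family closed under differentiation
  up to linear combinations, so all members are smooth by one induction with n arbitrary.\<close>

lemma flat_has_derivative:
  "(flat n has_real_derivative (- real n * flat (Suc n) x + flat (Suc (Suc n)) x)) (at x)"
proof -
  consider "x < 0" | "x = 0" | "x > 0" by linarith
  then show ?thesis
  proof cases
    case 1
    have "(flat n has_real_derivative 0) (at x)"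
      by (rule has_field_derivative_transform_within_open[OF DERIV_const, where S="{..<0}"])
        (use 1 in \<open>auto simp: flat_def\<close>)
    then show ?thesis using 1 by (simp add: flat_def)
  next
    case 2
    \<comment> \<open>The difference quotient of \<open>flat n\<close> at 0 is
      \<open>flat (Suc n)\<close>, whose limit is known.\<close>
    have "((\<lambda>h. (flat n (0 + h) - flat n 0) / h) \<longlongrightarrow> 0) (at 0)"
      by (rule Lim_transform_eventually[OF flat_tendsto_0[of "Suc n"]])
        (auto simp: flat_def eventually_at_filter)
    then show ?thesis using 2 by (simp add: flat_def DERIV_def)
  next
    case 3
    have "((\<lambda>x. exp (- (1 / x)) / x ^ n) has_real_derivative (- real n * flat (Suc n) x + flat (Suc (Suc n)) x)) (at x)"
      using 3
      apply (auto intro!: derivative_eq_intros simp: flat_def)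
      apply (cases n; simp add: field_simps)
      done
    then show ?thesis
      by (rule has_field_derivative_transform_within_open[where S="{0<..}"])
        (use 3 in \<open>auto simp: flat_def\<close>)
  qed
qed

lemma smooth_on_flat: "smooth_on UNIV (flat n)"
proof -
  have "smoothk k UNIV (flat n)" for k
  proof (induction k arbitrary: n)
    case 0
    have "isCont (flat n) x" for x using flat_has_derivative DERIV_isCont by blast
    then show ?case by (simp add: continuous_at_imp_continuous_on)
  next
    case (Suc k)
    show ?case
      by (rule smoothk_realI[OF open_UNIV flat_has_derivative])
        (intro smoothk_add smoothk_mult smoothk_const Suc open_UNIV)
  qed
  then show ?thesis by (simp add: smooth_on_def)
qed

lemma flat_0_bounds: "0 \<le> flat 0 x" "flat 0 x \<le> 1" "flat 0 x = 0 \<longleftrightarrow> x \<le> 0"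
  by (auto simp: flat_def)

lemma smooth_on_deriv:
  fixes f :: "real \<Rightarrow> real"
  assumes "open S" "smooth_on S f"
  shows "smooth_on S (deriv f)" "\<And>x. x \<in> S \<Longrightarrow> (f has_real_derivative deriv f x) (at x)"
proof -
  show d: "(f has_real_derivative deriv f x) (at x)" if "x \<in> S" for x
    using smooth_on_has_derivative[OF assms that]
    by (metis DERIV_deriv_iff_real_differentiable differentiable_def)
  have "frechet_derivative f (at x) 1 = deriv f x" if "x \<in> S" for x
    using frechet_derivative_at[OF d[OF that, unfolded has_field_derivative_def]] 
    by (metis mult.right_neutral)
  then show "smooth_on S (deriv f)"
    using smooth_on_cong[OF assms(1), of "\<lambda>x. frechet_derivative f (at x) 1" "deriv f"]
      smooth_on_frechet_derivative[OF assms(2), of 1] by simp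
qed

text \<open>The denominator is positive because x and 1 - x are not both nonpositive. It is written
  as a power -1 so that \<open>smooth_on_powr\<close> applies.\<close>

definition sstep :: "real \<Rightarrow> real" where
  "sstep x = flat 0 x * (flat 0 x + flat 0 (1 - x)) powr (-1)"

lemma smooth_on_sstep: "smooth_on UNIV sstep"
proof -
  have a: "smooth_on UNIV (\<lambda>x::real. 1 - x)"
    by (intro smooth_on_diff smooth_on_const smooth_on_ident) auto
  have b: "smooth_on UNIV (\<lambda>x::real. flat 0 x + flat 0 (1 - x))"
    by (intro smooth_on_add smooth_on_flat smooth_on_compose[OF _ _ smooth_on_flat a]) auto
  have pos: "flat 0 x + flat 0 (1 - x) > 0" for x :: real
    by (cases "x > 0") (auto simp: flat_def intro: add_pos_nonneg)
  have c: "smooth_on UNIV (\<lambda>x::real. (flat 0 x + flat 0 (1 - x)) powr (-1))"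
    by (rule smooth_on_compose[OF _ _ smooth_on_powr b]) (use pos in auto)
  show ?thesis unfolding sstep_def[abs_def]
    by (intro smooth_on_mult smooth_on_flat c open_UNIV)
qed

lemma sstep_simps:
  "x \<le> 0 \<Longrightarrow> sstep x = 0" "x \<ge> 1 \<Longrightarrow> sstep x = 1" "0 \<le> sstep x" "sstep x \<le> 1"
proof -
  show "x \<le> 0 \<Longrightarrow> sstep x = 0" by (simp add: sstep_def flat_def)
  show "x \<ge> 1 \<Longrightarrow> sstep x = 1" by (simp add: sstep_def flat_def powr_minus)
  show "0 \<le> sstep x" by (simp add: sstep_def flat_0_bounds)
  have p: "flat 0 x + flat 0 (1 - x) > 0"
    by (cases "x > 0") (auto simp: flat_def intro: add_pos_nonneg)
  then show "sstep x \<le> 1"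
    using flat_0_bounds(1)[of "1-x"] by (simp add: sstep_def powr_minus_divide field_simps)
qed

section \<open>Left-invariant fields and the horizontal gradient\<close>

lemma bounded_linear_dil: "bounded_linear (dil deg t)"
  unfolding dil_def bounded_linear_vec_nth
  by (intro bounded_linear_intros linear_conv_bounded_linear[THEN iffD1] linearI)
    (simp_all add: vec_eq_iff algebra_simps)

lemma dil_dil: "dil deg s (dil deg t x) = dil deg (s * t) x"
  by (simp add: dil_def vec_eq_iff power_mult_distrib)

lemma dil_one: "dil deg 1 x = x"
  by (simp add: dil_def vec_eq_iff)

lemma dil_inverse: "t > 0 \<Longrightarrow> dil deg t (dil deg (1 / t) x) = x"
  by (simp add: dil_dil dil_one)

lemma dil_inverse': "t > 0 \<Longrightarrow> dil deg (1 / t) (dil deg t x) = x"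
  by (simp add: dil_dil dil_one)

lemma dil_eq_0_iff: "t > 0 \<Longrightarrow> dil deg t x = 0 \<longleftrightarrow> x = 0"
  by (auto simp: dil_def vec_eq_iff)

lemma dil_axis: "dil deg t (axis i 1) = t ^ deg i *\<^sub>R axis i (1::real)"
  by (simp add: dil_def vec_eq_iff axis_def)

text \<open>The horizontal gradient as a function of the derivative alone. It is linear in the
  derivative, which reduces the chain and product rules for \<open>hgrad\<close> to those for
  \<open>has_derivative\<close>.\<close>

definition hvec :: "(real^'n \<Rightarrow> real^'n \<Rightarrow> real^'n) \<Rightarrow> ('n::finite \<Rightarrow> nat) \<Rightarrow> real^'n \<Rightarrow> (real^'n \<Rightarrow> real) \<Rightarrow> real^'n" where
  "hvec gmul deg x f' = (\<chi> i. if deg i = 1 then f' (Xfield gmul i x) else 0)"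

lemma hgrad_eq_hvec:
  assumes "(f has_derivative f') (at x)"
  shows "hgrad gmul deg f x = hvec gmul deg x f'"
  unfolding hgrad_def hvec_def Xop_def frechet_derivative_at[OF assms] ..

lemma hvec_scale: "hvec gmul deg x (\<lambda>v. c * f' v) = c *\<^sub>R hvec gmul deg x f'"
  by (simp add: hvec_def vec_eq_iff)

lemma hvec_add: "hvec gmul deg x (\<lambda>v. f' v + g' v) = hvec gmul deg x f' + hvec gmul deg x g'"
  by (simp add: hvec_def vec_eq_iff)

lemma hgrad_compose:
  assumes "(f has_derivative f') (at x)" "(F has_real_derivative D) (at (f x))"
  shows "hgrad gmul deg (\<lambda>x. F (f x)) x = D *\<^sub>R hgrad gmul deg f x"
proof -
  have "((\<lambda>x. F (f x)) has_derivative (\<lambda>v. D * f' v)) (at x)"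
    using has_derivative_compose[OF assms(1) assms(2)[unfolded has_field_derivative_def]] .
  from hgrad_eq_hvec[OF this] show ?thesis
    using hgrad_eq_hvec[OF assms(1)] by (simp add: hvec_scale)
qed

lemma hgrad_mult:
  assumes "(f has_derivative f') (at x)" "(g has_derivative g') (at x)"
  shows "hgrad gmul deg (\<lambda>x. f x * g x) x = f x *\<^sub>R hgrad gmul deg g x + g x *\<^sub>R hgrad gmul deg f x"
proof -
  have "((\<lambda>x. f x * g x) has_derivative (\<lambda>v. f x * g' v + g x * f' v)) (at x)"
    using has_derivative_mult[OF assms] by (simp add: mult.commute)
  from hgrad_eq_hvec[OF this] show ?thesis
    using hgrad_eq_hvec[OF assms(1)] hgrad_eq_hvec[OF assms(2)] by (simp add: hvec_scale hvec_add)
qed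

lemma hgrad_cong_open:
  assumes "open S" "x \<in> S" "\<And>y. y \<in> S \<Longrightarrow> f y = g y" "(g has_derivative g') (at x)"
  shows "hgrad gmul deg f x = hgrad gmul deg g x"
proof -
  have "(f has_derivative g') (at x)"
    by (rule has_derivative_transform_within_open[OF assms(4,1,2)]) (use assms(3) in simp)
  then show ?thesis using hgrad_eq_hvec assms(4) by metis
qed

lemma hgrad_eq_0:
  assumes "open S" "x \<in> S" "\<And>y. y \<in> S \<Longrightarrow> f y = c"
  shows "hgrad gmul deg f x = 0"
  using hgrad_cong_open[OF assms has_derivative_const] hgrad_eq_hvec[OF has_derivative_const, of gmul deg c x]
  by (simp add: hvec_def vec_eq_iff)

section \<open>Left translations and the fields they generate\<close>

locale carnot =
  fixes gmul :: "real^'n \<Rightarrow> real^'n \<Rightarrow> real^'n" and deg :: "'n::finite \<Rightarrow> nat"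
  assumes carnot_group: "carnot_group gmul deg"
begin

lemma deg_pos: "deg i \<ge> 1"
  using carnot_group by (simp add: carnot_group_def)

lemma gmul_assoc: "gmul (gmul x y) z = gmul x (gmul y z)"
  using carnot_group by (simp add: carnot_group_def lie_group_law_def)

lemma dil_gmul: "t > 0 \<Longrightarrow> dil deg t (gmul x y) = gmul (dil deg t x) (dil deg t y)"
  using carnot_group by (simp add: carnot_group_def)

lemma gmul_0: "gmul 0 x = x" "gmul x 0 = x"
proof -
  obtain e where e: "\<And>x. gmul e x = x" "\<And>x. gmul x e = x"
    using carnot_group unfolding carnot_group_def lie_group_law_def by blast
  \<comment> \<open>A dilation fixes the identity element, and 0 is its only fixed point.\<close>
  have "gmul (dil deg 2 e) z = z" for z
    using dil_gmul[of 2 e "dil deg (1/2) z"] by (simp add: dil_inverse e)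
  then have "dil deg 2 e = e" using e by metis
  then have "2 ^ deg i * e $ i = e $ i" for i
    by (metis dil_def vec_lambda_beta)
  moreover have "(2::real) ^ deg i \<noteq> 1" for i
    using deg_pos[of i] by (metis one_less_numeral_iff one_less_power less_irrefl semiring_norm(76) zero_less_one not_one_le_zero le_zero_eq linorder_not_less less_le_trans)
  ultimately have "e = 0" by (simp add: vec_eq_iff)
  then show "gmul 0 x = x" "gmul x 0 = x" using e by auto
qed

abbreviation "gm \<equiv> (\<lambda>(x, y). gmul x y)"

lemma smooth_gm: "smooth_on UNIV gm"
  using carnot_group by (simp add: carnot_group_def lie_group_law_def)

lemma gm_has_derivative: "(gm has_derivative frechet_derivative gm (at z)) (at z)"
  by (rule smooth_on_has_derivative[OF open_UNIV smooth_gm]) simp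

lemma gmul_has_derivative:
  "(gmul x has_derivative (\<lambda>h. frechet_derivative gm (at (x, y)) (0, h))) (at y)"
proof -
  have "((\<lambda>y. gm (x, y)) has_derivative (\<lambda>h. frechet_derivative gm (at (x, y)) (0, h))) (at y)"
    by (rule has_derivative_compose[OF _ gm_has_derivative]) (auto intro!: derivative_eq_intros)
  then show ?thesis by simp
qed

text \<open>The image of e_i under the differential of left translation by x. Taking the derivative
  of the joint map \<open>gm\<close> makes smoothness in x a consequence of
  \<open>smooth_gm\<close>.\<close>

definition lfield :: "'n \<Rightarrow> real^'n \<Rightarrow> real^'n" where
  "lfield i x = frechet_derivative gm (at (x, 0)) (0, axis i 1)"

lemma smooth_lfield: "smooth_on UNIV (lfield i)"
proof -
  have bl: "bounded_linear (\<lambda>x::real^'n. (x, 0::real^'n))"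
    by (intro bounded_linear_intros)
  show ?thesis
    unfolding smooth_on_def lfield_def[abs_def]
    using smoothk_compose_linear[OF bl] smooth_on_frechet_derivative[OF smooth_gm]
    unfolding smooth_on_def by blast
qed

lemma lfield_0: "lfield i 0 = axis i 1"
proof -
  have "gmul 0 = (\<lambda>x. x)" using gmul_0 by blast
  then have "((\<lambda>x. x) has_derivative (\<lambda>h. frechet_derivative gm (at (0, 0)) (0, h))) (at 0)"
    using gmul_has_derivative[of 0 0] by simp
  then have "(\<lambda>h. frechet_derivative gm (at (0, 0)) (0, h)) = (\<lambda>h. h)"
    using has_derivative_unique has_derivative_ident by blast
  then show ?thesis unfolding lfield_def by metis
qed

text \<open>Differentiate the associative law (x y) z = x (y z) in z at z = 0.\<close>

lemma left_inv_lfield: "left_inv gmul (lfield i)"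
proof -
  have "lfield i (gmul x y) = frechet_derivative (gmul x) (at y) (lfield i y)" for x y
  proof -
    have "((\<lambda>z. gmul x (gmul y z)) has_derivative
        (\<lambda>h. frechet_derivative gm (at (x, gmul y 0)) (0, frechet_derivative gm (at (y, 0)) (0, h)))) (at 0)"
      by (rule has_derivative_compose[OF gmul_has_derivative gmul_has_derivative])
    moreover have "(\<lambda>z. gmul x (gmul y z)) = gmul (gmul x y)" using gmul_assoc by auto
    ultimately have "(gmul (gmul x y) has_derivative
        (\<lambda>h. frechet_derivative gm (at (x, y)) (0, frechet_derivative gm (at (y, 0)) (0, h)))) (at 0)"
      by (simp add: gmul_0)
    then have "(\<lambda>h. frechet_derivative gm (at (gmul x y, 0)) (0, h)) =
        (\<lambda>h. frechet_derivative gm (at (x, y)) (0, frechet_derivative gm (at (y, 0)) (0, h)))"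
      using has_derivative_unique gmul_has_derivative by blast
    then have "lfield i (gmul x y) = frechet_derivative gm (at (x, y)) (0, lfield i y)"
      unfolding lfield_def by metis
    also have "\<dots> = frechet_derivative (gmul x) (at y) (lfield i y)"
      using frechet_derivative_at[OF gmul_has_derivative[of x y]] by metis
    finally show ?thesis .
  qed
  then show ?thesis using smooth_lfield by (simp add: left_inv_def)
qed

text \<open>\<open>Xfield\<close> is a definite description, and this gives it a value. Uniqueness
  holds because left invariance at y = 0 expresses V x through V 0.\<close>

lemma Xfield_eq: "Xfield gmul i = lfield i"
  unfolding Xfield_def
proof (rule the_equality)
  show "left_inv gmul (lfield i) \<and> lfield i 0 = axis i 1"
    using left_inv_lfield lfield_0 by blast
  fix V assume V: "left_inv gmul V \<and> V 0 = axis i 1"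
  show "V = lfield i"
  proof
    fix x
    have "V (gmul x 0) = frechet_derivative (gmul x) (at 0) (V 0)"
      "lfield i (gmul x 0) = frechet_derivative (gmul x) (at 0) (lfield i 0)"
      using V left_inv_lfield unfolding left_inv_def by blast+
    then show "V x = lfield i x" using V lfield_0 gmul_0 by metis
  qed
qed

text \<open>Differentiate the automorphism property in the second factor at 0; e_i is an eigenvector
  of the dilation with eigenvalue t^(deg i).\<close>

lemma dil_Xfield:
  assumes "t > 0"
  shows "dil deg t (Xfield gmul i x) = t ^ deg i *\<^sub>R Xfield gmul i (dil deg t x)"
proof -
  let ?D = "\<lambda>x h. frechet_derivative gm (at (x, 0)) (0, h)"
  have "((\<lambda>z. dil deg t (gmul x z)) has_derivative (\<lambda>h. dil deg t (?D x h))) (at 0)"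
    by (rule has_derivative_compose[OF gmul_has_derivative bounded_linear_imp_has_derivative[OF bounded_linear_dil]])
  moreover have "((\<lambda>z. gmul (dil deg t x) (dil deg t z)) has_derivative (\<lambda>h. ?D (dil deg t x) (dil deg t h))) (at 0)"
  proof -
    have "dil deg t 0 = 0" using assms dil_eq_0_iff by blast
    then have "(gmul (dil deg t x) has_derivative ?D (dil deg t x)) (at (dil deg t 0))"
      using gmul_has_derivative by metis
    then show ?thesis
      by (rule has_derivative_compose[OF bounded_linear_imp_has_derivative[OF bounded_linear_dil]])
  qed
  ultimately have "(\<lambda>h. dil deg t (?D x h)) = (\<lambda>h. ?D (dil deg t x) (dil deg t h))"
    using dil_gmul[OF assms] has_derivative_unique by simp blast
  then have "dil deg t (?D x (axis i 1)) = ?D (dil deg t x) (dil deg t (axis i 1))" by metis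
  also have "\<dots> = t ^ deg i *\<^sub>R ?D (dil deg t x) (axis i 1)"
    using linear_scale[OF has_derivative_linear[OF gmul_has_derivative[of "dil deg t x" 0]]]
    by (simp only: dil_axis)
  finally show ?thesis by (simp add: Xfield_eq lfield_def)
qed

lemma continuous_Xfield: "continuous_on S (Xfield gmul i)"
  using smooth_on_continuous_on[OF smooth_lfield[of i]] continuous_on_subset by (auto simp: Xfield_eq)

lemma continuous_on_hgrad:
  assumes "open S" "smooth_on S f"
  shows "continuous_on S (hgrad gmul deg f)"
proof -
  have "continuous_on S (\<lambda>x. Xop gmul i f x)" for i
  proof -
    \<comment> \<open>Smoothness of f controls derivatives in a fixed direction, so the moving
      direction \<open>Xfield gmul i x\<close> is expanded in the standard basis.\<close>
    have "continuous_on S (\<lambda>x. \<Sum>j\<in>UNIV. Xfield gmul i x $ j * frechet_derivative f (at x) (axis j 1))"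
      by (intro continuous_intros continuous_Xfield smooth_on_continuous_on
          smooth_on_frechet_derivative assms)
    moreover have "(\<Sum>j\<in>UNIV. Xfield gmul i x $ j * frechet_derivative f (at x) (axis j 1)) = Xop gmul i f x"
      if "x \<in> S" for x
    proof -
      have lin: "linear (frechet_derivative f (at x))"
        using has_derivative_linear[OF smooth_on_has_derivative[OF assms that]] .
      have "frechet_derivative f (at x) (Xfield gmul i x)
          = frechet_derivative f (at x) (\<Sum>j\<in>UNIV. Xfield gmul i x $ j *\<^sub>R axis j 1)"
        by (metis (no_types, lifting) basis_expansion scalar_mult_eq_scaleR sum.cong)
      also have "\<dots> = (\<Sum>j\<in>UNIV. Xfield gmul i x $ j * frechet_derivative f (at x) (axis j 1))"
        by (simp add: linear_sum[OF lin] linear_scale[OF lin])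
      finally show ?thesis by (simp add: Xop_def)
    qed
    ultimately show ?thesis by (simp cong: continuous_on_cong)
  qed
  then have "continuous_on S (\<lambda>x. if deg i = 1 then Xop gmul i f x else 0)" for i
    by (cases "deg i = 1") simp_all
  then show ?thesis
    unfolding hgrad_def[abs_def] by (rule continuous_on_vec_lambda)
qed

end

section \<open>The homogeneous norm\<close>

text \<open>The dilation is diagonal, and its Jacobian determinant is the product of the t^(deg i),
  that is t^Q.\<close>

lemma nn_integral_dil:
  fixes deg :: "'n::finite \<Rightarrow> nat"
  assumes "t > 0" "f \<in> borel_measurable lebesgue"
  shows "(\<integral>\<^sup>+ x. f x \<partial>lebesgue) = ennreal (t powr hdim deg) * (\<integral>\<^sup>+ x. f (dil deg t x) \<partial>lebesgue)"
proof -
  let ?c = "\<lambda>j::real^'n. dil deg t j \<bullet> j"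
  \<comment> \<open>The dilation in the diagonal affine form of
    \<open>lebesgue_affine_euclidean\<close>.\<close>
  let ?T = "\<lambda>x. 0 + (\<Sum>j\<in>Basis. (?c j * (x \<bullet> j)) *\<^sub>R j)"
  have B: "(Basis :: (real^'n) set) = (\<lambda>i. axis i 1) ` UNIV" by (auto simp: Basis_vec_def)
  have c: "?c (axis i 1) = t ^ deg i" for i
    by (simp add: dil_axis inner_axis_axis)
  have nz: "?c j \<noteq> 0" if "j \<in> Basis" for j
    using that assms by (auto simp: B c)
  have T: "?T = dil deg t"
  proof
    fix x show "?T x = dil deg t x"
    proof (rule euclidean_eqI)
      fix b :: "real^'n" assume b: "b \<in> Basis"
      then obtain i where i: "b = axis i 1" using B by auto
      have "?T x \<bullet> b = ?c b * (x \<bullet> b)"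
        using b by (simp add: inner_sum_left inner_Basis if_distrib cong: if_cong)
      also have "\<dots> = dil deg t x \<bullet> b"
        by (simp add: i c inner_axis) (simp add: dil_def)
      finally show "?T x \<bullet> b = dil deg t x \<bullet> b" .
    qed
  qed
  have P: "(\<Prod>j\<in>Basis. \<bar>?c j\<bar>) = t powr hdim deg"
  proof -
    have "(\<Prod>j\<in>Basis. \<bar>?c j\<bar>) = (\<Prod>i\<in>UNIV. t ^ deg i)"
      unfolding B using assms(1) by (subst prod.reindex) (auto simp: inj_on_def axis_eq_axis c)
    also have "\<dots> = t ^ (\<Sum>i\<in>UNIV. deg i)" by (simp add: power_sum)
    also have "\<dots> = t powr hdim deg" using assms(1) by (simp add: hdim_def powr_realpow flip: of_nat_sum)
    finally show ?thesis .
  qed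
  have m: "dil deg t \<in> lebesgue \<rightarrow>\<^sub>M lebesgue"
    using lebesgue_affine_measurable[of ?c 0] nz unfolding T by blast
  have L: "lebesgue = density (distr lebesgue lebesgue (dil deg t)) (\<lambda>_. t powr hdim deg)"
    using lebesgue_affine_euclidean[of ?c 0] nz unfolding T P by blast
  have "(\<integral>\<^sup>+ x. f x \<partial>lebesgue) = (\<integral>\<^sup>+ x. f x \<partial>density (distr lebesgue lebesgue (dil deg t)) (\<lambda>_. t powr hdim deg))"
    using L by metis
  also have "\<dots> = (\<integral>\<^sup>+ x. ennreal (t powr hdim deg) * f x \<partial>distr lebesgue lebesgue (dil deg t))"
    by (subst nn_integral_density) (use assms(2) in auto)
  also have "\<dots> = (\<integral>\<^sup>+ x. ennreal (t powr hdim deg) * f (dil deg t x) \<partial>lebesgue)"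
    by (subst nn_integral_distr) (use assms(2) m in auto)
  also have "\<dots> = ennreal (t powr hdim deg) * (\<integral>\<^sup>+ x. f (dil deg t x) \<partial>lebesgue)"
    by (rule nn_integral_cmult) (use measurable_compose[OF m assms(2)] in auto)
  finally show ?thesis .
qed

locale carnot_norm = carnot gmul deg
  for gmul :: "real^'n \<Rightarrow> real^'n \<Rightarrow> real^'n" and deg :: "'n::finite \<Rightarrow> nat" +
  fixes N :: "real^'n \<Rightarrow> real"
  assumes hom_norm: "hom_norm_fund gmul deg N"
begin

abbreviation "grad \<equiv> hgrad gmul deg"

lemma continuous_on_N: "continuous_on S N"
  using hom_norm continuous_on_subset unfolding hom_norm_fund_def by blast

lemma N_0: "N 0 = 0" and N_pos: "x \<noteq> 0 \<Longrightarrow> N x > 0"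
  and N_dil: "t > 0 \<Longrightarrow> N (dil deg t x) = t * N x"
  and smooth_N: "smooth_on (UNIV - {0}) N"
  using hom_norm by (auto simp: hom_norm_fund_def)

lemma N_nonneg: "N x \<ge> 0"
  by (cases "x = 0") (use N_0 N_pos in \<open>auto intro: less_imp_le\<close>)

lemma N_pos_iff: "N x > 0 \<longleftrightarrow> x \<noteq> 0"
  using N_0 N_pos by force

lemma measurable_N [measurable]: "N \<in> borel_measurable borel"
  using continuous_on_N borel_measurable_continuous_onI by blast

lemma N_has_derivative:
  "x \<noteq> 0 \<Longrightarrow> (N has_derivative frechet_derivative N (at x)) (at x)"
  by (rule smooth_on_has_derivative[OF _ smooth_N]) (auto simp: open_delete)

lemma continuous_on_grad_N: "0 \<notin> S \<Longrightarrow> continuous_on S (grad N)"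
  by (rule continuous_on_subset[OF continuous_on_hgrad[OF _ smooth_N]]) (auto simp: open_delete)

lemma measurable_grad_N [measurable]: "grad N \<in> borel_measurable borel"
  by (rule borel_measurable_continuous_countable_exceptions[of "{0}"])
    (auto intro: continuous_on_grad_N)

text \<open>N is homogeneous of degree 1, and a first-layer field lowers the degree by 1, so each
  X_i N has degree 0.\<close>

lemma grad_N_dil:
  assumes "t > 0" "x \<noteq> 0"
  shows "grad N (dil deg t x) = grad N x"
proof -
  let ?y = "dil deg t x"
  have y: "?y \<noteq> 0" using assms dil_eq_0_iff by blast
  have "((\<lambda>x. N (dil deg t x)) has_derivative (\<lambda>h. frechet_derivative N (at ?y) (dil deg t h))) (at x)"
    by (rule has_derivative_compose[OF bounded_linear_imp_has_derivative[OF bounded_linear_dil] N_has_derivative[OF y]])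
  moreover have "((\<lambda>x. t * N x) has_derivative (\<lambda>h. t * frechet_derivative N (at x) h)) (at x)"
    by (intro has_derivative_mult_right N_has_derivative assms)
  moreover have "(\<lambda>x. N (dil deg t x)) = (\<lambda>x. t * N x)" using N_dil assms by blast
  ultimately have *: "(\<lambda>h. frechet_derivative N (at ?y) (dil deg t h)) = (\<lambda>h. t * frechet_derivative N (at x) h)"
    using has_derivative_unique by metis
  have "frechet_derivative N (at ?y) (Xfield gmul i ?y) = frechet_derivative N (at x) (Xfield gmul i x)"
    if "deg i = 1" for i
  proof -
    have "t * frechet_derivative N (at x) (Xfield gmul i x) = frechet_derivative N (at ?y) (t *\<^sub>R Xfield gmul i ?y)"
      using fun_cong[OF *, of "Xfield gmul i x"] dil_Xfield[OF assms(1), of i x] that by simp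
    also have "\<dots> = t * frechet_derivative N (at ?y) (Xfield gmul i ?y)"
      using linear_scale[OF has_derivative_linear[OF N_has_derivative[OF y]]] by simp
    finally show ?thesis using assms by simp
  qed
  then show ?thesis by (simp add: hgrad_def Xop_def vec_eq_iff)
qed

text \<open>N is proper. Let c be its minimum on the Euclidean unit sphere. A point y of norm at
  least 1 is carried to the sphere by a dilation with some factor s \<le> 1, so N y \<ge> s N y
  \<ge> c. Hence t r' < c forces \<open>dil deg t x\<close> into the unit ball.\<close>

lemma compact_N_le: "compact {x. N x \<le> r}"
proof -
  \<comment> \<open>Raised to at least 1 so that dividing by \<open>r'\<close> gives a positive
    t.\<close>
  define r' where "r' = max r 1"
  have r': "r' > 0" "r \<le> r'" by (auto simp: r'_def)
  have "compact (sphere (0::real^'n) 1)" by simp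
  moreover have "sphere (0::real^'n) 1 \<noteq> {}" by simp
  ultimately obtain z where z: "norm z = 1" "\<And>y. norm y = 1 \<Longrightarrow> N z \<le> N y"
    using continuous_attains_inf[of "sphere (0::real^'n) 1" N] continuous_on_N by auto
  define c where "c = N z"
  have c: "c > 0" unfolding c_def by (rule N_pos) (use z in auto)
  define t where "t = c / (2 * r')"
  have t: "t > 0" "t * r' < c" using c r' by (auto simp: t_def field_simps)
  have "norm (dil deg t x) < 1" if "N x \<le> r" for x
  proof (rule ccontr)
    let ?y = "dil deg t x"
    assume "\<not> norm ?y < 1"
    then have y: "norm ?y \<ge> 1" by simp
    have "continuous_on {0..1} (\<lambda>s. norm (dil deg s ?y))"
      unfolding dil_def by (intro continuous_intros continuous_on_vec_lambda)
    moreover have "norm (dil deg 0 ?y) \<le> 1"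
    proof -
      have "(0::real) ^ deg i = 0" for i using deg_pos[of i] by (simp add: power_0_left)
      then have "dil deg 0 ?y = 0" unfolding dil_def[of deg 0] by (simp add: vec_eq_iff)
      then show ?thesis by simp
    qed
    moreover have "1 \<le> norm (dil deg 1 ?y)" using y by (simp add: dil_one)
    ultimately obtain s where s: "0 \<le> s" "s \<le> 1" "norm (dil deg s ?y) = 1"
      using IVT'[of "\<lambda>s. norm (dil deg s ?y)" 0 1 1] by auto
    have "s > 0"
    proof (rule ccontr)
      assume "\<not> s > 0"
      then have "s = 0" using s by simp
      moreover have "(0::real) ^ deg i = 0" for i using deg_pos[of i] by (simp add: power_0_left)
      then have "dil deg 0 ?y = 0" unfolding dil_def[of deg 0] by (simp add: vec_eq_iff)
      ultimately show False using s by simp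
    qed
    have "c \<le> N (dil deg s ?y)" unfolding c_def by (rule z(2)) (use s in auto)
    also have "\<dots> = s * (t * N x)" using N_dil \<open>s > 0\<close> t by simp
    also have "\<dots> \<le> 1 * (t * r')"
      by (intro mult_mono) (use s t that r' N_nonneg in auto)
    finally show False using t by simp
  qed
  then have "{x. N x \<le> r} \<subseteq> dil deg (1 / t) ` cball 0 1"
    by (auto intro!: image_eqI[where x="dil deg t x" for x] simp: dil_inverse'[OF t(1)] less_imp_le)
  moreover have "compact (dil deg (1 / t) ` cball 0 1)"
    by (intro compact_continuous_image linear_continuous_on bounded_linear_dil compact_cball)
  moreover have "closed {x. N x \<le> r}"
    by (intro closed_Collect_le continuous_on_N continuous_on_const)
  ultimately show ?thesis
    by (meson bounded_subset compact_eq_bounded_closed)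
qed

lemma compact_N_shell: "compact {x. a \<le> N x \<and> N x \<le> b}"
proof -
  have "{x. a \<le> N x \<and> N x \<le> b} = {x. N x \<le> b} \<inter> {x. a \<le> N x}" by auto
  moreover have "closed {x. a \<le> N x}" by (intro closed_Collect_le continuous_on_N continuous_on_const)
  ultimately show ?thesis using compact_N_le compact_Int_closed by metis
qed

text \<open>On the compact set {N \<le> 1} - U the function N attains a minimum, positive because 0
  lies in U. This minimum serves as r, or 1 if the set is empty.\<close>

lemma N_sublevel_subset:
  assumes "open U" "0 \<in> U"
  obtains r where "r > 0" "{x. N x < r} \<subseteq> U"
proof -
  define K where "K = {x. N x \<le> 1} - U"
  have K: "x \<in> K \<longleftrightarrow> N x \<le> 1 \<and> x \<notin> U" for x by (simp add: K_def)
  have cK: "compact K" unfolding K_def using compact_N_le assms compact_diff by blast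
  show ?thesis
  proof (cases "K = {}")
    case True
    have "{x. N x < 1} \<subseteq> U"
    proof
      fix x assume "x \<in> {x. N x < 1}"
      then have "N x \<le> 1" by simp
      then show "x \<in> U" using K[of x] True by (cases "x \<in> U") simp_all
    qed
    then show ?thesis by (rule that[OF zero_less_one])
  next
    case False
    obtain z where z: "z \<in> K" "\<forall>y\<in>K. N z \<le> N y"
      using continuous_attains_inf[OF cK False continuous_on_N] by (elim bexE)
    have "z \<noteq> 0" "N z \<le> 1" using z(1) assms(2) by (auto simp: K)
    moreover have "{x. N x < N z} \<subseteq> U"
    proof
      fix x assume x: "x \<in> {x. N x < N z}"
      show "x \<in> U"
      proof (rule ccontr)
        assume "x \<notin> U"
        then have "x \<in> K" using x \<open>N z \<le> 1\<close> by (simp add: K)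
        from bspec[OF z(2) this] x show False by simp
      qed
    qed
    ultimately show ?thesis using that[OF N_pos] by simp
  qed
qed

lemma open_N_vimage: "open T \<Longrightarrow> open {x. N x \<in> T}"
  using continuous_on_N[of UNIV] by (metis open_vimage vimage_def)

lemma smooth_on_compose_N:
  fixes F :: "real \<Rightarrow> real"
  assumes "open T" "T \<subseteq> {0<..}" "smooth_on T F"
  shows "smooth_on {x. N x \<in> T} (\<lambda>x. F (N x))"
proof (rule smooth_on_compose[OF open_N_vimage[OF assms(1)] assms(1,3)])
  have "x \<noteq> 0" if "N x \<in> T" for x using that assms N_pos_iff by auto
  then show "smooth_on {x. N x \<in> T} N" by (intro smooth_on_subset[OF smooth_N]) auto
qed (use assms in auto)

lemma grad_compose_N:
  assumes "x \<noteq> 0" "(F has_real_derivative D) (at (N x))"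
  shows "grad (\<lambda>x. F (N x)) x = D *\<^sub>R grad N x"
  using hgrad_compose[OF N_has_derivative[OF assms(1)] assms(2)] .

lemma test_fn_compose_N:
  fixes F :: "real \<Rightarrow> real"
  assumes "open T" "{a..b} \<subseteq> T" "T \<subseteq> {0<..}" "smooth_on T F"
    and "\<And>s. s \<notin> {a..b} \<Longrightarrow> F s = 0" "{x. a \<le> N x \<and> N x \<le> b} \<subseteq> \<Omega>"
  shows "test_fn \<Omega> (\<lambda>x. F (N x))"
  by (rule test_fnI[OF open_N_vimage[OF assms(1)] smooth_on_compose_N[OF assms(1,3,4)] compact_N_shell[of a b]])
    (use assms in auto)

lemma grad_N_nonzero: "\<exists>x. x \<noteq> 0 \<and> grad N x \<noteq> 0"
proof (rule ccontr)
  assume "\<not> ?thesis"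
  then have g0: "grad N x = 0" if "x \<noteq> 0" for x using that by blast
  define F where "F s = sstep (2 - s)" for s :: real
  have sm: "smooth_on UNIV F"
    unfolding F_def[abs_def]
    by (intro smooth_on_compose[OF _ _ smooth_on_sstep] smooth_on_diff smooth_on_const smooth_on_ident) auto
  define \<phi> where "\<phi> x = F (N x)" for x
  have one: "\<phi> x = 1" if "N x < 1" for x using that by (simp add: \<phi>_def F_def sstep_simps)
  have o1: "open {x. N x < 1}" using open_N_vimage[of "{..<1}"] by simp
  \<comment> \<open>N need not be smooth at 0, but \<phi> is constant near 0; the two open pieces
    cover the space.\<close>
  have "smooth_on {x. N x < 1} \<phi>"
    using smooth_on_cong[OF o1, of \<phi> "\<lambda>_. 1"] one smooth_on_const by auto
  moreover have "smooth_on {x. N x \<in> {0<..}} \<phi>"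
    unfolding \<phi>_def[abs_def] by (rule smooth_on_compose_N) (auto intro: smooth_on_subset[OF sm])
  ultimately have "smooth_on ({x. N x < 1} \<union> {x. N x \<in> {0<..}}) \<phi>"
    unfolding smooth_on_def using smoothk_Un[OF o1 open_N_vimage[OF open_greaterThan]] by blast
  moreover have "{x. N x < 1} \<union> {x. N x \<in> {0<..}} = UNIV" by force
  ultimately have "smooth_on UNIV \<phi>" by metis
  then have t: "test_fn UNIV \<phi>"
    by (rule test_fnI[OF open_UNIV _ compact_N_le[of 2]]) (auto simp: \<phi>_def F_def sstep_simps)
  have g: "grad \<phi> x = 0" for x
  proof (cases "x = 0")
    case True
    show ?thesis by (rule hgrad_eq_0[OF o1 _ one]) (use True N_0 in auto)
  next
    case False
    show ?thesis
      using grad_compose_N[OF False smooth_on_deriv(2)[OF open_UNIV sm]] g0[OF False]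
      by (simp add: \<phi>_def[abs_def])
  qed
  have "Xop gmul i \<phi> = (\<lambda>x. 0)" if "deg i = 1" for i
  proof
    fix x show "Xop gmul i \<phi> x = 0"
      using arg_cong[OF g[of x], of "\<lambda>v. v $ i"] that by (simp add: hgrad_def)
  qed
  then have "subLaplacian gmul deg \<phi> x = 0" for x
    unfolding subLaplacian_def by (intro sum.neutral) (auto simp: Xop_def)
  then have "\<phi> 0 = 0"
    using hom_norm t unfolding hom_norm_fund_def by auto
  moreover have "\<phi> 0 = 1" using one N_0 by simp
  ultimately show False by simp
qed

end

section \<open>Passing from test functions to the weighted Sobolev space\<close>

text \<open>Convexity at the combination (1-t) (a/(1-t)) + t (b/t). Unlike the crude factor 2^(p-1),
  the coefficient of a^p tends to 1 as t goes to 0, so no constant is lost in the limit.\<close>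

lemma powr_add_le_convex:
  fixes a b t p :: real
  assumes "0 < t" "t < 1" "0 \<le> a" "0 \<le> b" "p > 1"
  shows "(a + b) powr p \<le> (1 - t) powr (1 - p) * a powr p + t powr (1 - p) * b powr p"
proof -
  have ge1: "1 \<le> s powr (1 - p)" if "0 < s" "s < 1" for s :: real
    using that assms(5) powr_mono2'[of "1-p" s 1] by simp
  have e: "s * (c / s) powr p = s powr (1 - p) * c powr p" if "0 < s" "c > 0" for s c :: real
    using that by (simp add: powr_divide powr_diff)
  consider "a = 0" | "b = 0" | "a > 0" "b > 0" using assms by linarith
  then show ?thesis
  proof cases
    case 1
    then show ?thesis using assms mult_right_mono[OF ge1[of t], of "b powr p"] by simp
  next
    case 2
    then show ?thesis using assms mult_right_mono[OF ge1[of "1 - t"], of "a powr p"] by simp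
  next
    case 3
    have "((1 - t) * (a / (1 - t)) + t * (b / t)) powr p \<le> (1 - t) * (a / (1 - t)) powr p + t * (b / t) powr p"
      using convex_onD[OF powr_convex[of p], of t "a / (1 - t)" "b / t"] assms 3 by simp
    then show ?thesis using assms 3 e[of t b] e[of "1-t" a] by simp
  qed
qed

text \<open>Young's inequality for l^(1-p) A and l B. The powers of l cancel in the product on the
  left, so l is a free weight between the two terms; it is set to c/p later.\<close>

lemma young_powr:
  fixes A B l p :: real
  assumes "A \<ge> 0" "B \<ge> 0" "l > 0" "p > 1"
  shows "p * (A powr (1 / p) * B powr ((p - 1) / p)) \<le> l powr (1 - p) * A + (p - 1) * (l * B)"
proof (cases "A = 0 \<or> B = 0")
  case True
  then show ?thesis using assms by auto
next
  case False
  let ?X = "l powr (1 - p) * A" and ?Y = "l * B"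
  have "?X powr (1 / p) * ?Y powr ((p - 1) / p) \<le> 1 / p * ?X + (p - 1) / p * ?Y"
    by (rule Youngs_inequality_0) (use False assms in \<open>auto simp: field_simps\<close>)
  moreover have "?X powr (1 / p) * ?Y powr ((p - 1) / p)
      = (l powr ((1 - p) / p) * l powr ((p - 1) / p)) * (A powr (1 / p) * B powr ((p - 1) / p))"
    using assms by (simp add: powr_mult powr_powr)
  moreover have "l powr ((1 - p) / p) * l powr ((p - 1) / p) = 1"
    using assms by (simp flip: powr_add add_divide_distrib)
  ultimately have "A powr (1 / p) * B powr ((p - 1) / p) \<le> (?X + (p - 1) * ?Y) / p"
    by (simp add: add_divide_distrib)
  then show ?thesis using assms by (simp add: field_simps)
qed

lemma borel_imp_lebesgue [simp]: "f \<in> borel_measurable borel \<Longrightarrow> f \<in> borel_measurable lebesgue"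
  by (simp add: measurable_completion)

lemma wint_cong_AE:
  "AE x in lebesgue. x \<in> \<Omega> \<longrightarrow> f x = g x \<Longrightarrow> wint \<Omega> f = wint \<Omega> g"
  unfolding wint_def by (rule nn_integral_cong_AE) (auto split: split_indicator)

text \<open>One point is ignored because the weights have junk values at the origin, e.g. \<open>0 powr 0 = 0\<close>.\<close>

lemma wint_cong: "(\<And>x. x \<in> \<Omega> \<Longrightarrow> x \<noteq> a \<Longrightarrow> f x = g x) \<Longrightarrow> wint \<Omega> f = wint \<Omega> g"
  by (rule wint_cong_AE, rule AE_I'[of "{a}"]) auto

lemma wint_mono: "(\<And>x. x \<in> \<Omega> \<Longrightarrow> f x \<le> g x) \<Longrightarrow> wint \<Omega> f \<le> wint \<Omega> g"
  unfolding wint_def by (rule nn_integral_mono) (auto split: split_indicator intro: ennreal_leI)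

text \<open>Recovers the factor 1 after a sum has been split with parameter t by
  \<open>powr_add_le_convex\<close>.\<close>

lemma ennreal_le_of_mult_le:
  fixes x y :: ennreal
  assumes "\<And>t. 0 < t \<Longrightarrow> t < 1 \<Longrightarrow> x \<le> ennreal ((1 - t) powr c) * y"
  shows "x \<le> y"
proof (cases "y = top")
  case False
  have "((\<lambda>t::real. (1 - t) powr c) \<longlongrightarrow> (1 - 0) powr c) (at_right 0)"
    by (intro tendsto_intros) simp_all
  then have "((\<lambda>t. ennreal ((1 - t) powr c)) \<longlongrightarrow> ennreal 1) (at_right 0)"
    by (intro tendsto_ennrealI) simp
  then have "((\<lambda>t. y * ennreal ((1 - t) powr c)) \<longlongrightarrow> y * ennreal 1) (at_right 0)"
    by (rule ennreal_tendsto_cmult[rotated]) (use False in \<open>simp add: top.not_eq_extremum\<close>)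
  moreover have "eventually (\<lambda>t. x \<le> y * ennreal ((1 - t) powr c)) (at_right 0)"
    using eventually_at_right_less[of "0::real"] eventually_at_right_field[of _ "0::real"] assms
    by (auto simp: mult.commute eventually_at_right_field intro!: exI[of _ 1])
  ultimately have "x \<le> y * ennreal 1"
    by (rule tendsto_lowerbound) simp
  then show ?thesis by simp
qed simp

text \<open>Fatou in the shape needed twice: for test functions approximating an element of
  \<open>Dsp\<close>, and for cutoffs near the origin that tend to 1.\<close>

lemma nn_integral_Fatou_bound:
  assumes [measurable]: "\<And>n. f n \<in> borel_measurable M"
    and lim: "AE x in M. (\<lambda>n. f n x) \<longlonglongrightarrow> h x"
    and le: "\<And>n. ennreal K * (\<integral>\<^sup>+ x. f n x \<partial>M) \<le> B n"
  shows "ennreal K * (\<integral>\<^sup>+ x. h x \<partial>M) \<le> liminf B"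
proof -
  have "(\<integral>\<^sup>+ x. h x \<partial>M) = (\<integral>\<^sup>+ x. liminf (\<lambda>n. f n x) \<partial>M)"
    by (rule nn_integral_cong_AE, use lim in eventually_elim) (simp add: lim_imp_Liminf)
  also have "\<dots> \<le> liminf (\<lambda>n. \<integral>\<^sup>+ x. f n x \<partial>M)"
    by (rule nn_integral_liminf) measurable
  finally have "ennreal K * (\<integral>\<^sup>+ x. h x \<partial>M) \<le> ennreal K * liminf (\<lambda>n. \<integral>\<^sup>+ x. f n x \<partial>M)"
    by (rule mult_left_mono) simp
  also have "\<dots> \<le> liminf (\<lambda>n. ennreal K * (\<integral>\<^sup>+ x. f n x \<partial>M))"
  \<comment> \<open>The constant is moved inside the liminf by testing with every y below the left
    side.\<close>
  proof (rule le_Liminf_iff[THEN iffD2], intro allI impI)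
    fix y assume y: "y < ennreal K * liminf (\<lambda>n. \<integral>\<^sup>+ x. f n x \<partial>M)"
    show "eventually (\<lambda>n. y < ennreal K * (\<integral>\<^sup>+ x. f n x \<partial>M)) sequentially"
    proof (cases "K > 0")
      case False then show ?thesis using y by (simp add: ennreal_neg)
    next
      case True
      have "y / ennreal K < liminf (\<lambda>n. \<integral>\<^sup>+ x. f n x \<partial>M)"
        using y True by (simp add: divide_less_ennreal mult.commute)
      then have "eventually (\<lambda>n. y / ennreal K < (\<integral>\<^sup>+ x. f n x \<partial>M)) sequentially"
        by (rule less_LiminfD)
      then show ?thesis
        by eventually_elim (use True in \<open>simp add: divide_less_ennreal mult.commute\<close>)
    qed
  qed
  also have "\<dots> \<le> liminf B"
    by (rule Liminf_mono) (use le in simp)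
  finally show ?thesis .
qed

context carnot
begin

lemma test_fn_smooth: "test_fn \<Omega> \<phi> \<Longrightarrow> smooth_on UNIV \<phi>"
  by (simp add: test_fn_def)

lemma test_fn_measurable: "test_fn \<Omega> \<phi> \<Longrightarrow> \<phi> \<in> borel_measurable borel"
  using borel_measurable_continuous_onI smooth_on_continuous_on test_fn_smooth by blast

lemma test_fn_hgrad_measurable: "test_fn \<Omega> \<phi> \<Longrightarrow> hgrad gmul deg \<phi> \<in> borel_measurable borel"
  using borel_measurable_continuous_onI continuous_on_hgrad[OF open_UNIV] test_fn_smooth by blast

text \<open>On the left, a.e. convergence of the approximating functions suffices by Fatou. On the
  right, the liminf of their energies is at most the energy of g: split off g - \<nabla>\<phi>_k
  with parameter t, let k tend to infinity, and only then let t tend to 0. Infinite energies are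
  covered.\<close>

lemma hardy_Dsp:
  assumes \<Omega>: "open \<Omega>" and p: "p > 1" and K: "K \<ge> 0"
    and W: "W \<in> borel_measurable borel" "\<And>x. W x \<ge> 0"
    and v: "v \<in> borel_measurable borel" "\<And>x. v x \<ge> 0"
    and test: "\<And>\<phi>. test_fn \<Omega> \<phi> \<Longrightarrow> ennreal K * wint \<Omega> (\<lambda>x. \<bar>\<phi> x\<bar> powr p * W x)
          \<le> wint \<Omega> (\<lambda>x. norm (hgrad gmul deg \<phi> x) powr p * v x)"
    and ug: "(u, g) \<in> Dsp gmul deg p \<Omega> v"
  shows "ennreal K * wint \<Omega> (\<lambda>x. \<bar>u x\<bar> powr p * W x) \<le> wint \<Omega> (\<lambda>x. norm (g x) powr p * v x)"
proof -
  obtain \<phi> where g: "g \<in> borel_measurable lebesgue" and \<phi>: "\<And>k. test_fn \<Omega> (\<phi> k)"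
    and ae: "AE x in lebesgue. x \<in> \<Omega> \<longrightarrow> (\<lambda>k. \<phi> k x) \<longlonglongrightarrow> u x"
    and lim: "(\<lambda>k. wint \<Omega> (\<lambda>x. norm (hgrad gmul deg (\<phi> k) x - g x) powr p * v x)) \<longlonglongrightarrow> 0"
    using ug unfolding Dsp_def by auto
  have [measurable]: "\<Omega> \<in> sets lebesgue"
    using \<Omega> by (metis borel_open sets_completionI_sets sets_lborel)
  have [measurable]: "W \<in> borel_measurable lebesgue" "v \<in> borel_measurable lebesgue" "g \<in> borel_measurable lebesgue"
    using W v g by simp_all
  have [measurable]: "\<phi> k \<in> borel_measurable lebesgue" "hgrad gmul deg (\<phi> k) \<in> borel_measurable lebesgue" for k
    using test_fn_measurable[OF \<phi>] test_fn_hgrad_measurable[OF \<phi>] by simp_all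
  let ?B = "\<lambda>k. wint \<Omega> (\<lambda>x. norm (hgrad gmul deg (\<phi> k) x) powr p * v x)"
  let ?E = "\<lambda>k. wint \<Omega> (\<lambda>x. norm (hgrad gmul deg (\<phi> k) x - g x) powr p * v x)"
  let ?G = "wint \<Omega> (\<lambda>x. norm (g x) powr p * v x)"
  have "ennreal K * wint \<Omega> (\<lambda>x. \<bar>u x\<bar> powr p * W x) \<le> liminf ?B"
    unfolding wint_def[of _ "\<lambda>x. \<bar>u x\<bar> powr p * W x"]
  proof (rule nn_integral_Fatou_bound[where f="\<lambda>k x. indicator \<Omega> x * ennreal (\<bar>\<phi> k x\<bar> powr p * W x)"])
    show "(\<lambda>x. indicator \<Omega> x * ennreal (\<bar>\<phi> k x\<bar> powr p * W x)) \<in> borel_measurable lebesgue" for k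
      by measurable
    show "ennreal K * (\<integral>\<^sup>+ x. indicator \<Omega> x * ennreal (\<bar>\<phi> k x\<bar> powr p * W x) \<partial>lebesgue) \<le> ?B k" for k
      using test[OF \<phi>[of k]] by (simp add: wint_def)
    show "AE x in lebesgue. (\<lambda>k. indicator \<Omega> x * ennreal (\<bar>\<phi> k x\<bar> powr p * W x))
        \<longlonglongrightarrow> indicator \<Omega> x * ennreal (\<bar>u x\<bar> powr p * W x)"
      using ae
    proof eventually_elim
      case (elim x)
      show ?case
      proof (cases "x \<in> \<Omega>")
        case True
        then have l: "(\<lambda>k. \<phi> k x) \<longlonglongrightarrow> u x" using elim by blast
        have "(\<lambda>k. \<bar>\<phi> k x\<bar> powr p * W x) \<longlonglongrightarrow> \<bar>u x\<bar> powr p * W x"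
          by (intro tendsto_intros tendsto_powr2 l) (use p in auto)
        from tendsto_ennrealI[OF this] show ?thesis using True by simp
      qed simp
    qed
  qed
  also have "liminf ?B \<le> ?G"
  proof (rule ennreal_le_of_mult_le[where c="1 - p"])
    fix t :: real assume t: "0 < t" "t < 1"
    have B: "?B k \<le> ennreal ((1 - t) powr (1 - p)) * ?G + ennreal (t powr (1 - p)) * ?E k" for k
    proof -
      let ?h = "hgrad gmul deg (\<phi> k)"
      have "norm (?h x) powr p * v x \<le> (1 - t) powr (1 - p) * (norm (g x) powr p * v x)
          + t powr (1 - p) * (norm (?h x - g x) powr p * v x)" for x
      proof -
        have "norm (?h x) \<le> norm (g x) + norm (?h x - g x)"
          using norm_triangle_ineq[of "g x" "?h x - g x"] by simp
        then have "norm (?h x) powr p \<le> (norm (g x) + norm (?h x - g x)) powr p"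
          using p by (intro powr_mono2) auto
        also have "\<dots> \<le> (1 - t) powr (1 - p) * norm (g x) powr p + t powr (1 - p) * norm (?h x - g x) powr p"
          by (rule powr_add_le_convex) (use t p in auto)
        finally have *: "norm (?h x) powr p \<le> (1 - t) powr (1 - p) * norm (g x) powr p + t powr (1 - p) * norm (?h x - g x) powr p" .
        show ?thesis
          using mult_right_mono[OF * v(2)[of x]] by (simp add: algebra_simps)
      qed
      then have "indicator \<Omega> x * ennreal (norm (?h x) powr p * v x)
          \<le> ennreal ((1 - t) powr (1 - p)) * (indicator \<Omega> x * ennreal (norm (g x) powr p * v x))
          + ennreal (t powr (1 - p)) * (indicator \<Omega> x * ennreal (norm (?h x - g x) powr p * v x))" for x
        using v(2)[of x] by (auto split: split_indicator simp flip: ennreal_mult ennreal_plus intro!: ennreal_leI)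
      then have "?B k \<le> (\<integral>\<^sup>+ x. ennreal ((1 - t) powr (1 - p)) * (indicator \<Omega> x * ennreal (norm (g x) powr p * v x))
          + ennreal (t powr (1 - p)) * (indicator \<Omega> x * ennreal (norm (?h x - g x) powr p * v x)) \<partial>lebesgue)"
        unfolding wint_def by (intro nn_integral_mono)
      also have "\<dots> = ennreal ((1 - t) powr (1 - p)) * ?G + ennreal (t powr (1 - p)) * ?E k"
        unfolding wint_def
        by (subst nn_integral_add, measurable, subst nn_integral_cmult, measurable, subst nn_integral_cmult, measurable)
      finally show ?thesis .
    qed
    have "(\<lambda>k. ennreal ((1 - t) powr (1 - p)) * ?G + ennreal (t powr (1 - p)) * ?E k)
        \<longlonglongrightarrow> ennreal ((1 - t) powr (1 - p)) * ?G + ennreal (t powr (1 - p)) * 0"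
      by (intro tendsto_intros ennreal_tendsto_cmult lim) simp
    then have "liminf (\<lambda>k. ennreal ((1 - t) powr (1 - p)) * ?G + ennreal (t powr (1 - p)) * ?E k)
        = ennreal ((1 - t) powr (1 - p)) * ?G"
      using lim_imp_Liminf[OF sequentially_bot] by fastforce
    then show "liminf ?B \<le> ennreal ((1 - t) powr (1 - p)) * ?G"
      using Liminf_mono[of ?B] B by (metis (no_types, lifting) always_eventually)
  qed
  finally show ?thesis .
qed

end

section \<open>Hardy inequalities for test functions\<close>

text \<open>A smooth replacement for \<open>|u|\<^bsup>p\<^esup>\<close>, which is not smooth at 0 in general; subtracting
  \<open>e\<^bsup>p\<^esup>\<close> preserves supports.\<close>

definition reg_powr :: "real \<Rightarrow> real \<Rightarrow> real \<Rightarrow> real" where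
  "reg_powr p e u = (u\<^sup>2 + e\<^sup>2) powr (p / 2) - e powr p"

lemma reg_powr_0: "e > 0 \<Longrightarrow> reg_powr p e 0 = 0"
  by (simp add: reg_powr_def powr_powr powr_numeral[symmetric] del: powr_numeral)

lemma reg_powr_deriv:
  assumes "e > 0"
  shows "(reg_powr p e has_real_derivative p * u * (u\<^sup>2 + e\<^sup>2) powr (p / 2 - 1)) (at u)"
proof -
  have "u\<^sup>2 + e\<^sup>2 > 0" using assms by (simp add: add_nonneg_pos)
  then show ?thesis
    unfolding reg_powr_def[abs_def]
    by (auto intro!: derivative_eq_intros simp: powr_diff field_simps power2_eq_square)
qed

lemma smooth_on_reg_powr:
  assumes "e > 0" shows "smooth_on UNIV (reg_powr p e)"
proof -
  have "smooth_on UNIV (\<lambda>u::real. u * u + e * e)"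
    by (intro smooth_on_add smooth_on_mult smooth_on_const smooth_on_ident) auto
  then have "smooth_on UNIV (\<lambda>u::real. (u * u + e * e) powr (p / 2))"
    by (rule smooth_on_compose[OF open_UNIV open_greaterThan smooth_on_powr])
      (use assms in \<open>auto simp: add_nonneg_pos\<close>)
  then show ?thesis
    unfolding reg_powr_def[abs_def] power2_eq_square
    by (intro smooth_on_diff smooth_on_const) auto
qed

text \<open>To be read at a point x with s = N x, n = \<nabla>N, z = \<phi>(x), h = \<nabla>\<phi>,
  and F, F', w, v the values at s. The right side is then \<sigma> times the integrand of
  \<open>weak_harmonic\<close> for the test function F(N) \<open>reg_powr p e\<close> (\<phi>). Its
  F' term is at least c w f |n|^p with f = \<open>reg_powr p e z\<close>; the term with h is
  estimated by Cauchy-Schwarz and Young.\<close>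

lemma hardy_pointwise:
  fixes n h :: "'a::real_inner"
  assumes p: "p > 1" and c: "c > 0" and e: "e > 0"
    and \<sigma>: "\<bar>\<sigma>\<bar> = 1" and s: "s > 0" "F \<ge> 0" "w \<ge> 0" "v \<ge> 0"
    and F': "c * w \<le> \<sigma> * F' * s powr (1 - Q)"
    and F: "F * s powr (1 - Q) = v powr (1 / p) * w powr ((p - 1) / p)"
  shows "c / p * (\<bar>z\<bar> powr p * w * norm n powr p) - (c / p) powr (1 - p) * (norm h powr p * v)
      - c * e powr p * (w * norm n powr p)
    \<le> \<sigma> * (s powr (1 - Q) * norm n powr (p - 2)
        * (n \<bullet> (F *\<^sub>R ((p * z * (z\<^sup>2 + e\<^sup>2) powr (p / 2 - 1)) *\<^sub>R h) + reg_powr p e z *\<^sub>R (F' *\<^sub>R n))))"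
proof -
  \<comment> \<open>The regularised |z|: \<open>reg_powr p e z\<close> becomes r^p - e^p, and its
    derivative p z r^(p-2) is at most p r^(p-1) in absolute value.\<close>
  define r where "r = sqrt (z\<^sup>2 + e\<^sup>2)"
  define m where "m = norm n"
  define a where "a = norm h"
  have pos: "z\<^sup>2 + e\<^sup>2 > 0" using e by (simp add: add_nonneg_pos)
  have r: "r > 0" "\<bar>z\<bar> \<le> r" unfolding r_def using pos by (auto intro: real_le_rsqrt)
  have rr: "z\<^sup>2 + e\<^sup>2 = r powr 2" using pos by (simp add: r_def)
  have rp: "(z\<^sup>2 + e\<^sup>2) powr (p / 2) = r powr p" "(z\<^sup>2 + e\<^sup>2) powr (p / 2 - 1) = r powr (p - 2)"
    unfolding rr powr_powr by (simp_all add: algebra_simps)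
  define f where "f = reg_powr p e z"
  have f: "f = r powr p - e powr p" by (simp add: f_def reg_powr_def rp)
  have "e \<le> r" unfolding r_def by (rule real_le_rsqrt) simp
  then have f0: "f \<ge> 0" unfolding f using e p by (simp add: powr_mono2)
  define f' where "f' = p * z * (z\<^sup>2 + e\<^sup>2) powr (p / 2 - 1)"
  have f': "\<bar>f'\<bar> \<le> p * r powr (p - 1)"
  proof -
    have "\<bar>f'\<bar> = p * (\<bar>z\<bar> * r powr (p - 2))" unfolding f'_def rp using p by (simp add: abs_mult)
    also have "\<dots> \<le> p * (r * r powr (p - 2))"
      using r p by (intro mult_left_mono mult_right_mono) auto
    also have "r * r powr (p - 2) = r powr (p - 1)" using r powr_mult_base[of r "p - 2"] by simp
    finally show ?thesis .
  qed
  \<comment> \<open>The case m = 0 is separate because \<open>0 powr (p - 2)\<close> is 0 by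
    convention; both sides vanish there, also for p < 2.\<close>
  have mp: "m powr (p - 2) * (n \<bullet> n) = m powr p"
  proof (cases "m = 0")
    case False
    then have "m > 0" by (simp add: m_def)
    then show ?thesis
      by (simp add: powr_diff m_def power2_norm_eq_inner[symmetric] powr_numeral)
  qed (simp add: m_def)
  have ma: "\<bar>m powr (p - 2) * (n \<bullet> h)\<bar> \<le> m powr (p - 1) * a"
  proof (cases "m = 0")
    case False
    then have "m > 0" by (simp add: m_def)
    have "\<bar>m powr (p - 2) * (n \<bullet> h)\<bar> \<le> m powr (p - 2) * (m * a)"
      unfolding abs_mult m_def a_def by (intro mult_mono Cauchy_Schwarz_ineq2) auto
    also have "\<dots> = m powr (p - 1) * a"
      using \<open>m > 0\<close> powr_mult_base[of m "p - 2"] by (simp add: mult_ac)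
    finally show ?thesis .
  qed (simp add: m_def)
  define g where "g = F * s powr (1 - Q)"
  have g0: "g \<ge> 0" using s by (simp add: g_def)
  let ?A = "a powr p * v" and ?B = "r powr p * w * m powr p"
  have "g * (p * r powr (p - 1)) * (m powr (p - 1) * a)
      = p * (?A powr (1 / p) * ?B powr ((p - 1) / p))"
  proof -
    have "m powr (p - 1) = (m powr p) powr ((p - 1) / p)" "r powr (p - 1) = (r powr p) powr ((p - 1) / p)"
      "a = (a powr p) powr (1 / p)"
      using p r by (simp_all add: powr_powr m_def a_def)
    then show ?thesis
      unfolding g_def F using s p by (simp add: powr_mult)
  qed
  \<comment> \<open>The weight l = c/p: since f = r^p - e^p, taking the part (p-1) (c/p) r^p from
    the main term c f leaves (c/p) r^p - c e^p.\<close>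
  also have "\<dots> \<le> (c / p) powr (1 - p) * ?A + (p - 1) * (c / p * ?B)"
    by (rule young_powr) (use s p c in auto)
  finally have young: "g * (p * r powr (p - 1)) * (m powr (p - 1) * a)
      \<le> (c / p) powr (1 - p) * ?A + (p - 1) * (c / p * ?B)" .
  have "\<bar>\<sigma> * g * f' * (m powr (p - 2) * (n \<bullet> h))\<bar> = g * \<bar>f'\<bar> * \<bar>m powr (p - 2) * (n \<bullet> h)\<bar>"
    using \<sigma> g0 by (simp add: abs_mult)
  also have "\<dots> \<le> g * (p * r powr (p - 1)) * (m powr (p - 1) * a)"
    using f' ma g0 p by (intro mult_mono mult_nonneg_nonneg) (auto simp: a_def)
  finally have cross: "- (\<sigma> * g * f' * (m powr (p - 2) * (n \<bullet> h)))
      \<le> (c / p) powr (1 - p) * ?A + (p - 1) * (c / p * ?B)"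
    using young by linarith
  have main: "c * w * (f * m powr p) \<le> \<sigma> * F' * s powr (1 - Q) * (f * m powr p)"
    using F' f0 by (intro mult_right_mono) auto
  have "\<sigma> * (s powr (1 - Q) * m powr (p - 2) * (n \<bullet> (F *\<^sub>R (f' *\<^sub>R h) + f *\<^sub>R (F' *\<^sub>R n))))
      = \<sigma> * F' * s powr (1 - Q) * (f * (m powr (p - 2) * (n \<bullet> n))) + \<sigma> * g * f' * (m powr (p - 2) * (n \<bullet> h))"
    by (simp add: g_def inner_add_right algebra_simps)
  also have "\<dots> \<ge> c * w * (f * m powr p) - ((c / p) powr (1 - p) * ?A + (p - 1) * (c / p * ?B))"
    using main cross unfolding mp by linarith
  finally have 1: "c * w * (f * m powr p) - ((c / p) powr (1 - p) * ?A + (p - 1) * (c / p * ?B))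
    \<le> \<sigma> * (s powr (1 - Q) * m powr (p - 2) * (n \<bullet> (F *\<^sub>R (f' *\<^sub>R h) + f *\<^sub>R (F' *\<^sub>R n))))" .
  have "c * w * (f * m powr p) - (p - 1) * (c / p * ?B) = c / p * ?B - c * e powr p * (w * m powr p)"
    using p by (simp add: f field_simps)
  moreover have "\<bar>z\<bar> powr p * w * m powr p \<le> ?B"
    using r s p by (intro mult_right_mono powr_mono2) auto
  then have "c / p * (\<bar>z\<bar> powr p * w * m powr p) \<le> c / p * ?B"
    using c p by (intro mult_left_mono) auto
  ultimately have "c / p * (\<bar>z\<bar> powr p * w * m powr p) - (c / p) powr (1 - p) * ?A - c * e powr p * (w * m powr p)
    \<le> \<sigma> * (s powr (1 - Q) * m powr (p - 2) * (n \<bullet> (F *\<^sub>R (f' *\<^sub>R h) + f *\<^sub>R (F' *\<^sub>R n))))"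
    using 1 by linarith
  then show ?thesis unfolding a_def m_def f_def f'_def .
qed

text \<open>Domination replaces continuity: the factor \<open>norm (grad N x) powr (p - 2)\<close>
  in the weak equation may be discontinuous at critical points of N when p \<le> 2.\<close>

lemma integrable_bounded_on_compact:
  fixes h b :: "'a::euclidean_space \<Rightarrow> real"
  assumes "compact K" "continuous_on K b" "h \<in> borel_measurable lebesgue"
    and "\<And>x. x \<in> K \<Longrightarrow> \<bar>h x\<bar> \<le> b x"
  shows "integrable lebesgue (\<lambda>x. indicator K x * h x)"
proof (rule Bochner_Integration.integrable_bound)
  have "integrable lborel (\<lambda>x. indicator K x *\<^sub>R b x)"
    by (rule borel_integrable_compact[OF assms(1,2)])
  then show "integrable lebesgue (\<lambda>x. indicator K x *\<^sub>R b x)"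
    using integrable_completion borel_measurable_integrable by blast
  have [measurable]: "K \<in> sets lebesgue"
    using assms(1) by (metis borel_closed compact_imp_closed sets_completionI_sets sets_lborel)
  note assms(3)[measurable]
  show "(\<lambda>x. indicator K x * h x) \<in> borel_measurable lebesgue" by measurable
  show "AE x in lebesgue. norm (indicator K x * h x) \<le> norm (indicator K x *\<^sub>R b x)"
    using assms(4) by (intro AE_I2) (force split: split_indicator)
qed

section \<open>The weak equation for N\<close>

locale carnot_harmonic = carnot_norm gmul deg N
  for gmul :: "real^'n \<Rightarrow> real^'n \<Rightarrow> real^'n" and deg :: "'n::finite \<Rightarrow> nat" and N :: "real^'n \<Rightarrow> real" +
  fixes p :: real
  assumes p: "p > 1"
    and harmonic: "Lp_harmonic_on gmul deg p (UNIV - {0}) (Gamma_p deg N p)"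
begin

abbreviation "Q \<equiv> hdim deg"

text \<open>The exponent \<alpha> = (p-Q)/(p-1) satisfies (\<alpha>-1)(p-1) = 1-Q; for the
  logarithm, d = -1/N together with p = Q has the same effect. The cases differ only in the nonzero
  factor k, which drops out of an equation with right side 0.\<close>

lemma grad_Gamma_p:
  obtains k where "k \<noteq> 0" "\<And>x. x \<noteq> 0 \<Longrightarrow> \<exists>d. grad (Gamma_p deg N p) x = d *\<^sub>R grad N x \<and>
      \<bar>d\<bar> powr (p - 2) * d = k * N x powr (1 - Q)"
proof (cases "p = Q")
  case True
  show ?thesis
  proof (rule that[of "-1"])
    fix x :: "real^'n" assume x: "x \<noteq> 0"
    have G: "Gamma_p deg N p = (\<lambda>x. - ln (N x))" using True by (simp add: Gamma_p_def[abs_def])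
    have "((\<lambda>s. - ln s) has_real_derivative - (1 / N x)) (at (N x))"
      using N_pos[OF x] by (auto intro!: derivative_eq_intros)
    from grad_compose_N[OF x this] have "grad (Gamma_p deg N p) x = - (1 / N x) *\<^sub>R grad N x"
      unfolding G .
    moreover have "\<bar>- (1 / N x)\<bar> powr (p - 2) * - (1 / N x) = -1 * N x powr (1 - Q)"
      using N_pos[OF x] True by (simp add: powr_divide powr_diff field_simps power2_eq_square)
    ultimately show "\<exists>d. grad (Gamma_p deg N p) x = d *\<^sub>R grad N x \<and>
      \<bar>d\<bar> powr (p - 2) * d = -1 * N x powr (1 - Q)" by blast
  qed simp
next
  case False
  define \<alpha> where "\<alpha> = (p - Q) / (p - 1)"
  have \<alpha>: "\<alpha> \<noteq> 0" using False p by (simp add: \<alpha>_def)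
  show ?thesis
  proof (rule that[of "\<bar>\<alpha>\<bar> powr (p - 2) * \<alpha>"])
    fix x :: "real^'n" assume x: "x \<noteq> 0"
    have G: "Gamma_p deg N p = (\<lambda>x. N x powr \<alpha>)" using False by (simp add: Gamma_p_def[abs_def] \<alpha>_def)
    have "((\<lambda>s. s powr \<alpha>) has_real_derivative \<alpha> * N x powr (\<alpha> - 1)) (at (N x))"
      by (rule has_real_derivative_powr[OF N_pos[OF x]])
    from grad_compose_N[OF x this] have "grad (Gamma_p deg N p) x = (\<alpha> * N x powr (\<alpha> - 1)) *\<^sub>R grad N x"
      unfolding G .
    moreover have "\<bar>\<alpha> * N x powr (\<alpha> - 1)\<bar> powr (p - 2) * (\<alpha> * N x powr (\<alpha> - 1))
        = \<bar>\<alpha>\<bar> powr (p - 2) * \<alpha> * N x powr (1 - Q)"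
    proof -
      have "(\<alpha> - 1) * (p - 2) + (\<alpha> - 1) = (\<alpha> - 1) * (p - 1)" by (simp add: algebra_simps)
      also have "\<dots> = 1 - Q" using p by (simp add: \<alpha>_def field_simps)
      finally have e: "(\<alpha> - 1) * (p - 2) + (\<alpha> - 1) = 1 - Q" .
      have "\<bar>\<alpha> * N x powr (\<alpha> - 1)\<bar> powr (p - 2) * (\<alpha> * N x powr (\<alpha> - 1))
          = \<bar>\<alpha>\<bar> powr (p - 2) * \<alpha> * (N x powr ((\<alpha> - 1) * (p - 2)) * N x powr (\<alpha> - 1))"
        by (simp add: abs_mult powr_mult powr_powr)
      then show ?thesis by (simp flip: powr_add add: e)
    qed
    ultimately show "\<exists>d. grad (Gamma_p deg N p) x = d *\<^sub>R grad N x \<and>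
      \<bar>d\<bar> powr (p - 2) * d = \<bar>\<alpha>\<bar> powr (p - 2) * \<alpha> * N x powr (1 - Q)" by blast
  qed (use \<alpha> in simp)
qed

lemma weak_harmonic:
  assumes "test_fn (UNIV - {0}) \<psi>"
  shows "(\<integral>x. N x powr (1 - Q) * norm (grad N x) powr (p - 2) * (grad N x \<bullet> grad \<psi> x) \<partial>lebesgue) = 0"
proof -
  let ?I = "\<lambda>x. N x powr (1 - Q) * norm (grad N x) powr (p - 2) * (grad N x \<bullet> grad \<psi> x)"
  obtain k where k: "k \<noteq> 0" "\<And>x. x \<noteq> 0 \<Longrightarrow> \<exists>d. grad (Gamma_p deg N p) x = d *\<^sub>R grad N x \<and>
      \<bar>d\<bar> powr (p - 2) * d = k * N x powr (1 - Q)" using grad_Gamma_p by blast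
  have \<psi>[measurable]: "grad \<psi> \<in> borel_measurable lebesgue"
    using test_fn_hgrad_measurable[OF assms] by simp
  have [measurable]: "N \<in> borel_measurable lebesgue" "grad N \<in> borel_measurable lebesgue"
    using measurable_N measurable_grad_N by simp_all
  let ?J = "\<lambda>x. norm (grad (Gamma_p deg N p) x) powr (p - 2) * (grad (Gamma_p deg N p) x \<bullet> grad \<psi> x)"
  have eq: "?J x = k * ?I x" if "x \<noteq> 0" for x
  proof -
    obtain d where d: "grad (Gamma_p deg N p) x = d *\<^sub>R grad N x"
      "\<bar>d\<bar> powr (p - 2) * d = k * N x powr (1 - Q)" using k(2)[OF \<open>x \<noteq> 0\<close>] by blast
    have "?J x = (\<bar>d\<bar> powr (p - 2) * d) * (norm (grad N x) powr (p - 2) * (grad N x \<bullet> grad \<psi> x))"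
      unfolding d(1) by (simp add: powr_mult)
    then show ?thesis unfolding d(2) by (simp add: mult_ac)
  qed
  \<comment> \<open>\<open>integral_cong_AE\<close> asks for measurability of \<open>?J\<close>; it
    is inherited from \<open>?I\<close> by changing one value, at the origin, where the derivative
    of \<Gamma>_p is arbitrary.\<close>
  have J: "?J = (\<lambda>x. if x = 0 then ?J 0 else k * ?I x)"
  proof
    fix x show "?J x = (if x = 0 then ?J 0 else k * ?I x)"
      using eq[of x] by (cases "x = 0") simp_all
  qed
  have "(\<integral>x. k * ?I x \<partial>lebesgue) = (\<integral>x. ?J x \<partial>lebesgue)"
  proof (rule integral_cong_AE)
    show mI: "(\<lambda>x. k * ?I x) \<in> borel_measurable lebesgue" by measurable
    have "{x \<in> space lebesgue. x = (0::real^'n)} = {0}" by auto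
    then have "{x \<in> space lebesgue. x = (0::real^'n)} \<in> sets lebesgue" by simp
    note this[simp]
    have "(\<lambda>x. if x = 0 then ?J 0 else k * ?I x) \<in> borel_measurable lebesgue"
      by (rule measurable_If[OF _ mI]) (rule measurable_const, simp_all)
    from ssubst[where P="\<lambda>f. f \<in> borel_measurable lebesgue", OF J this]
    show "?J \<in> borel_measurable lebesgue" .
    show "AE x in lebesgue. k * ?I x = ?J x"
    proof (rule AE_I')
      show "{x \<in> space lebesgue. k * ?I x \<noteq> ?J x} \<subseteq> {0}"
      proof
        fix x assume "x \<in> {x \<in> space lebesgue. k * ?I x \<noteq> ?J x}"
        then show "x \<in> {0}" using eq[of x] by (cases "x = 0") simp_all
      qed
    qed simp
  qed
  also have "\<dots> = 0"
    using harmonic assms unfolding Lp_harmonic_on_def by blast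
  finally show ?thesis using k(1) by simp
qed


text \<open>Integrate \<open>hardy_pointwise\<close>; the right side gives 0 by
  \<open>weak_harmonic\<close>. As K avoids the origin, the regularisation error is e^p times a
  finite integral and vanishes with e. What remains, multiplied by (c/p)^(p-1), is the claim.
  Condition \<open>off\<close> asks only that \<phi> F(N) vanish off K, so K may be smaller than the
  support of \<phi>: a cutoff near the origin can be built into F.\<close>

lemma hardy_compact:
  fixes F w v :: "real \<Rightarrow> real"
  assumes T: "open T" "T \<subseteq> {0<..}" "smooth_on T F" "continuous_on T w" "continuous_on T v"
    and c: "c > 0" and \<sigma>: "\<bar>\<sigma>\<bar> = 1"
    and pos: "\<And>s. s \<in> T \<Longrightarrow> F s \<ge> 0 \<and> w s \<ge> 0 \<and> v s \<ge> 0"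
    and F': "\<And>s. s \<in> T \<Longrightarrow> c * w s \<le> \<sigma> * deriv F s * s powr (1 - Q)"
    and F: "\<And>s. s \<in> T \<Longrightarrow> F s * s powr (1 - Q) = v s powr (1 / p) * w s powr ((p - 1) / p)"
    and \<phi>: "smooth_on UNIV \<phi>" and K: "compact K" "K \<subseteq> {x. N x \<in> T}"
    and off: "\<And>x. x \<notin> K \<Longrightarrow> \<phi> x = 0 \<or> F (N x) = 0"
  shows "ennreal ((c / p) powr p) * wint K (\<lambda>x. \<bar>\<phi> x\<bar> powr p * (w (N x) * norm (grad N x) powr p))
    \<le> wint K (\<lambda>x. norm (grad \<phi> x) powr p * v (N x))"
proof -
  let ?h1 = "\<lambda>x. \<bar>\<phi> x\<bar> powr p * (w (N x) * norm (grad N x) powr p)"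
  let ?h2 = "\<lambda>x. norm (grad \<phi> x) powr p * v (N x)"
  let ?h3 = "\<lambda>x. w (N x) * norm (grad N x) powr p"
  let ?int = "\<lambda>h. \<integral>x. indicator K x * h x \<partial>lebesgue"
  have K0: "0 \<notin> K" using K T N_0 by auto
  have [continuous_intros]: "continuous_on K (\<lambda>x. w (N x))" "continuous_on K (\<lambda>x. v (N x))"
    using K(2) by (auto intro!: continuous_on_compose2[OF T(4)] continuous_on_compose2[OF T(5)] continuous_on_N)
  have [continuous_intros]: "continuous_on K N" "continuous_on K (grad N)" "continuous_on K \<phi>" "continuous_on K (grad \<phi>)"
    using continuous_on_N continuous_on_grad_N[OF K0] continuous_on_subset[OF smooth_on_continuous_on[OF \<phi>]]
      continuous_on_subset[OF continuous_on_hgrad[OF open_UNIV \<phi>]] by auto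
  have cint: "integrable lebesgue (\<lambda>x. indicator K x * h x)" if "continuous_on K h" for h :: "_ \<Rightarrow> real"
  proof -
    have i: "integrable lborel (\<lambda>x. indicator K x *\<^sub>R h x)" by (rule borel_integrable_compact[OF K(1) that])
    show ?thesis using integrable_completion[OF borel_measurable_integrable[OF i]] i by simp
  qed
  have i1: "integrable lebesgue (\<lambda>x. indicator K x * ?h1 x)"
    using p by (intro cint continuous_intros continuous_on_powr') auto
  have i2: "integrable lebesgue (\<lambda>x. indicator K x * ?h2 x)"
    using p by (intro cint continuous_intros continuous_on_powr') auto
  have i3: "integrable lebesgue (\<lambda>x. indicator K x * ?h3 x)"
    using p by (intro cint continuous_intros continuous_on_powr') auto
  have nn: "?h1 x \<ge> 0" "?h2 x \<ge> 0" "?h3 x \<ge> 0" if "x \<in> K" for x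
    using pos[of "N x"] K(2) that by auto
  have W: "wint K h = ennreal (?int h)"
    if "integrable lebesgue (\<lambda>x. indicator K x * h x)" "\<And>x. x \<in> K \<Longrightarrow> h x \<ge> 0" for h
  proof -
    have "wint K h = (\<integral>\<^sup>+ x. ennreal (indicator K x * h x) \<partial>lebesgue)"
      unfolding wint_def by (intro nn_integral_cong) (auto split: split_indicator)
    also have "\<dots> = ennreal (?int h)"
      by (rule nn_integral_eq_integral[OF that(1)]) (use that(2) in \<open>auto split: split_indicator\<close>)
    finally show ?thesis .
  qed
  have step: "c / p * ?int ?h1 - (c / p) powr (1 - p) * ?int ?h2 \<le> e powr p * (c * ?int ?h3)"
    if e: "e > 0" for e
  proof -
    define \<psi> where "\<psi> x = F (N x) * reg_powr p e (\<phi> x)" for x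
    have sF: "smooth_on {x. N x \<in> T} (\<lambda>x. F (N x))" by (rule smooth_on_compose_N[OF T(1-3)])
    have sf: "smooth_on UNIV (\<lambda>x. reg_powr p e (\<phi> x))"
      by (rule smooth_on_compose[OF open_UNIV open_UNIV smooth_on_reg_powr[OF e] \<phi>]) simp
    have s\<psi>: "smooth_on {x. N x \<in> T} \<psi>"
      unfolding \<psi>_def[abs_def]
      by (intro smooth_on_mult sF smooth_on_subset[OF sf] open_N_vimage T) simp
    have \<psi>0: "\<psi> x = 0" if "x \<notin> K" for x
      using off[OF that] reg_powr_0[OF e] by (auto simp: \<psi>_def)
    have test: "test_fn (UNIV - {0}) \<psi>"
      by (rule test_fnI[OF open_N_vimage[OF T(1)] s\<psi> K]) (use K0 \<psi>0 in auto)
    have grad: "grad \<psi> x = F (N x) *\<^sub>R ((p * \<phi> x * ((\<phi> x)\<^sup>2 + e\<^sup>2) powr (p / 2 - 1)) *\<^sub>R grad \<phi> x)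
        + reg_powr p e (\<phi> x) *\<^sub>R (deriv F (N x) *\<^sub>R grad N x)" if "x \<in> K" for x
    proof -
      have x: "N x \<in> T" "x \<noteq> 0" using that K K0 by auto
      have "grad \<psi> x = F (N x) *\<^sub>R grad (\<lambda>x. reg_powr p e (\<phi> x)) x + reg_powr p e (\<phi> x) *\<^sub>R grad (\<lambda>x. F (N x)) x"
        unfolding \<psi>_def[abs_def]
        by (rule hgrad_mult[OF smooth_on_has_derivative[OF open_N_vimage[OF T(1)] sF]
              smooth_on_has_derivative[OF open_UNIV sf]]) (use x in auto)
      moreover have "grad (\<lambda>x. F (N x)) x = deriv F (N x) *\<^sub>R grad N x"
        by (rule grad_compose_N[OF x(2) smooth_on_deriv(2)[OF T(1) T(3) x(1)]])
      moreover have "grad (\<lambda>x. reg_powr p e (\<phi> x)) x = (p * \<phi> x * ((\<phi> x)\<^sup>2 + e\<^sup>2) powr (p / 2 - 1)) *\<^sub>R grad \<phi> x"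
        by (rule hgrad_compose[OF smooth_on_has_derivative[OF open_UNIV \<phi>] reg_powr_deriv[OF e]]) simp
      ultimately show ?thesis by simp
    qed
    let ?L = "\<lambda>x. N x powr (1 - Q) * norm (grad N x) powr (p - 2) * (grad N x \<bullet> grad \<psi> x)"
    have "grad \<psi> x = 0" if "x \<notin> K" for x
      by (rule hgrad_eq_0[of "- K"]) (use that \<psi>0 K compact_imp_closed in auto)
    then have LK: "indicator K x * ?L x = ?L x" for x by (auto split: split_indicator)
    have [continuous_intros]: "continuous_on K (grad \<psi>)"
      by (rule continuous_on_subset[OF continuous_on_hgrad[OF open_UNIV test_fn_smooth[OF test]]]) simp
    have [measurable]: "N \<in> borel_measurable lebesgue" "grad N \<in> borel_measurable lebesgue"
        "grad \<psi> \<in> borel_measurable lebesgue"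
      using measurable_N measurable_grad_N test_fn_hgrad_measurable[OF test] by simp_all
    have iL: "integrable lebesgue (\<lambda>x. indicator K x * ?L x)"
    proof (rule integrable_bounded_on_compact[OF K(1)])
      show "continuous_on K (\<lambda>x. N x powr (1 - Q) * norm (grad N x) powr (p - 1) * norm (grad \<psi> x))"
      proof (intro continuous_on_mult continuous_on_norm)
        have "N x \<noteq> 0" if "x \<in> K" for x using that K0 N_pos_iff[of x] by auto
        then show "continuous_on K (\<lambda>x. N x powr (1 - Q))"
          by (intro continuous_on_powr continuous_intros) auto
        show "continuous_on K (\<lambda>x. norm (grad N x) powr (p - 1))"
          using p by (intro continuous_on_powr' continuous_intros) auto
      qed (rule \<open>continuous_on K (grad \<psi>)\<close>)
      show "?L \<in> borel_measurable lebesgue" by measurable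
      show "\<bar>?L x\<bar> \<le> N x powr (1 - Q) * norm (grad N x) powr (p - 1) * norm (grad \<psi> x)" for x
      proof (cases "grad N x = 0")
        case False
        have "\<bar>?L x\<bar> \<le> N x powr (1 - Q) * norm (grad N x) powr (p - 2) * (norm (grad N x) * norm (grad \<psi> x))"
          unfolding abs_mult by (intro mult_mono Cauchy_Schwarz_ineq2) auto
        also have "\<dots> = N x powr (1 - Q) * norm (grad N x) powr (p - 1) * norm (grad \<psi> x)"
          using powr_mult_base[of "norm (grad N x)" "p - 2"] by (simp add: mult_ac)
        finally show ?thesis .
      qed simp
    qed
    have "c / p * ?int ?h1 - (c / p) powr (1 - p) * ?int ?h2 - c * e powr p * ?int ?h3
        = (\<integral>x. c / p * (indicator K x * ?h1 x) - (c / p) powr (1 - p) * (indicator K x * ?h2 x)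
            - c * e powr p * (indicator K x * ?h3 x) \<partial>lebesgue)"
      using i1 i2 i3 by simp
    also have "\<dots> \<le> (\<integral>x. \<sigma> * (indicator K x * ?L x) \<partial>lebesgue)"
    proof (rule integral_mono)
      show "integrable lebesgue (\<lambda>x. c / p * (indicator K x * ?h1 x) - (c / p) powr (1 - p) * (indicator K x * ?h2 x)
            - c * e powr p * (indicator K x * ?h3 x))"
        using i1 i2 i3 by simp
      show "integrable lebesgue (\<lambda>x. \<sigma> * (indicator K x * ?L x))"
        using iL by (rule integrable_mult_right)
      fix x
      show "c / p * (indicator K x * ?h1 x) - (c / p) powr (1 - p) * (indicator K x * ?h2 x)
            - c * e powr p * (indicator K x * ?h3 x) \<le> \<sigma> * (indicator K x * ?L x)"
      proof (cases "x \<in> K")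
        case True
        then have s: "N x \<in> T" using K by auto
        show ?thesis
          unfolding grad[OF True]
          using hardy_pointwise[OF p c e \<sigma> _ _ _ _ F'[OF s] F[OF s], of "\<phi> x" "grad N x" "grad \<phi> x"]
            pos[OF s] s T(2) True by auto
      qed simp
    qed
    also have "\<dots> = \<sigma> * (\<integral>x. ?L x \<partial>lebesgue)" unfolding LK by simp
    also have "\<dots> = 0" using weak_harmonic[OF test] by simp
    finally show ?thesis by (simp add: algebra_simps)
  qed
  have "c / p * ?int ?h1 - (c / p) powr (1 - p) * ?int ?h2 \<le> 0 * (c * ?int ?h3)"
  proof (rule tendsto_lowerbound)
    show "((\<lambda>\<eta>. \<eta> * (c * ?int ?h3)) \<longlongrightarrow> 0 * (c * ?int ?h3)) (at_right 0)"
      by (intro tendsto_intros)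
    \<comment> \<open>Substituting e = \<eta>^(1/p) makes the error linear in \<eta>.\<close>
    have "c / p * ?int ?h1 - (c / p) powr (1 - p) * ?int ?h2 \<le> \<eta> * (c * ?int ?h3)" if "\<eta> > 0" for \<eta>
      using step[of "\<eta> powr (1 / p)"] that p by (simp add: powr_powr)
    then show "\<forall>\<^sub>F \<eta> in at_right 0. c / p * ?int ?h1 - (c / p) powr (1 - p) * ?int ?h2 \<le> \<eta> * (c * ?int ?h3)"
      by (auto simp: eventually_at_right_field intro: exI[of _ 1])
  qed simp
  then have le: "(c / p) powr (p - 1) * (c / p * ?int ?h1) \<le> (c / p) powr (p - 1) * ((c / p) powr (1 - p) * ?int ?h2)"
    by (intro mult_left_mono) auto
  have e1: "(c / p) powr (p - 1) * (c / p) = (c / p) powr p"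
    using powr_mult_base[of "c / p" "p - 1"] c p by (simp add: mult.commute)
  have e2: "(c / p) powr (p - 1) * (c / p) powr (1 - p) = 1"
    using c p by (simp flip: powr_add)
  have "(c / p) powr p * ?int ?h1 \<le> ?int ?h2"
    using le unfolding mult.assoc[symmetric, of "(c / p) powr (p - 1)"] e1 e2 by simp
  then have "ennreal ((c / p) powr p) * ennreal (?int ?h1) \<le> ennreal (?int ?h2)"
    by (simp add: ennreal_leI flip: ennreal_mult')
  then show ?thesis using W[OF i1] W[OF i2] nn by simp
qed

end

lemma AE_lebesgue_except:
  fixes a :: "'a::euclidean_space"
  assumes "\<And>x. x \<noteq> a \<Longrightarrow> P x" shows "AE x in lebesgue. P x"
  by (rule AE_I'[of "{a}"]) (use assms in auto)

text \<open>Meant for the unweighted spaces: a weight \<open>N x powr (p + - p)\<close> is 1 except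
  at the origin, where the convention gives 0.\<close>

lemma Dsp_cong:
  "(\<And>x. x \<in> \<Omega> \<Longrightarrow> x \<noteq> a \<Longrightarrow> v x = v' x) \<Longrightarrow> Dsp gmul deg p \<Omega> v = Dsp gmul deg p \<Omega> v'"
proof -
  assume "\<And>x. x \<in> \<Omega> \<Longrightarrow> x \<noteq> a \<Longrightarrow> v x = v' x"
  then have "wint \<Omega> (\<lambda>x. norm (hgrad gmul deg f x - g x) powr p * v x)
      = wint \<Omega> (\<lambda>x. norm (hgrad gmul deg f x - g x) powr p * v' x)" for f g
    by (intro wint_cong[of _ a]) simp
  then show ?thesis unfolding Dsp_def by simp
qed

lemma wint_mono_set: "A \<subseteq> B \<Longrightarrow> wint A f \<le> wint B f"
  unfolding wint_def by (rule nn_integral_mono) (auto split: split_indicator)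

lemma wint_eq_of_subset: "A \<subseteq> B \<Longrightarrow> (\<And>x. x \<in> B - A \<Longrightarrow> f x = 0) \<Longrightarrow> wint B f = wint A f"
  unfolding wint_def by (rule nn_integral_cong) (auto split: split_indicator)

context carnot_harmonic
begin

text \<open>If \<sigma> = -1 the profile F decreases and an increasing cutoff would contribute with
  the wrong sign; this case is confined to 0 outside \<Omega>, where the support of \<phi> is
  already a compact set off the origin. If \<sigma> = 1 the origin is removed by cutoffs.\<close>

lemma hardy_test:
  fixes F w v :: "real \<Rightarrow> real"
  assumes T: "open T" "T \<subseteq> {0<..}" "smooth_on T F" "continuous_on T w" "continuous_on T v"
    and c: "c > 0" and \<sigma>: "\<bar>\<sigma>\<bar> = 1" "\<sigma> = 1 \<or> 0 \<notin> \<Omega>"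
    and w[measurable]: "w \<in> borel_measurable borel" and w0: "\<And>s. w s \<ge> 0" and v0: "\<And>s. v s \<ge> 0"
    and F0: "\<And>s. s \<in> T \<Longrightarrow> F s \<ge> 0"
    and F': "\<And>s. s \<in> T \<Longrightarrow> c * w s \<le> \<sigma> * deriv F s * s powr (1 - Q)"
    and F: "\<And>s. s \<in> T \<Longrightarrow> F s * s powr (1 - Q) = v s powr (1 / p) * w s powr ((p - 1) / p)"
    and \<Omega>: "open \<Omega>" "\<And>x. x \<in> \<Omega> \<Longrightarrow> x \<noteq> 0 \<Longrightarrow> N x \<in> T" and \<phi>: "test_fn \<Omega> \<phi>"
  shows "ennreal ((c / p) powr p) * wint \<Omega> (\<lambda>x. \<bar>\<phi> x\<bar> powr p * (w (N x) * norm (grad N x) powr p))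
    \<le> wint \<Omega> (\<lambda>x. norm (grad \<phi> x) powr p * v (N x))"
proof -
  let ?C = "ennreal ((c / p) powr p)"
  define K where "K = closure {x. \<phi> x \<noteq> 0}"
  have K: "compact K" "K \<subseteq> \<Omega>" using \<phi> by (simp_all add: test_fn_def K_def)
  have off: "\<phi> x = 0" if "x \<notin> K" for x
    using that closure_subset[of "{x. \<phi> x \<noteq> 0}"] unfolding K_def by blast
  have sm: "smooth_on UNIV \<phi>" using test_fn_smooth[OF \<phi>] .
  from \<sigma>(2) show ?thesis
  proof
    assume n0: "0 \<notin> \<Omega>"
    have "?C * wint K (\<lambda>x. \<bar>\<phi> x\<bar> powr p * (w (N x) * norm (grad N x) powr p))
        \<le> wint K (\<lambda>x. norm (grad \<phi> x) powr p * v (N x))"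
    proof (rule hardy_compact[OF T c \<sigma>(1) _ F' F sm K(1)])
      show "K \<subseteq> {x. N x \<in> T}" using K(2) \<Omega>(2) n0 by auto
    qed (use F0 w0 v0 off in auto)
    also have "\<dots> \<le> wint \<Omega> (\<lambda>x. norm (grad \<phi> x) powr p * v (N x))"
      by (rule wint_mono_set[OF K(2)])
    also have "wint K (\<lambda>x. \<bar>\<phi> x\<bar> powr p * (w (N x) * norm (grad N x) powr p))
        = wint \<Omega> (\<lambda>x. \<bar>\<phi> x\<bar> powr p * (w (N x) * norm (grad N x) powr p))"
      by (rule wint_eq_of_subset[symmetric, OF K(2)]) (use off p in auto)
    finally show ?thesis .
  next
    assume \<sigma>1: "\<sigma> = 1"
    let ?B = "wint \<Omega> (\<lambda>x. norm (grad \<phi> x) powr p * v (N x))"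
    \<comment> \<open>Zero for s \<le> 1/(n+1), increasing, below 1, and convergent to 1 at each s >
      0. Monotonicity and the pointwise limit are what counts, so no plateau at height 1 is built
      in.\<close>
    define cut where "cut n s = flat 0 (real (Suc n) * s - 1)" for n :: nat and s :: real
    have aff: "smooth_on UNIV (\<lambda>s::real. real (Suc n) * s - 1)" for n
      by (intro smooth_on_diff smooth_on_mult smooth_on_const smooth_on_ident) auto
    have cut_smooth: "smooth_on UNIV (cut n)" for n
      unfolding cut_def[abs_def] by (rule smooth_on_compose[OF open_UNIV open_UNIV smooth_on_flat aff]) simp
    have cut': "(cut n has_real_derivative real (Suc n) * flat 2 (real (Suc n) * s - 1)) (at s)" for n s
    proof -
      have "((\<lambda>s. real (Suc n) * s - 1) has_real_derivative real (Suc n)) (at s)"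
        by (auto intro!: derivative_eq_intros)
      from DERIV_chain2[OF flat_has_derivative[of 0] this] show ?thesis
        unfolding cut_def[abs_def] by (simp add: mult.commute numeral_2_eq_2)
    qed
    have cut_bounds: "0 \<le> cut n s" "cut n s \<le> 1" for n s using flat_0_bounds by (simp_all add: cut_def)
    have cut_meas[measurable]: "cut n \<in> borel_measurable borel" for n
      using borel_measurable_continuous_onI[OF smooth_on_continuous_on[OF cut_smooth]] .
    have cut_lim: "(\<lambda>n. cut n s) \<longlonglongrightarrow> 1" if "s > 0" for s
    proof -
      have "filterlim (\<lambda>n. real (Suc n)) at_top sequentially"
        using filterlim_compose[OF filterlim_real_sequentially filterlim_Suc] .
      then have top: "filterlim (\<lambda>n. - 1 + s * real (Suc n)) at_top sequentially"
        using that by (intro filterlim_tendsto_add_at_top[OF tendsto_const]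
            filterlim_tendsto_pos_mult_at_top[OF tendsto_const])
      have "(\<lambda>n. exp (- inverse (- 1 + s * real (Suc n)))) \<longlonglongrightarrow> exp (- 0)"
        by (intro tendsto_intros tendsto_inverse_0_at_top top)
      moreover have "eventually (\<lambda>n. exp (- inverse (- 1 + s * real (Suc n))) = cut n s) sequentially"
        using filterlim_at_top_dense[THEN iffD1, OF top, rule_format, of 0]
        by eventually_elim (simp add: cut_def flat_def divide_inverse mult.commute add.commute)
      ultimately show ?thesis
        using Lim_transform_eventually by fastforce
    qed
    have bound: "?C * wint \<Omega> (\<lambda>x. \<bar>\<phi> x\<bar> powr p * (w (N x) * cut n (N x) * norm (grad N x) powr p)) \<le> ?B" for n
    proof -
      define Kn where "Kn = K \<inter> {x. 1 / real (Suc n) \<le> N x}"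
      have "closed {x. 1 / real (Suc n) \<le> N x}" by (intro closed_Collect_le continuous_on_N continuous_on_const)
      then have cKn: "compact Kn" unfolding Kn_def by (intro compact_Int_closed K)
      have Kn\<Omega>: "Kn \<subseteq> \<Omega>" using K(2) by (auto simp: Kn_def)
      have z: "cut n (N x) = 0" if "N x < 1 / real (Suc n)" for x
        using that flat_0_bounds(3) by (simp add: cut_def field_simps)
      have offn: "\<phi> x = 0 \<or> cut n (N x) = 0" if "x \<notin> Kn" for x
        using that off z by (auto simp: Kn_def not_le)
      \<comment> \<open>All three functions get the same factor: the identity between F, v and w is
        homogeneous of degree 1, as 1/p + (p-1)/p = 1, and the derivative inequality gains the
        nonnegative term F \<open>cut\<close>'.\<close>
      let ?F = "\<lambda>s. F s * cut n s" and ?w = "\<lambda>s. w s * cut n s" and ?v = "\<lambda>s. v s * cut n s"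
      have cont_cut: "continuous_on T (cut n)"
        using continuous_on_subset[OF smooth_on_continuous_on[OF cut_smooth]] by blast
      have "?C * wint Kn (\<lambda>x. \<bar>\<phi> x\<bar> powr p * (?w (N x) * norm (grad N x) powr p))
        \<le> wint Kn (\<lambda>x. norm (grad \<phi> x) powr p * ?v (N x))"
      proof (rule hardy_compact[where F="?F" and \<sigma>=1, OF T(1,2) _ _ _ c _ _ _ _ sm cKn])
        show "smooth_on T ?F"
          by (intro smooth_on_mult T smooth_on_subset[OF cut_smooth]) simp
        show "continuous_on T ?w" "continuous_on T ?v"
          by (intro continuous_on_mult T cont_cut)+
        show "0 \<le> ?F s \<and> 0 \<le> ?w s \<and> 0 \<le> ?v s" if "s \<in> T" for s
          using F0[OF that] w0 v0 cut_bounds by simp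
        show "c * ?w s \<le> 1 * deriv ?F s * s powr (1 - Q)" if s: "s \<in> T" for s
        proof -
          have "(?F has_real_derivative F s * (real (Suc n) * flat 2 (real (Suc n) * s - 1)) + deriv F s * cut n s) (at s)"
            using DERIV_mult[OF smooth_on_deriv(2)[OF T(1,3) s] cut'[of n s]] by (simp add: mult_ac add.commute)
          then have d: "deriv ?F s = F s * (real (Suc n) * flat 2 (real (Suc n) * s - 1)) + deriv F s * cut n s"
            by (rule DERIV_imp_deriv)
          have "0 \<le> F s * (real (Suc n) * flat 2 (real (Suc n) * s - 1))"
            using F0[OF s] by (simp add: flat_def)
          then have "deriv F s * cut n s * s powr (1 - Q) \<le> deriv ?F s * s powr (1 - Q)"
            unfolding d by (intro mult_right_mono) auto
          moreover have "c * w s * cut n s \<le> (deriv F s * s powr (1 - Q)) * cut n s"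
            using F'[OF s] \<sigma>1 cut_bounds by (intro mult_right_mono) auto
          ultimately show ?thesis by (simp add: mult_ac)
        qed
        show "?F s * s powr (1 - Q) = ?v s powr (1 / p) * ?w s powr ((p - 1) / p)" if "s \<in> T" for s
        proof -
          have "cut n s powr (1 / p) * cut n s powr ((p - 1) / p) = cut n s"
            using p cut_bounds by (simp flip: powr_add add_divide_distrib)
          moreover have "?v s powr (1 / p) * ?w s powr ((p - 1) / p)
              = (v s powr (1 / p) * w s powr ((p - 1) / p)) * (cut n s powr (1 / p) * cut n s powr ((p - 1) / p))"
            using v0 w0 cut_bounds by (simp add: powr_mult)
          ultimately show ?thesis using F[OF that] by simp
        qed
        show "Kn \<subseteq> {x. N x \<in> T}"
        proof
          fix x assume x: "x \<in> Kn"
          then have "N x > 0" by (auto simp: Kn_def intro: less_le_trans[rotated])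
          then show "x \<in> {x. N x \<in> T}" using x Kn\<Omega> \<Omega>(2) N_pos_iff by auto
        qed
        show "\<phi> x = 0 \<or> ?F (N x) = 0" if "x \<notin> Kn" for x using offn[OF that] by auto
      qed simp
      also have "\<dots> \<le> wint \<Omega> (\<lambda>x. norm (grad \<phi> x) powr p * ?v (N x))"
        by (rule wint_mono_set[OF Kn\<Omega>])
      also have "\<dots> \<le> ?B"
        by (rule wint_mono) (use v0 cut_bounds in \<open>auto intro!: mult_left_mono mult_right_le_one_le\<close>)
      also have "wint Kn (\<lambda>x. \<bar>\<phi> x\<bar> powr p * (?w (N x) * norm (grad N x) powr p))
          = wint \<Omega> (\<lambda>x. \<bar>\<phi> x\<bar> powr p * (?w (N x) * norm (grad N x) powr p))"
      proof (rule wint_eq_of_subset[symmetric, OF Kn\<Omega>])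
        fix x assume "x \<in> \<Omega> - Kn"
        then have "\<phi> x = 0 \<or> cut n (N x) = 0" using offn by blast
        then show "\<bar>\<phi> x\<bar> powr p * (?w (N x) * norm (grad N x) powr p) = 0" using p by auto
      qed
      finally show ?thesis .
    qed
    have [measurable]: "\<phi> \<in> borel_measurable borel" using test_fn_measurable[OF \<phi>] .
    have [measurable]: "\<Omega> \<in> sets borel" using \<Omega>(1) by (rule borel_open)
    have "?C * wint \<Omega> (\<lambda>x. \<bar>\<phi> x\<bar> powr p * (w (N x) * norm (grad N x) powr p)) \<le> liminf (\<lambda>n::nat. ?B)"
      unfolding wint_def[of _ "\<lambda>x. \<bar>\<phi> x\<bar> powr p * (w (N x) * norm (grad N x) powr p)"]
    proof (rule nn_integral_Fatou_bound[where
          f="\<lambda>n x. indicator \<Omega> x * ennreal (\<bar>\<phi> x\<bar> powr p * (w (N x) * cut n (N x) * norm (grad N x) powr p))"])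
      show "(\<lambda>x. indicator \<Omega> x * ennreal (\<bar>\<phi> x\<bar> powr p * (w (N x) * cut n (N x) * norm (grad N x) powr p)))
          \<in> borel_measurable lebesgue" for n
        by (rule borel_imp_lebesgue) measurable
      show "?C * (\<integral>\<^sup>+ x. indicator \<Omega> x * ennreal (\<bar>\<phi> x\<bar> powr p * (w (N x) * cut n (N x) * norm (grad N x) powr p)) \<partial>lebesgue) \<le> ?B" for n
        using bound[of n] by (simp add: wint_def)
      show "AE x in lebesgue. (\<lambda>n. indicator \<Omega> x * ennreal (\<bar>\<phi> x\<bar> powr p * (w (N x) * cut n (N x) * norm (grad N x) powr p)))
          \<longlonglongrightarrow> indicator \<Omega> x * ennreal (\<bar>\<phi> x\<bar> powr p * (w (N x) * norm (grad N x) powr p))"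
      proof (rule AE_lebesgue_except[of 0])
        fix x :: "real^'n" assume x: "x \<noteq> 0"
        have "(\<lambda>n. \<bar>\<phi> x\<bar> powr p * (w (N x) * cut n (N x) * norm (grad N x) powr p))
          \<longlonglongrightarrow> \<bar>\<phi> x\<bar> powr p * (w (N x) * 1 * norm (grad N x) powr p)"
          using x N_pos by (intro tendsto_intros cut_lim) simp
        from tendsto_ennrealI[OF this]
        show "(\<lambda>n. indicator \<Omega> x * ennreal (\<bar>\<phi> x\<bar> powr p * (w (N x) * cut n (N x) * norm (grad N x) powr p)))
          \<longlonglongrightarrow> indicator \<Omega> x * ennreal (\<bar>\<phi> x\<bar> powr p * (w (N x) * norm (grad N x) powr p))"
          by (cases "x \<in> \<Omega>") simp_all
      qed
    qed
    then show ?thesis by (simp add: Liminf_const)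
  qed
qed

lemma hardy_general:
  fixes F w v :: "real \<Rightarrow> real"
  assumes "open T" "T \<subseteq> {0<..}" "smooth_on T F" "continuous_on T w" "continuous_on T v"
    and "c > 0" "\<bar>\<sigma>\<bar> = 1" "\<sigma> = 1 \<or> 0 \<notin> \<Omega>"
    and w[measurable]: "w \<in> borel_measurable borel" and v[measurable]: "v \<in> borel_measurable borel"
    and "\<And>s. w s \<ge> 0" "\<And>s. v s \<ge> 0" "\<And>s. s \<in> T \<Longrightarrow> F s \<ge> 0"
    and "\<And>s. s \<in> T \<Longrightarrow> c * w s \<le> \<sigma> * deriv F s * s powr (1 - Q)"
    and "\<And>s. s \<in> T \<Longrightarrow> F s * s powr (1 - Q) = v s powr (1 / p) * w s powr ((p - 1) / p)"
    and "open \<Omega>" "\<And>x. x \<in> \<Omega> \<Longrightarrow> x \<noteq> 0 \<Longrightarrow> N x \<in> T"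
    and "(u, g) \<in> Dsp gmul deg p \<Omega> (\<lambda>x. v (N x))"
  shows "ennreal ((c / p) powr p) * wint \<Omega> (\<lambda>x. \<bar>u x\<bar> powr p * (w (N x) * norm (grad N x) powr p))
    \<le> wint \<Omega> (\<lambda>x. norm (g x) powr p * v (N x))"
  by (rule hardy_Dsp[OF \<open>open \<Omega>\<close> p _ _ _ _ _ hardy_test[of T F w v c \<sigma>]]) (use assms in simp_all)

section \<open>The power and the logarithmic weights\<close>

lemma hardy_power:
  assumes \<Omega>: "open \<Omega>" "\<beta> + Q < 0 \<longrightarrow> 0 \<notin> \<Omega>"
    and ug: "(u, g) \<in> Dsp gmul deg p \<Omega> (\<lambda>x. N x powr (p + \<beta>))"
  shows "ennreal ((\<bar>Q + \<beta>\<bar> / p) powr p) *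
           wint \<Omega> (\<lambda>x. \<bar>u x\<bar> powr p * (N x powr \<beta> * norm (grad N x) powr p))
         \<le> wint \<Omega> (\<lambda>x. norm (g x) powr p * N x powr (p + \<beta>))"
proof (cases "Q + \<beta> = 0")
  case False
  have d: "deriv (\<lambda>s. s powr (Q + \<beta>)) s = (Q + \<beta>) * s powr (Q + \<beta> - 1)" if "s > 0" for s
    using has_real_derivative_powr[OF that] by (rule DERIV_imp_deriv)
  show ?thesis
  proof (rule hardy_general[where T="{0<..}" and F="\<lambda>s. s powr (Q + \<beta>)" and \<sigma>="sgn (Q + \<beta>)"
        and w="\<lambda>s. s powr \<beta>" and v="\<lambda>s. s powr (p + \<beta>)", OF _ _ smooth_on_powr _ _ _ _ _ _ _ _ _ _ _ _ \<Omega>(1) _ ug])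
    show "\<bar>Q + \<beta>\<bar> * s powr \<beta> \<le> sgn (Q + \<beta>) * deriv (\<lambda>s. s powr (Q + \<beta>)) s * s powr (1 - Q)"
      if "s \<in> {0<..}" for s
    proof -
      have "sgn (Q + \<beta>) * deriv (\<lambda>s. s powr (Q + \<beta>)) s * s powr (1 - Q)
          = (sgn (Q + \<beta>) * (Q + \<beta>)) * (s powr (Q + \<beta> - 1) * s powr (1 - Q))"
        using that d[of s] by simp
      also have "\<dots> = \<bar>Q + \<beta>\<bar> * s powr \<beta>" by (simp add: sgn_mult_self_eq abs_sgn mult.commute flip: powr_add)
      finally show ?thesis by simp
    qed
    show "s powr (Q + \<beta>) * s powr (1 - Q) = (s powr (p + \<beta>)) powr (1 / p) * (s powr \<beta>) powr ((p - 1) / p)"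
      if "s \<in> {0<..}" for s
    proof -
      have "(p + \<beta>) / p + \<beta> * (p - 1) / p = Q + \<beta> + (1 - Q)" using p by (simp add: field_simps)
      then show ?thesis by (simp add: powr_powr flip: powr_add)
    qed
    show "sgn (Q + \<beta>) = 1 \<or> 0 \<notin> \<Omega>" using \<Omega>(2) False by (auto simp: sgn_if)
  qed (use False N_pos in \<open>auto intro!: continuous_intros simp: abs_sgn_eq\<close>)
\<comment> \<open>For Q + \<beta> = 0 the constant is \<open>0 powr p\<close>, that is 0.\<close>
qed (use p in simp)

text \<open>As \<beta> + 1 < 0, the profile ln(R/s)^(\<beta>+1) increases on (0, R), so \<sigma> = 1
  is allowed although 0 lies in the ball. Q = p turns (1/s) s^(1-Q) into the weight s^(-p).\<close>

lemma hardy_log: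
  assumes Q: "Q = p" and R: "R > 0" and \<beta>: "\<beta> < -1"
    and ug: "(u, g) \<in> Dsp gmul deg p {x. N x < R} (\<lambda>x. ln (R / N x) powr (p + \<beta>))"
  shows "ennreal ((\<bar>\<beta> + 1\<bar> / p) powr p) *
           wint {x. N x < R} (\<lambda>x. \<bar>u x\<bar> powr p * (1 / N x powr p * ln (R / N x) powr \<beta> * norm (grad N x) powr p))
         \<le> wint {x. N x < R} (\<lambda>x. norm (g x) powr p * ln (R / N x) powr (p + \<beta>))"
proof -
  let ?T = "{0<..<R}"
  have l: "ln (R / s) > 0" if "s \<in> ?T" for s using that R by (simp add: ln_gt_zero)
  have dl: "((\<lambda>s. ln (R / s)) has_real_derivative - (1 / s)) (at s)" if "s \<in> ?T" for s
    using that R by (auto intro!: derivative_eq_intros simp: field_simps power2_eq_square)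
  have "smooth_on ?T (\<lambda>s. ln R - ln s)"
    by (intro smooth_on_diff smooth_on_const smooth_on_subset[OF smooth_on_ln]) auto
  then have sl: "smooth_on ?T (\<lambda>s. ln (R / s))"
    by (rule smooth_on_cong[THEN iffD1, rotated 2]) (use R in \<open>auto simp: ln_div\<close>)
  have cl: "continuous_on ?T (\<lambda>s. ln (R / s))" by (rule smooth_on_continuous_on[OF sl])
  have sF: "smooth_on ?T (\<lambda>s. ln (R / s) powr (\<beta> + 1))"
    by (rule smooth_on_compose[OF _ open_greaterThan smooth_on_powr sl]) (use l in auto)
  have d: "deriv (\<lambda>s. ln (R / s) powr (\<beta> + 1)) s = (\<beta> + 1) * ln (R / s) powr \<beta> * - (1 / s)" if "s \<in> ?T" for s
  proof -
    have "((\<lambda>s. ln (R / s) powr (\<beta> + 1)) has_real_derivative (\<beta> + 1) * ln (R / s) powr (\<beta> + 1 - 1) * - (1 / s)) (at s)"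
      by (rule DERIV_chain2[OF has_real_derivative_powr[OF l[OF that]] dl[OF that]])
    then show ?thesis by (simp add: DERIV_imp_deriv)
  qed
  have o: "open {x. N x < R}" using open_N_vimage[of "{..<R}"] by simp
  show ?thesis
  proof (rule hardy_general[where T="?T" and F="\<lambda>s. ln (R / s) powr (\<beta> + 1)" and \<sigma>=1
        and w="\<lambda>s. 1 / s powr p * ln (R / s) powr \<beta>" and v="\<lambda>s. ln (R / s) powr (p + \<beta>)",
        OF _ _ sF _ _ _ _ _ _ _ _ _ _ _ _ o _ ug])
    show "continuous_on ?T (\<lambda>s. 1 / s powr p * ln (R / s) powr \<beta>)"
      "continuous_on ?T (\<lambda>s. ln (R / s) powr (p + \<beta>))"
      using l by (auto intro!: continuous_intros cl simp: less_le)
    show "\<bar>\<beta> + 1\<bar> * (1 / s powr p * ln (R / s) powr \<beta>)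
        \<le> 1 * deriv (\<lambda>s. ln (R / s) powr (\<beta> + 1)) s * s powr (1 - Q)" if "s \<in> ?T" for s
    proof -
      have "1 / s powr p = 1 / s * s powr (1 - Q)" using that Q by (simp add: powr_diff)
      then have "(\<beta> + 1) * ln (R / s) powr \<beta> * - (1 / s) * s powr (1 - Q)
          = - (\<beta> + 1) * (1 / s powr p * ln (R / s) powr \<beta>)"
        by (simp only: mult_minus_left mult_minus_right mult_ac)
      then show ?thesis unfolding d[OF that] using \<beta> by simp
    qed
    show "ln (R / s) powr (\<beta> + 1) * s powr (1 - Q) = (ln (R / s) powr (p + \<beta>)) powr (1 / p)
        * (1 / s powr p * ln (R / s) powr \<beta>) powr ((p - 1) / p)" if s: "s \<in> ?T" for s
    proof -
      have e1: "(p + \<beta>) * (1 / p) + \<beta> * ((p - 1) / p) = \<beta> + 1" using p by (simp add: field_simps)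
      have e2: "- p * ((p - 1) / p) = 1 - Q" using p Q by (simp add: field_simps)
      have "1 / s powr p = s powr (- p)" using s by (simp add: powr_minus_divide)
      then have "(1 / s powr p * ln (R / s) powr \<beta>) powr ((p - 1) / p)
          = s powr (1 - Q) * ln (R / s) powr (\<beta> * ((p - 1) / p))"
        by (simp only: powr_mult powr_powr e2 powr_ge_zero)
      then show ?thesis
        unfolding powr_powr by (simp only: e1[symmetric] powr_add) (simp add: mult_ac)
    qed
  qed (use \<beta> N_pos l in \<open>auto simp: less_le\<close>)
qed

end

section \<open>Sharpness\<close>

definition plateau :: "real \<Rightarrow> real \<Rightarrow> real \<Rightarrow> real" where
  "plateau a b t = sstep (t - a) * sstep (b - t)"

definition plateau' :: "real \<Rightarrow> real \<Rightarrow> real \<Rightarrow> real" where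
  "plateau' a b t = deriv sstep (t - a) * sstep (b - t) - sstep (t - a) * deriv sstep (b - t)"

lemma sstep_deriv: "(sstep has_real_derivative deriv sstep x) (at x)"
  using smooth_on_deriv(2)[OF open_UNIV smooth_on_sstep] by simp

lemma deriv_sstep_0: "x < 0 \<or> 1 < x \<Longrightarrow> deriv sstep x = 0"
proof -
  assume "x < 0 \<or> 1 < x"
  then have "(sstep has_real_derivative 0) (at x)"
  proof
    assume x: "x < 0"
    show ?thesis
      by (rule has_field_derivative_transform_within_open[where S="{..<0}" and f="\<lambda>_. 0"])
        (use x in \<open>auto simp: sstep_simps\<close>)
  next
    assume x: "1 < x"
    show ?thesis
      by (rule has_field_derivative_transform_within_open[where S="{1<..}" and f="\<lambda>_. 1"])
        (use x in \<open>auto simp: sstep_simps\<close>)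
  qed
  then show ?thesis by (rule DERIV_imp_deriv)
qed

text \<open>The ramps of every plateau are shifted or reflected copies of this one step, so D serves
  for all lengths.\<close>

lemma deriv_sstep_bounded: obtains D where "D \<ge> 0" "\<And>x. \<bar>deriv sstep x\<bar> \<le> D"
proof -
  have "continuous_on {0..1} (deriv sstep)"
    using continuous_on_subset[OF smooth_on_continuous_on[OF smooth_on_deriv(1)[OF open_UNIV smooth_on_sstep]]] by blast
  then have "bounded (deriv sstep ` {0..1})"
    using compact_continuous_image compact_imp_bounded compact_Icc by blast
  then obtain D where D: "\<And>x. x \<in> {0..1} \<Longrightarrow> \<bar>deriv sstep x\<bar> \<le> D"
    unfolding bounded_iff by (metis imageI real_norm_def)
  have "\<bar>deriv sstep x\<bar> \<le> max D 0" for x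
  proof (cases "x \<in> {0..1}")
    case True then show ?thesis using D[OF True] by simp
  next
    case False then show ?thesis using deriv_sstep_0[of x] by auto
  qed
  then show ?thesis by (intro that[of "max D 0"]) auto
qed

lemma plateau_deriv: "(plateau a b has_real_derivative plateau' a b t) (at t)"
proof -
  have "((\<lambda>t. sstep (t - a)) has_real_derivative deriv sstep (t - a) * 1) (at t)"
    by (rule DERIV_chain2[OF sstep_deriv]) (auto intro!: derivative_eq_intros)
  moreover have "((\<lambda>t. sstep (b - t)) has_real_derivative deriv sstep (b - t) * -1) (at t)"
    by (rule DERIV_chain2[OF sstep_deriv]) (auto intro!: derivative_eq_intros)
  ultimately show ?thesis
    unfolding plateau_def[abs_def] plateau'_def
    by (rule DERIV_cong[OF DERIV_mult]) (simp add: algebra_simps)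
qed

lemma smooth_on_plateau: "smooth_on UNIV (plateau a b)"
proof -
  have 1: "smooth_on UNIV (\<lambda>t::real. t - a)" "smooth_on UNIV (\<lambda>t::real. b - t)"
    by (intro smooth_on_diff smooth_on_const smooth_on_ident open_UNIV)+
  show ?thesis unfolding plateau_def[abs_def]
    by (intro smooth_on_mult open_UNIV smooth_on_compose[OF open_UNIV open_UNIV smooth_on_sstep] 1) auto
qed

lemma measurable_plateau [measurable]:
  "plateau a b \<in> borel_measurable borel" "plateau' a b \<in> borel_measurable borel"
proof -
  show "plateau a b \<in> borel_measurable borel"
    by (rule borel_measurable_continuous_onI[OF smooth_on_continuous_on[OF smooth_on_plateau]])
  have [measurable]: "sstep \<in> borel_measurable borel" "deriv sstep \<in> borel_measurable borel"
    using smooth_on_continuous_on[OF smooth_on_sstep]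
      smooth_on_continuous_on[OF smooth_on_deriv(1)[OF open_UNIV smooth_on_sstep]]
    by (auto intro: borel_measurable_continuous_onI)
  show "plateau' a b \<in> borel_measurable borel" unfolding plateau'_def[abs_def] by measurable
qed

lemma plateau_eq_0: "t \<notin> {a..b} \<Longrightarrow> plateau a b t = 0" "t \<notin> {a..b} \<Longrightarrow> plateau' a b t = 0"
  by (auto simp: plateau_def plateau'_def sstep_simps deriv_sstep_0)

lemma plateau_eq_1:
  "a + 1 < t \<Longrightarrow> t < b - 1 \<Longrightarrow> plateau' a b t = 0"
  "a + 1 \<le> t \<Longrightarrow> t \<le> b - 1 \<Longrightarrow> plateau a b t = 1"
  by (auto simp: plateau_def plateau'_def sstep_simps deriv_sstep_0)

lemma plateau_bounds: "0 \<le> plateau a b t" "plateau a b t \<le> 1"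
  using sstep_simps(3,4) by (auto simp: plateau_def intro!: mult_nonneg_nonneg mult_le_one)

lemma emeasure_atLeastLessThan_ge:
  fixes \<mu> :: "real measure"
  assumes [measurable_cong, simp]: "sets \<mu> = sets borel"
    and low: "\<And>a. a \<ge> a0 \<Longrightarrow> emeasure \<mu> {a..<a + 1} \<ge> ennreal k" and k: "k \<ge> 0"
  shows "a \<ge> a0 \<Longrightarrow> emeasure \<mu> {a..<a + real n} \<ge> ennreal (real n * k)"
proof (induction n)
  case (Suc n)
  have "ennreal (real (Suc n) * k) = ennreal (real n * k) + ennreal k"
    using k by (simp add: algebra_simps flip: ennreal_plus)
  also have "\<dots> \<le> emeasure \<mu> {a..<a + real n} + emeasure \<mu> {a + real n..<a + real n + 1}"
    using Suc low[of "a + real n"] by (intro add_mono) auto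
  also have "\<dots> = emeasure \<mu> ({a..<a + real n} \<union> {a + real n..<a + real n + 1})"
    by (rule plus_emeasure) auto
  also have "{a..<a + real n} \<union> {a + real n..<a + real n + 1} = {a..<a + real (Suc n)}"
    by auto
  finally show ?case .
qed simp

lemma emeasure_atLeastLessThan_le:
  fixes \<mu> :: "real measure"
  assumes [measurable_cong, simp]: "sets \<mu> = sets borel"
    and up: "\<And>a. a \<ge> a0 \<Longrightarrow> emeasure \<mu> {a..<a + 1} \<le> ennreal k" and k: "k \<ge> 0"
  shows "a \<ge> a0 \<Longrightarrow> emeasure \<mu> {a..<a + real n} \<le> ennreal (real n * k)"
proof (induction n)
  case (Suc n)
  have "{a..<a + real (Suc n)} = {a..<a + real n} \<union> {a + real n..<a + real n + 1}"
    by auto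
  then have "emeasure \<mu> {a..<a + real (Suc n)} = emeasure \<mu> {a..<a + real n} + emeasure \<mu> {a + real n..<a + real n + 1}"
    by (simp only:) (rule plus_emeasure[symmetric], auto)
  also have "\<dots> \<le> ennreal (real n * k) + ennreal k"
    using Suc up[of "a + real n"] by (intro add_mono) auto
  also have "\<dots> = ennreal (real (Suc n) * k)"
    using k by (simp add: algebra_simps flip: ennreal_plus)
  finally show ?case .
qed simp

text \<open>On the plateau G = 1 and G' = 0, so the integrands are |\<gamma>|^p and 1. The two ramps
  have length 1 and cost at most L M each, whatever b is, while the mass of the plateau grows at
  least like n k. A surplus C - |\<gamma>|^p > 0 therefore wins for large n.\<close>

lemma plateau_sharp:
  fixes \<mu> :: "real measure"
  assumes [measurable_cong, simp]: "sets \<mu> = sets borel"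
    and low: "\<And>a. a \<ge> a0 \<Longrightarrow> emeasure \<mu> {a..<a + 1} \<ge> ennreal k" and k: "k > 0"
    and up: "\<And>a. a \<ge> a0 \<Longrightarrow> emeasure \<mu> {a..a + 1} \<le> ennreal M" and M: "M \<ge> 0"
    and C: "C > \<bar>\<gamma>\<bar> powr p" and p: "p > 0"
  obtains b where "b > a0"
    "(\<integral>\<^sup>+ t. ennreal (\<bar>\<gamma> * plateau a0 b t + plateau' a0 b t\<bar> powr p) \<partial>\<mu>)
      < ennreal C * (\<integral>\<^sup>+ t. ennreal (plateau a0 b t powr p) \<partial>\<mu>)"
proof -
  obtain D where D: "D \<ge> 0" "\<And>x. \<bar>deriv sstep x\<bar> \<le> D"
    using deriv_sstep_bounded by blast
  define L where "L = (\<bar>\<gamma>\<bar> + 2 * D) powr p"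
  have L0: "L \<ge> 0" by (simp add: L_def)
  \<comment> \<open>Chosen so that the surplus (C - |\<gamma>|^p) n k exceeds the cost 2 L M of both
    ramps.\<close>
  obtain n :: nat where "2 * L * M / ((C - \<bar>\<gamma>\<bar> powr p) * k) < real n"
    using reals_Archimedean2 by blast
  then have n: "2 * L * M < (C - \<bar>\<gamma>\<bar> powr p) * (real n * k)"
    using C k by (simp add: divide_less_eq mult_ac)
  define b where "b = a0 + real n + 2"
  let ?G = "plateau a0 b" and ?G' = "plateau' a0 b"
  let ?m = "{a0 + 1..<b - 1}"
  have mid: "?m = {a0 + 1..<(a0 + 1) + real n}" by (auto simp: b_def)
  have Xlow: "emeasure \<mu> ?m \<ge> ennreal (real n * k)"
    unfolding mid by (rule emeasure_atLeastLessThan_ge[of \<mu> a0]) (use low k in auto)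
  \<comment> \<open>The plateau must have finite mass: with infinite values on both sides the strict
    inequality would be lost.\<close>
  have "emeasure \<mu> {a..<a + 1} \<le> ennreal M" if "a \<ge> a0" for a
    by (rule order_trans[OF emeasure_mono up[OF that]]) auto
  then have "emeasure \<mu> ?m \<le> ennreal (real n * M)"
    unfolding mid by (intro emeasure_atLeastLessThan_le[of \<mu> a0]) (use M in auto)
  then obtain x where x: "emeasure \<mu> ?m = ennreal x" "x \<ge> 0"
    by (cases "emeasure \<mu> ?m") (auto simp: top_unique)
  have xn: "real n * k \<le> x" using Xlow x k by simp
  have gb: "\<bar>\<gamma> * ?G t + ?G' t\<bar> powr p \<le> L" for t
  proof -
    have "\<bar>?G' t\<bar> \<le> D * 1 + 1 * D"
      unfolding plateau'_def
      by (rule order_trans[OF abs_triangle_ineq4], unfold abs_mult, intro add_mono mult_mono D)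
        (use D(1) sstep_simps(3,4) in auto)
    moreover have "\<bar>\<gamma> * ?G t\<bar> \<le> \<bar>\<gamma>\<bar>"
      unfolding abs_mult using plateau_bounds by (simp add: mult_left_le)
    ultimately show ?thesis unfolding L_def using p by (intro powr_mono2) auto
  qed
  have pt: "ennreal (\<bar>\<gamma> * ?G t + ?G' t\<bar> powr p) \<le> ennreal (\<bar>\<gamma>\<bar> powr p) * indicator ?m t
      + (ennreal L * indicator {a0..a0 + 1} t + ennreal L * indicator {b - 1..b - 1 + 1} t)" for t
  proof -
    consider "t \<notin> {a0..b}" | "t \<in> {a0..a0+1}" | "a0 + 1 < t" "t < b - 1" | "t \<in> {b - 1..b}" by force
    then show ?thesis
    proof cases
      case 1 then show ?thesis using plateau_eq_0 p by simp
    next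
      case 2
      then have "ennreal (\<bar>\<gamma> * ?G t + ?G' t\<bar> powr p) \<le> ennreal L * indicator {a0..a0 + 1} t"
        using gb[of t] by (simp add: ennreal_leI)
      then show ?thesis by (rule add_increasing[OF zero_le add_increasing2[OF zero_le]])
    next
      case 3
      then show ?thesis by (auto simp: plateau_eq_1 intro!: add_increasing2)
    next
      case 4
      then have "ennreal (\<bar>\<gamma> * ?G t + ?G' t\<bar> powr p) \<le> ennreal L * indicator {b - 1..b - 1 + 1} t"
        using gb[of t] by (simp add: ennreal_leI)
      then show ?thesis by (rule add_increasing[OF zero_le add_increasing[OF zero_le]])
    qed
  qed
  have "(\<integral>\<^sup>+ t. ennreal (\<bar>\<gamma> * ?G t + ?G' t\<bar> powr p) \<partial>\<mu>)
      \<le> (\<integral>\<^sup>+ t. ennreal (\<bar>\<gamma>\<bar> powr p) * indicator ?m t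
      + (ennreal L * indicator {a0..a0 + 1} t + ennreal L * indicator {b - 1..b - 1 + 1} t) \<partial>\<mu>)"
    by (rule nn_integral_mono) (rule pt)
  also have "\<dots> = ennreal (\<bar>\<gamma>\<bar> powr p) * emeasure \<mu> ?m
      + (ennreal L * emeasure \<mu> {a0..a0 + 1} + ennreal L * emeasure \<mu> {b - 1..b - 1 + 1})"
    by (simp add: nn_integral_add nn_integral_cmult_indicator)
  also have "\<dots> \<le> ennreal (\<bar>\<gamma>\<bar> powr p) * ennreal x + (ennreal L * ennreal M + ennreal L * ennreal M)"
    unfolding x(1) by (intro add_mono mult_left_mono up) (auto simp: b_def)
  also have "\<dots> = ennreal (\<bar>\<gamma>\<bar> powr p * x + 2 * L * M)"
    using x(2) L0 M by (simp flip: ennreal_mult ennreal_plus)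
  also have "\<dots> < ennreal (C * x)"
  proof (rule ennreal_lessI)
    have "(C - \<bar>\<gamma>\<bar> powr p) * (real n * k) \<le> (C - \<bar>\<gamma>\<bar> powr p) * x"
      using xn C by (intro mult_left_mono) auto
    then have "2 * L * M < (C - \<bar>\<gamma>\<bar> powr p) * x" using n by linarith
    then show lt: "\<bar>\<gamma>\<bar> powr p * x + 2 * L * M < C * x" by (simp add: algebra_simps)
    have "0 \<le> \<bar>\<gamma>\<bar> powr p * x + 2 * L * M" using x(2) L0 M by simp
    then show "0 < C * x" using lt by linarith
  qed
  also have "ennreal (C * x) = ennreal C * emeasure \<mu> ?m"
  proof -
    have "C \<ge> 0" using C powr_ge_zero[of "\<bar>\<gamma>\<bar>" p] by linarith
    then show ?thesis unfolding x(1) using x(2) by (simp add: ennreal_mult)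
  qed
  also have "emeasure \<mu> ?m \<le> (\<integral>\<^sup>+ t. ennreal (?G t powr p) \<partial>\<mu>)"
  proof -
    have "emeasure \<mu> ?m = (\<integral>\<^sup>+ t. indicator ?m t \<partial>\<mu>)" by simp
    also have "\<dots> \<le> (\<integral>\<^sup>+ t. ennreal (?G t powr p) \<partial>\<mu>)"
      by (rule nn_integral_mono) (auto simp: plateau_eq_1 split: split_indicator)
    finally show ?thesis .
  qed
  then have "ennreal C * emeasure \<mu> ?m \<le> ennreal C * (\<integral>\<^sup>+ t. ennreal (?G t powr p) \<partial>\<mu>)"
    by (rule mult_left_mono) simp
  finally show ?thesis by (intro that[of b]) (simp_all add: b_def)
qed

section \<open>The dilation-invariant radial measure\<close>

context carnot_harmonic
begin

definition radial_density :: "real^'n \<Rightarrow> real" where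
  "radial_density x = N x powr - Q * norm (grad N x) powr p"

text \<open>The density has degree -Q under dilations, which offsets the Jacobian t^Q. In the
  coordinate - ln N dilations act as translations, so the image measure is translation
  invariant.\<close>

definition radial_measure :: "real measure" where
  "radial_measure = distr (density lborel (\<lambda>x. ennreal (radial_density x))) borel (\<lambda>x. - ln (N x))"

lemma radial_density_nonneg: "radial_density x \<ge> 0"
  by (simp add: radial_density_def)

lemma measurable_radial_density [measurable]: "radial_density \<in> borel_measurable borel"
  unfolding radial_density_def[abs_def] by measurable

lemma sets_radial_measure [simp, measurable_cong]: "sets radial_measure = sets borel"
  by (simp add: radial_measure_def)

lemma nn_integral_radial_measure:
  assumes [measurable]: "h \<in> borel_measurable borel"
  shows "(\<integral>\<^sup>+ t. h t \<partial>radial_measure) = (\<integral>\<^sup>+ x. ennreal (radial_density x) * h (- ln (N x)) \<partial>lborel)"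
  unfolding radial_measure_def
  by (subst nn_integral_distr, measurable, subst nn_integral_density, measurable)

lemma emeasure_radial_measure:
  assumes [measurable]: "A \<in> sets borel"
  shows "emeasure radial_measure A = (\<integral>\<^sup>+ x. ennreal (radial_density x) * indicator A (- ln (N x)) \<partial>lborel)"
  using nn_integral_radial_measure[of "indicator A"] by simp

text \<open>Change of variables by the dilation with factor exp(-t): it adds t to - ln N, multiplies
  the density by exp(t Q), and has Jacobian exp(-t Q).\<close>

lemma radial_measure_translate:
  "emeasure radial_measure {u + t..<v + t} = emeasure radial_measure {u..<v}"
proof -
  let ?r = "exp (- t)"
  let ?f = "\<lambda>x. ennreal (radial_density x) * indicator {u + t..<v + t} (- ln (N x))"
  have [measurable]: "?f \<in> borel_measurable borel" by measurable
  have "?f (dil deg ?r x) = ennreal (exp (t * Q)) * (ennreal (radial_density x) * indicator {u..<v} (- ln (N x)))" for x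
  proof (cases "x = 0")
    case True
    then have "dil deg ?r x = 0" using dil_eq_0_iff[of ?r deg x] by simp
    then show ?thesis using True by (simp add: radial_density_def N_0)
  next
    case False
    have l: "- ln (N (dil deg ?r x)) = - ln (N x) + t"
      using N_pos[OF False] by (simp add: N_dil ln_mult)
    have d: "radial_density (dil deg ?r x) = exp (t * Q) * radial_density x"
      unfolding radial_density_def using N_pos[OF False] grad_N_dil[OF _ False, of ?r]
      by (simp add: N_dil powr_mult exp_powr_real)
    have "indicator {u + t..<v + t} (- ln (N (dil deg ?r x))) = (indicator {u..<v} (- ln (N x)) :: ennreal)"
      unfolding l by (auto split: split_indicator)
    then show ?thesis unfolding d by (simp add: ennreal_mult radial_density_nonneg mult.assoc)
  qed
  then have "emeasure radial_measure {u + t..<v + t}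
      = ennreal (?r powr Q) * (\<integral>\<^sup>+ x. ennreal (exp (t * Q)) * (ennreal (radial_density x) * indicator {u..<v} (- ln (N x))) \<partial>lebesgue)"
    using nn_integral_dil[of ?r ?f deg] by (simp add: emeasure_radial_measure nn_integral_completion)
  also have "\<dots> = ennreal (?r powr Q) * (ennreal (exp (t * Q)) * emeasure radial_measure {u..<v})"
    by (simp add: emeasure_radial_measure nn_integral_completion nn_integral_cmult)
  also have "\<dots> = ennreal (?r powr Q * exp (t * Q)) * emeasure radial_measure {u..<v}"
    by (simp add: ennreal_mult mult.assoc)
  also have "?r powr Q * exp (t * Q) = 1" by (simp add: exp_powr_real flip: exp_add)
  finally show ?thesis by simp
qed

text \<open>Invariance reduces everything to one interval. Its mass is finite because it comes from
  a compact shell off the origin, and nonzero because \<nabla>N, being continuous there, is nonzero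
  on some open set.\<close>

lemma radial_measure_unit:
  obtains m where "m > 0" "\<And>a. emeasure radial_measure {a..<a + 1} = ennreal m"
proof -
  let ?m = "emeasure radial_measure {0..<1}"
  have eq: "emeasure radial_measure {a..<a + 1} = ?m" for a
    using radial_measure_translate[of 0 a 1] by (simp add: add.commute)
  have "?m < \<infinity>"
  proof -
    \<comment> \<open>Contains every nonzero x with - ln (N x) in [0, 1); the closed shell is taken
      for compactness.\<close>
    let ?K = "{x. exp (- 1) \<le> N x \<and> N x \<le> 1}"
    have K0: "x \<noteq> 0" "N x \<noteq> 0" if "x \<in> ?K" for x
    proof -
      have "N x > 0" using that less_le_trans[OF exp_gt_zero[of "- 1::real"]] by auto
      then show "x \<noteq> 0" "N x \<noteq> 0" using N_0 by auto
    qed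
    then have "0 \<notin> ?K" by blast
    have "continuous_on ?K radial_density"
      unfolding radial_density_def[abs_def]
      by (intro continuous_on_mult continuous_on_powr continuous_on_powr' continuous_on_norm continuous_on_N
          continuous_on_const continuous_on_grad_N \<open>0 \<notin> ?K\<close>) (use K0(2) p in auto)
    then have i: "integrable lborel (\<lambda>x. indicator ?K x *\<^sub>R radial_density x)"
      by (rule borel_integrable_compact[OF compact_N_shell])
    have "?m \<le> (\<integral>\<^sup>+ x. ennreal (indicator ?K x *\<^sub>R radial_density x) \<partial>lborel)"
    proof (subst emeasure_radial_measure, simp, rule nn_integral_mono)
      fix x
      show "ennreal (radial_density x) * indicator {0..<1} (- ln (N x)) \<le> ennreal (indicator ?K x *\<^sub>R radial_density x)"
      proof (cases "x \<noteq> 0 \<and> - ln (N x) \<in> {0..<1}")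
        case True
        then have "N x > 0" "- 1 < ln (N x)" "ln (N x) \<le> 0" using N_pos by auto
        then have "x \<in> ?K" using exp_less_mono[of "- 1" "ln (N x)"] by (simp add: less_imp_le)
        then show ?thesis by (simp split: split_indicator)
      next
        case False
        then have "radial_density x = 0 \<or> - ln (N x) \<notin> {0..<1}" by (auto simp: radial_density_def N_0)
        then show ?thesis by (auto split: split_indicator)
      qed
    qed
    also have "\<dots> < \<infinity>"
      using i unfolding integrable_iff_bounded by (simp add: radial_density_nonneg)
    finally show ?thesis .
  qed
  moreover have "?m \<noteq> 0"
  proof
    assume m0: "?m = 0"
    obtain z where z: "z \<noteq> 0" "grad N z \<noteq> 0" using grad_N_nonzero by blast
    \<comment> \<open>Places - ln (N z) at the midpoint of the unit interval starting at a, so a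
      neighbourhood of z is counted.\<close>
    define a where "a = - ln (N z) - 1 / 2"
    define U where "U = {x \<in> {x. N x \<in> {exp (- (a + 1))<..<exp (- a)}}. grad N x \<noteq> 0}"
    have oS: "open {x. N x \<in> {exp (- (a + 1))<..<exp (- a)}}" by (rule open_N_vimage) simp
    have S0: "0 \<notin> {x. N x \<in> {exp (- (a + 1))<..<exp (- a)}}"
      using N_0 less_asym[OF exp_gt_zero] by auto
    have "open U"
    proof -
      have "U = {x. N x \<in> {exp (- (a + 1))<..<exp (- a)}} \<inter> grad N -` (- {0})" unfolding U_def by auto
      then show ?thesis
        using continuous_open_preimage[OF continuous_on_grad_N[OF S0] oS open_Compl[OF closed_singleton[of 0]]]
        by (simp only:)
    qed
    moreover have "z \<in> U"
    proof -
      have "exp (- (a + 1)) < exp (ln (N z))" "exp (ln (N z)) < exp (- a)" by (simp_all add: a_def)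
      then show ?thesis using N_pos[OF z(1)] z(2) by (simp add: U_def)
    qed
    ultimately have "\<not> negligible U" using open_not_negligible by blast
    moreover have "negligible U"
    proof -
      have "(\<integral>\<^sup>+ x. ennreal (radial_density x) * indicator {a..<a + 1} (- ln (N x)) \<partial>lborel) = 0"
        using eq[of a] m0 by (simp add: emeasure_radial_measure)
      then have "AE x in lborel. ennreal (radial_density x) * indicator {a..<a + 1} (- ln (N x)) = 0"
        by (subst (asm) nn_integral_0_iff_AE) auto
      moreover have "ennreal (radial_density x) * indicator {a..<a + 1} (- ln (N x)) \<noteq> 0" if "x \<in> U" for x
      proof -
        have x: "exp (- (a + 1)) < N x" "N x < exp (- a)" "grad N x \<noteq> 0" using that by (auto simp: U_def)
        have "N x > 0" using x(1) less_trans[OF exp_gt_zero] by blast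
        then have "- (a + 1) < ln (N x)" "ln (N x) < - a" 
          using x by (metis exp_less_cancel_iff exp_ln)+
        then show ?thesis using \<open>N x > 0\<close> x(3) by (auto simp: radial_density_def)
      qed
      ultimately have "AE x in lborel. x \<notin> U"
        by (auto elim: eventually_mono)
      then have "U \<in> null_sets lborel" using \<open>open U\<close> by (simp add: AE_iff_null)
      then show ?thesis by (simp add: negligible_iff_null_sets null_sets_completionI)
    qed
    ultimately show False by blast
  qed
  ultimately obtain m where "?m = ennreal m" "m > 0"
    by (cases ?m) (auto simp: less_le)
  then show ?thesis using that[of m] eq by simp
qed

end

lemma ln_le_iff_exp: "x > 0 \<Longrightarrow> ln x \<le> y \<longleftrightarrow> x \<le> exp y" for x y :: real
  by (metis exp_le_cancel_iff exp_ln)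

lemma ln_less_iff_exp: "x > 0 \<Longrightarrow> ln x < y \<longleftrightarrow> x < exp y" for x y :: real
  by (metis exp_less_cancel_iff exp_ln)

context carnot_harmonic
begin

text \<open>Here \<open>\<eta>\<close> is the inverse of the decreasing function \<open>\<tau>\<close>.\<close>

lemma sharp_profile:
  fixes \<tau> \<eta> D W V :: "real \<Rightarrow> real" and \<mu> :: "real measure"
  assumes T: "open T" "T \<subseteq> {0<..}" and \<tau>: "smooth_on T \<tau>"
    and \<eta>: "\<And>b. b > a0 \<Longrightarrow> {\<eta> b..\<eta> a0} \<subseteq> T"
      "\<And>b s. b > a0 \<Longrightarrow> s \<in> T \<Longrightarrow> \<tau> s \<in> {a0..b} \<longleftrightarrow> s \<in> {\<eta> b..\<eta> a0}"
    and \<Omega>: "\<And>b. b > a0 \<Longrightarrow> {x. \<eta> b \<le> N x \<and> N x \<le> \<eta> a0} \<subseteq> \<Omega>"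
    and \<mu>: "\<And>h. h \<in> borel_measurable borel \<Longrightarrow>
      (\<integral>\<^sup>+ t. h t \<partial>\<mu>) = (\<integral>\<^sup>+ x. ennreal (indicator T (N x) * (D (N x) * norm (grad N x) powr p)) * h (\<tau> (N x)) \<partial>lborel)"
    and D0: "\<And>s. s \<in> T \<Longrightarrow> D s \<ge> 0"
    and W: "\<And>s. s \<in> T \<Longrightarrow> exp (\<gamma> * \<tau> s) powr p * W s = D s"
    and V: "\<And>s. s \<in> T \<Longrightarrow> exp (\<gamma> * \<tau> s) powr p * \<bar>deriv \<tau> s\<bar> powr p * V s = D s"
    and sets: "sets \<mu> = sets borel"
    and low: "\<And>a. a \<ge> a0 \<Longrightarrow> emeasure \<mu> {a..<a + 1} \<ge> ennreal k" and k: "k > 0"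
    and up: "\<And>a. a \<ge> a0 \<Longrightarrow> emeasure \<mu> {a..a + 1} \<le> ennreal M" and M: "M \<ge> 0"
    and C: "C > \<bar>\<gamma>\<bar> powr p"
  obtains \<phi> where "test_fn \<Omega> \<phi>"
    "wint \<Omega> (\<lambda>x. norm (grad \<phi> x) powr p * V (N x))
      < ennreal C * wint \<Omega> (\<lambda>x. \<bar>\<phi> x\<bar> powr p * (W (N x) * norm (grad N x) powr p))"
proof -
  have p0: "p > 0" using p by simp
  obtain b where b: "b > a0"
    and lt: "(\<integral>\<^sup>+ t. ennreal (\<bar>\<gamma> * plateau a0 b t + plateau' a0 b t\<bar> powr p) \<partial>\<mu>)
      < ennreal C * (\<integral>\<^sup>+ t. ennreal (plateau a0 b t powr p) \<partial>\<mu>)"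
    by (rule plateau_sharp[OF sets low k up M C p0])
  let ?G = "plateau a0 b" and ?G' = "plateau' a0 b" and ?I = "{\<eta> b..\<eta> a0}"
  let ?P = "{x. \<eta> b \<le> N x \<and> N x \<le> \<eta> a0}"
  \<comment> \<open>Outside T the values of \<open>\<tau>\<close> are meaningless, hence the
    explicit truncation; on T it agrees with the support of the plateau and does not disturb
    smoothness.\<close>
  define F where "F s = (if s \<in> ?I then exp (\<gamma> * \<tau> s) * ?G (\<tau> s) else 0)" for s
  define \<phi> where "\<phi> x = F (N x)" for x
  have FT: "F s = exp (\<gamma> * \<tau> s) * ?G (\<tau> s)" if "s \<in> T" for s
    using \<eta>(2)[OF b that] plateau_eq_0(1)[of "\<tau> s" a0 b] by (auto simp: F_def)
  have "smooth_on T (\<lambda>s. exp (\<gamma> * \<tau> s) * ?G (\<tau> s))"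
    by (intro smooth_on_mult T smooth_on_compose[OF T(1) open_UNIV smooth_on_exp]
        smooth_on_compose[OF T(1) open_UNIV smooth_on_plateau] \<tau> smooth_on_const subset_UNIV)
  then have sF: "smooth_on T F"
    using smooth_on_cong[OF T(1), of F "\<lambda>s. exp (\<gamma> * \<tau> s) * ?G (\<tau> s)"] FT by simp
  have test: "test_fn \<Omega> \<phi>"
    unfolding \<phi>_def[abs_def]
    by (rule test_fn_compose_N[OF T(1) \<eta>(1)[OF b] T(2) sF _ \<Omega>[OF b]]) (auto simp: F_def)
  have F': "(F has_real_derivative exp (\<gamma> * \<tau> s) * (\<gamma> * ?G (\<tau> s) + ?G' (\<tau> s)) * deriv \<tau> s) (at s)"
    if s: "s \<in> T" for s
  proof -
    note d\<tau> = smooth_on_deriv(2)[OF T(1) \<tau> s]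
    have 1: "((\<lambda>s. exp (\<gamma> * \<tau> s)) has_real_derivative exp (\<gamma> * \<tau> s) * (\<gamma> * deriv \<tau> s)) (at s)"
      by (rule DERIV_chain2[OF DERIV_exp DERIV_cmult[OF d\<tau>]])
    have 2: "((\<lambda>s. ?G (\<tau> s)) has_real_derivative ?G' (\<tau> s) * deriv \<tau> s) (at s)"
      by (rule DERIV_chain2[OF plateau_deriv d\<tau>])
    have "((\<lambda>s. exp (\<gamma> * \<tau> s) * ?G (\<tau> s)) has_real_derivative
        exp (\<gamma> * \<tau> s) * (\<gamma> * ?G (\<tau> s) + ?G' (\<tau> s)) * deriv \<tau> s) (at s)"
      by (rule DERIV_cong[OF DERIV_mult[OF 1 2]]) (simp add: algebra_simps)
    then show ?thesis
      by (rule has_field_derivative_transform_within_open[OF _ T(1) s]) (simp add: FT)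
  qed
  have outside: "?G (\<tau> (N x)) = 0 \<and> ?G' (\<tau> (N x)) = 0" if "N x \<in> T" "x \<notin> ?P" for x
    using \<eta>(2)[OF b that(1)] that(2) plateau_eq_0[of "\<tau> (N x)" a0 b] by auto
  have PT: "N x \<in> T" if "x \<in> ?P" for x using \<eta>(1)[OF b] that by auto
  have grad: "grad \<phi> x = (exp (\<gamma> * \<tau> (N x)) * (\<gamma> * ?G (\<tau> (N x)) + ?G' (\<tau> (N x))) * deriv \<tau> (N x)) *\<^sub>R grad N x"
    if "N x \<in> T" for x
  proof -
    have "x \<noteq> 0" using that T(2) N_0 by auto
    then show ?thesis unfolding \<phi>_def[abs_def] by (rule grad_compose_N[OF _ F'[OF that]])
  qed
  have grad0: "grad \<phi> x = 0" if "x \<notin> ?P" for x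
  proof (rule hgrad_eq_0[of "- ?P"])
    show "open (- ?P)" using compact_N_shell compact_imp_closed by blast
  qed (use that in \<open>auto simp: \<phi>_def F_def\<close>)
  have [measurable]: "(\<lambda>t. ennreal (?G t powr p)) \<in> borel_measurable borel"
    "(\<lambda>t. ennreal (\<bar>\<gamma> * ?G t + ?G' t\<bar> powr p)) \<in> borel_measurable borel" by measurable
  \<comment> \<open>By \<open>W\<close> the exponential cancels the weight and leaves the density D;
    \<open>V\<close> does the same for the gradient term below, where the chain rule adds
    |\<tau>'|^p. Both integrals thus refer to the same measure \<mu>.\<close>
  have A: "wint \<Omega> (\<lambda>x. \<bar>\<phi> x\<bar> powr p * (W (N x) * norm (grad N x) powr p)) = (\<integral>\<^sup>+ t. ennreal (?G t powr p) \<partial>\<mu>)"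
  proof -
    have "indicator \<Omega> x * ennreal (\<bar>\<phi> x\<bar> powr p * (W (N x) * norm (grad N x) powr p))
        = ennreal (indicator T (N x) * (D (N x) * norm (grad N x) powr p)) * ennreal (?G (\<tau> (N x)) powr p)" for x
    proof (cases "x \<in> ?P")
      case True
      let ?s = "N x"
      have s: "?s \<in> T" "x \<in> \<Omega>" using PT[OF True] \<Omega>[OF b] True by auto
      have "\<bar>\<phi> x\<bar> powr p = exp (\<gamma> * \<tau> ?s) powr p * ?G (\<tau> ?s) powr p"
        unfolding \<phi>_def FT[OF s(1)] using plateau_bounds(1)[of a0 b "\<tau> ?s"] by (simp add: abs_mult powr_mult)
      then have "\<bar>\<phi> x\<bar> powr p * (W ?s * norm (grad N x) powr p)
          = (exp (\<gamma> * \<tau> ?s) powr p * W ?s) * norm (grad N x) powr p * ?G (\<tau> ?s) powr p"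
        by (simp only: mult_ac)
      then have *: "\<bar>\<phi> x\<bar> powr p * (W ?s * norm (grad N x) powr p) = D ?s * norm (grad N x) powr p * ?G (\<tau> ?s) powr p"
        unfolding W[OF s(1)] .
      show ?thesis unfolding * using s D0[OF s(1)] by (simp add: ennreal_mult)
    next
      case False
      then have "\<phi> x = 0" by (auto simp: \<phi>_def F_def)
      then show ?thesis using outside[OF _ False] p by (cases "N x \<in> T") auto
    qed
    then show ?thesis
      unfolding wint_def nn_integral_completion by (subst \<mu>) simp_all
  qed
  have B: "wint \<Omega> (\<lambda>x. norm (grad \<phi> x) powr p * V (N x)) = (\<integral>\<^sup>+ t. ennreal (\<bar>\<gamma> * ?G t + ?G' t\<bar> powr p) \<partial>\<mu>)"
  proof -
    have "indicator \<Omega> x * ennreal (norm (grad \<phi> x) powr p * V (N x))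
        = ennreal (indicator T (N x) * (D (N x) * norm (grad N x) powr p))
          * ennreal (\<bar>\<gamma> * ?G (\<tau> (N x)) + ?G' (\<tau> (N x))\<bar> powr p)" for x
    proof (cases "x \<in> ?P")
      case True
      let ?s = "N x"
      have s: "?s \<in> T" "x \<in> \<Omega>" using PT[OF True] \<Omega>[OF b] True by auto
      have "norm (grad \<phi> x) powr p = exp (\<gamma> * \<tau> ?s) powr p * \<bar>\<gamma> * ?G (\<tau> ?s) + ?G' (\<tau> ?s)\<bar> powr p
          * \<bar>deriv \<tau> ?s\<bar> powr p * norm (grad N x) powr p"
        unfolding grad[OF s(1)] by (simp add: abs_mult powr_mult)
      then have "norm (grad \<phi> x) powr p * V ?s
          = (exp (\<gamma> * \<tau> ?s) powr p * \<bar>deriv \<tau> ?s\<bar> powr p * V ?s) * norm (grad N x) powr p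
            * \<bar>\<gamma> * ?G (\<tau> ?s) + ?G' (\<tau> ?s)\<bar> powr p"
        by (simp only: mult_ac)
      then have *: "norm (grad \<phi> x) powr p * V ?s
          = D ?s * norm (grad N x) powr p * \<bar>\<gamma> * ?G (\<tau> ?s) + ?G' (\<tau> ?s)\<bar> powr p"
        unfolding V[OF s(1)] .
      show ?thesis unfolding * using s D0[OF s(1)] by (simp add: ennreal_mult)
    next
      case False
      then show ?thesis using grad0[OF False] outside[OF _ False] p by (cases "N x \<in> T") auto
    qed
    then show ?thesis
      unfolding wint_def nn_integral_completion by (subst \<mu>) simp_all
  qed
  show ?thesis by (rule that[OF test]) (use lt A B in simp)
qed

lemma test_fn_in_Dsp: "test_fn \<Omega> \<phi> \<Longrightarrow> (\<phi>, grad \<phi>) \<in> Dsp gmul deg p \<Omega> v"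
  using test_fn_hgrad_measurable[of \<Omega> \<phi>] p
  unfolding Dsp_def by (auto intro!: exI[of _ "\<lambda>_. \<phi>"] simp: wint_def)

lemma hardy_power_sharp:
  assumes \<Omega>: "0 \<in> interior (\<Omega> \<union> {0})" and C: "C > (\<bar>Q + \<beta>\<bar> / p) powr p"
  obtains \<phi> where "test_fn \<Omega> \<phi>"
    "wint \<Omega> (\<lambda>x. norm (grad \<phi> x) powr p * N x powr (p + \<beta>))
      < ennreal C * wint \<Omega> (\<lambda>x. \<bar>\<phi> x\<bar> powr p * (N x powr \<beta> * norm (grad N x) powr p))"
proof -
  obtain r where r: "r > 0" "{x. N x < r} \<subseteq> interior (\<Omega> \<union> {0})"
    using N_sublevel_subset[OF open_interior \<Omega>] by blast
  \<comment> \<open>The extra 1 gives exp(-a0) < r. The shells exp(-b) \<le> N \<le> exp(-a0) avoid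
    the origin, so they lie in \<Omega> once {N < r} lies in \<Omega> together with 0.\<close>
  define a0 where "a0 = - ln r + 1"
  obtain m where m: "m > 0" "\<And>a. emeasure radial_measure {a..<a + 1} = ennreal m"
    using radial_measure_unit by blast
  let ?\<gamma> = "(Q + \<beta>) / p"
  have sm: "smooth_on {0<..} (\<lambda>s::real. - ln s)"
    using smooth_on_mult[OF _ smooth_on_const[of _ "- 1"] smooth_on_ln] by simp
  have d: "deriv (\<lambda>s. - ln s) s = - (1 / s)" if "s > 0" for s :: real
    by (rule DERIV_imp_deriv) (use that in \<open>auto intro!: derivative_eq_intros\<close>)
  have e: "exp (?\<gamma> * - ln s) powr p = s powr - (Q + \<beta>)" if "s > 0" for s
  proof -
    have "exp (?\<gamma> * - ln s) powr p = exp (?\<gamma> * - ln s * p)" by (rule exp_powr_real)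
    also have "?\<gamma> * - ln s * p = - (Q + \<beta>) * ln s" using p by simp (simp add: algebra_simps)
    finally show ?thesis using that by (simp only: powr_def) simp
  qed
  show ?thesis
  proof (rule sharp_profile[where T="{0<..}" and \<tau>="\<lambda>s. - ln s" and \<eta>="\<lambda>t. exp (- t)" and D="\<lambda>s. s powr - Q"
        and W="\<lambda>s. s powr \<beta>" and V="\<lambda>s. s powr (p + \<beta>)" and \<mu>=radial_measure and \<gamma>="?\<gamma>" and C=C and \<Omega>=\<Omega>
        and k=m and M="2 * m" and ?a0.0=a0])
    show "{exp (- b)..exp (- a0)} \<subseteq> {0<..}" if "b > a0" for b
      using less_le_trans[OF exp_gt_zero] by auto
    show "- ln s \<in> {a0..b} \<longleftrightarrow> s \<in> {exp (- b)..exp (- a0)}" if "b > a0" "s \<in> {0<..}" for b s :: real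
    proof -
      have "ln s \<le> - a0 \<longleftrightarrow> s \<le> exp (- a0)" "- b \<le> ln s \<longleftrightarrow> exp (- b) \<le> s"
        using that(2) by (simp_all add: ln_le_iff_exp ln_ge_iff)
      then show ?thesis by auto
    qed
    show "{x. exp (- b) \<le> N x \<and> N x \<le> exp (- a0)} \<subseteq> \<Omega>" if "b > a0" for b
    proof
      fix x assume x: "x \<in> {x. exp (- b) \<le> N x \<and> N x \<le> exp (- a0)}"
      have "exp (- a0) < exp (ln r)" by (simp add: a0_def)
      then have "N x < r" using x r by simp
      moreover have "x \<noteq> 0" using x N_0 by auto
      ultimately show "x \<in> \<Omega>" using r(2) interior_subset[of "\<Omega> \<union> {0}"] by blast
    qed
    show "(\<integral>\<^sup>+ t. h t \<partial>radial_measure)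
        = (\<integral>\<^sup>+ x. ennreal (indicator {0<..} (N x) * (N x powr - Q * norm (grad N x) powr p)) * h (- ln (N x)) \<partial>lborel)"
      if "h \<in> borel_measurable borel" for h
    proof -
      have "radial_density x = indicator {0<..} (N x) * (N x powr - Q * norm (grad N x) powr p)" for x
        unfolding radial_density_def using N_nonneg[of x] by (cases "N x = 0") auto
      then show ?thesis using nn_integral_radial_measure[OF that] by simp
    qed
    show "exp (?\<gamma> * - ln s) powr p * s powr \<beta> = s powr - Q" if "s \<in> {0<..}" for s
      using that e[of s] by (simp flip: powr_add)
    show "exp (?\<gamma> * - ln s) powr p * \<bar>deriv (\<lambda>s. - ln s) s\<bar> powr p * s powr (p + \<beta>) = s powr - Q"
      if s: "s \<in> {0<..}" for s
    proof -
      have "\<bar>deriv (\<lambda>s. - ln s) s\<bar> powr p = s powr - p"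
        using s d[of s] by (simp add: powr_divide powr_minus_divide)
      then show ?thesis using s e[of s] by (simp flip: powr_add)
    qed
    show "ennreal m \<le> emeasure radial_measure {a..<a + 1}" for a using m by simp
    \<comment> \<open>A closed unit interval is covered by two half-open ones, hence the factor
      2.\<close>
    show "emeasure radial_measure {a..a + 1} \<le> ennreal (2 * m)" for a
    proof -
      have "emeasure radial_measure {a..a + 1} \<le> emeasure radial_measure {a..<a + real 2}"
        by (rule emeasure_mono) auto
      also have "\<dots> \<le> ennreal (real 2 * m)"
        by (rule emeasure_atLeastLessThan_le[of _ a]) (use m in auto)
      finally show ?thesis by simp
    qed
    show "\<bar>?\<gamma>\<bar> powr p < C" using C p by simp
  qed (use sm m in \<open>auto intro: that\<close>)
qed

text \<open>The radial measure with density 1/(ln R + t), seen in the coordinate ln(ln R + t); at t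
  = - ln N this is ln(ln(R/N)). Were the radial measure m dt, the image would be m dt again. Only
  masses of unit intervals are used instead: [a, a+1] is compared with the roughly (e-1) e^a unit
  intervals that make up its preimage.\<close>

lemma hardy_log_sharp:
  assumes Q: "Q = p" and R: "R > 0" and \<beta>: "\<beta> < -1" and C: "C > (\<bar>\<beta> + 1\<bar> / p) powr p"
  obtains \<phi> where "test_fn {x. N x < R} \<phi>"
    "wint {x. N x < R} (\<lambda>x. norm (grad \<phi> x) powr p * ln (R / N x) powr (p + \<beta>))
      < ennreal C * wint {x. N x < R} (\<lambda>x. \<bar>\<phi> x\<bar> powr p * (1 / N x powr p * ln (R / N x) powr \<beta> * norm (grad N x) powr p))"
proof -
  obtain m where m: "m > 0" "\<And>a. emeasure radial_measure {a..<a + 1} = ennreal m"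
    using radial_measure_unit by blast
  let ?\<gamma> = "- (\<beta> + 1) / p" and ?T = "{0<..<R}" and ?\<tau> = "\<lambda>s. ln (ln (R / s))"
  \<comment> \<open>The values t \<le> - ln R belong to points with N \<ge> R, outside the ball, and
    get weight 0.\<close>
  define w where "w t = (if - ln R < t then 1 / (ln R + t) else 0)" for t :: real
  have [measurable]: "w \<in> borel_measurable borel" unfolding w_def[abs_def] by measurable
  define \<mu> where "\<mu> = distr (density radial_measure (\<lambda>t. ennreal (w t))) borel (\<lambda>t. ln (ln R + t))"
  have \<mu>: "(\<integral>\<^sup>+ t. h t \<partial>\<mu>) = (\<integral>\<^sup>+ t. ennreal (w t) * h (ln (ln R + t)) \<partial>radial_measure)"
    if [measurable]: "h \<in> borel_measurable borel" for h
    unfolding \<mu>_def by (subst nn_integral_distr, measurable, subst nn_integral_density, measurable)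
  have sets\<mu>: "sets \<mu> = sets borel" by (simp add: \<mu>_def)
  have em: "emeasure \<mu> A = (\<integral>\<^sup>+ t. ennreal (w t) * indicator A (ln (ln R + t)) \<partial>radial_measure)"
    if "A \<in> sets borel" for A
    using \<mu>[of "indicator A"] that sets\<mu> by simp
  have l: "ln (R / s) > 0" if "s \<in> ?T" for s using that R by (simp add: ln_gt_zero)
  have "smooth_on ?T (\<lambda>s. ln R - ln s)"
    by (intro smooth_on_diff smooth_on_const smooth_on_subset[OF smooth_on_ln]) auto
  then have sl: "smooth_on ?T (\<lambda>s. ln (R / s))"
    by (rule smooth_on_cong[THEN iffD1, rotated 2]) (use R in \<open>auto simp: ln_div\<close>)
  have sm: "smooth_on ?T ?\<tau>"
    by (rule smooth_on_compose[OF _ open_greaterThan smooth_on_ln sl]) (use l in auto)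
  have d: "deriv ?\<tau> s = - (1 / (s * ln (R / s)))" if "s \<in> ?T" for s
  proof (rule DERIV_imp_deriv)
    have "((\<lambda>s. ln (R / s)) has_real_derivative - (1 / s)) (at s)"
      using that R by (auto intro!: derivative_eq_intros simp: field_simps power2_eq_square)
    from DERIV_chain2[OF DERIV_ln_divide[OF l[OF that]] this]
    show "(?\<tau> has_real_derivative - (1 / (s * ln (R / s)))) (at s)" by (simp add: mult.commute)
  qed
  have e: "exp (?\<gamma> * ?\<tau> s) powr p = ln (R / s) powr - (\<beta> + 1)" if "s \<in> ?T" for s
  proof -
    have "exp (?\<gamma> * ?\<tau> s) powr p = exp (- (\<beta> + 1) * ?\<tau> s)" using p by (simp add: exp_powr_real)
    then show ?thesis using l[OF that] by (simp add: powr_def)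
  qed
  show ?thesis
  proof (rule sharp_profile[where T="?T" and \<tau>="?\<tau>" and \<eta>="\<lambda>t. R * exp (- exp t)"
        and D="\<lambda>s. s powr - Q * (1 / ln (R / s))"
        and W="\<lambda>s. 1 / s powr p * ln (R / s) powr \<beta>" and V="\<lambda>s. ln (R / s) powr (p + \<beta>)"
        and \<mu>=\<mu> and \<gamma>="?\<gamma>" and C=C and \<Omega>="{x. N x < R}" and k="m / 10" and M="m * exp 1" and ?a0.0=0])
    show sub: "{R * exp (- exp b)..R * exp (- exp 0)} \<subseteq> ?T" if "b > 0" for b
    proof -
      have "0 < R * exp (- exp b)" "R * exp (- exp 0) < R" using R by simp_all
      then show ?thesis by (auto intro: less_le_trans le_less_trans)
    qed
    show "?\<tau> s \<in> {0..b} \<longleftrightarrow> s \<in> {R * exp (- exp b)..R * exp (- exp 0)}" if b: "b > 0" and s: "s \<in> ?T" for b s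
    proof -
      have "0 \<le> ?\<tau> s \<longleftrightarrow> exp 0 \<le> ln (R / s)" using l[OF s] by (simp add: ln_ge_iff)
      also have "\<dots> \<longleftrightarrow> exp (exp 0) \<le> R / s" using s R by (simp add: ln_ge_iff)
      also have "\<dots> \<longleftrightarrow> s \<le> R * exp (- exp 0)" using s by (simp add: exp_minus field_simps)
      finally have 1: "0 \<le> ?\<tau> s \<longleftrightarrow> s \<le> R * exp (- exp 0)" .
      have "?\<tau> s \<le> b \<longleftrightarrow> ln (R / s) \<le> exp b" using l[OF s] by (simp add: ln_le_iff_exp)
      also have "\<dots> \<longleftrightarrow> R / s \<le> exp (exp b)" using s R by (simp add: ln_le_iff_exp)
      also have "\<dots> \<longleftrightarrow> R * exp (- exp b) \<le> s" using s by (simp add: exp_minus field_simps)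
      finally show ?thesis using 1 by auto
    qed
    show "{x. R * exp (- exp b) \<le> N x \<and> N x \<le> R * exp (- exp 0)} \<subseteq> {x. N x < R}" if "b > 0" for b
      using sub[OF that] by auto
    show "(\<integral>\<^sup>+ t. h t \<partial>\<mu>) = (\<integral>\<^sup>+ x. ennreal (indicator ?T (N x) *
        (N x powr - Q * (1 / ln (R / N x)) * norm (grad N x) powr p)) * h (?\<tau> (N x)) \<partial>lborel)"
      if h[measurable]: "h \<in> borel_measurable borel" for h
    proof -
      have "ennreal (radial_density x) * (ennreal (w (- ln (N x))) * h (ln (ln R + - ln (N x))))
          = ennreal (indicator ?T (N x) * (N x powr - Q * (1 / ln (R / N x)) * norm (grad N x) powr p)) * h (?\<tau> (N x))" for x
      proof (cases "N x \<in> ?T")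
        case True
        then have "- ln R < - ln (N x)" "ln R + - ln (N x) = ln (R / N x)" using R by (auto simp: ln_div)
        then have "w (- ln (N x)) = 1 / ln (R / N x)" "ln (ln R + - ln (N x)) = ?\<tau> (N x)"
          unfolding w_def by (simp_all only: if_True)
        then show ?thesis
          using True l[OF True] by (simp add: radial_density_def mult_ac flip: ennreal_mult mult.assoc)
      next
        case False
        then consider "N x = 0" | "N x \<ge> R" using N_nonneg[of x] by force
        then have "radial_density x * w (- ln (N x)) = 0"
        proof cases
          case 2
          then have "ln R \<le> ln (N x)" using R by simp
          then show ?thesis by (simp add: w_def)
        qed (simp add: radial_density_def)
        then show ?thesis using False by auto
      qed
      then show ?thesis
        using \<mu>[OF h] nn_integral_radial_measure[of "\<lambda>t. ennreal (w t) * h (ln (ln R + t))"] by simp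
    qed
    show "0 \<le> s powr - Q * (1 / ln (R / s))" if "s \<in> ?T" for s using l[OF that] by simp
    show "exp (?\<gamma> * ?\<tau> s) powr p * (1 / s powr p * ln (R / s) powr \<beta>) = s powr - Q * (1 / ln (R / s))"
      if s: "s \<in> ?T" for s
    proof -
      have "ln (R / s) powr - (\<beta> + 1) * ln (R / s) powr \<beta> = 1 / ln (R / s)"
        using l[OF s] by (simp add: powr_minus_divide flip: powr_add)
      moreover have "1 / s powr p = s powr - Q" using Q by (simp add: powr_minus_divide)
      ultimately show ?thesis unfolding e[OF s] by (simp add: mult_ac)
    qed
    show "exp (?\<gamma> * ?\<tau> s) powr p * \<bar>deriv ?\<tau> s\<bar> powr p * ln (R / s) powr (p + \<beta>) = s powr - Q * (1 / ln (R / s))"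
      if s: "s \<in> ?T" for s
    proof -
      have "\<bar>deriv ?\<tau> s\<bar> powr p = s powr - Q * ln (R / s) powr - p"
        unfolding d[OF s] using l[OF s] s Q by (simp add: abs_mult powr_divide powr_mult powr_minus_divide)
      moreover have "ln (R / s) powr - (\<beta> + 1) * ln (R / s) powr - p * ln (R / s) powr (p + \<beta>) = 1 / ln (R / s)"
      proof -
        have "- (\<beta> + 1) + - p + (p + \<beta>) = - 1" by simp
        then have "ln (R / s) powr - (\<beta> + 1) * ln (R / s) powr - p * ln (R / s) powr (p + \<beta>) = ln (R / s) powr - 1"
          by (simp only: powr_add[symmetric])
        then show ?thesis using l[OF s] by (simp add: powr_minus_divide)
      qed
      ultimately show ?thesis unfolding e[OF s] by (simp add: mult_ac)
    qed
    \<comment> \<open>On the preimage the density is at least exp(-a-1). As e \<ge> 5/2 and exp a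
      \<ge> 1, it contains n \<ge> (3/2) exp a - 1 \<ge> exp a / 2 unit intervals, and exp(a+1)
      \<le> 3 exp a \<le> 6 n; thus 1/10 is a safe choice. Starting at a = 0 keeps the rounding
      error below exp a.\<close>
    show "ennreal (m / 10) \<le> emeasure \<mu> {a..<a + 1}" if a: "a \<ge> 0" for a
    proof -
      let ?J = "{exp a - ln R..<exp (a + 1) - ln R}"
      have ea: "exp a \<ge> 1" "exp (a + 1) = exp a * exp 1" using a by (simp_all add: exp_add)
      have e2: "exp 1 \<ge> (5/2::real)" "exp 1 \<le> (3::real)" using exp_lower_Taylor_quadratic[of 1] exp_le by simp_all
      define n where "n = nat \<lfloor>exp (a + 1) - exp a\<rfloor>"
      have "exp (a + 1) - exp a \<ge> 3/2 * exp a" using mult_left_mono[OF e2(1), of "exp a"] ea by simp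
      then have n: "real n \<le> exp (a + 1) - exp a" "real n \<ge> 1/2 * exp a"
        unfolding n_def using ea(1) by linarith+
      have "m / 10 \<le> 1 / exp (a + 1) * (real n * m)"
      proof -
        have "exp (a + 1) \<le> 10 * real n"
          using n(2) mult_left_mono[OF e2(2), of "exp a"] ea by linarith
        then show ?thesis using m(1) by (simp add: field_simps)
      qed
      then have "ennreal (m / 10) \<le> ennreal (1 / exp (a + 1)) * ennreal (real n * m)"
        using m(1) by (simp add: ennreal_leI flip: ennreal_mult)
      also have "\<dots> \<le> ennreal (1 / exp (a + 1)) * emeasure radial_measure {exp a - ln R..<exp a - ln R + real n}"
        by (rule mult_left_mono, rule emeasure_atLeastLessThan_ge[of _ "exp a - ln R"]) (use m in auto)
      also have "\<dots> \<le> ennreal (1 / exp (a + 1)) * emeasure radial_measure ?J"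
        using n(1) by (intro mult_left_mono emeasure_mono) auto
      also have "\<dots> = (\<integral>\<^sup>+ t. ennreal (1 / exp (a + 1)) * indicator ?J t \<partial>radial_measure)"
        by (simp add: nn_integral_cmult_indicator)
      also have "\<dots> \<le> emeasure \<mu> {a..<a + 1}"
      proof (subst em, simp, rule nn_integral_mono)
        fix t
        show "ennreal (1 / exp (a + 1)) * indicator ?J t \<le> ennreal (w t) * indicator {a..<a + 1} (ln (ln R + t))"
        proof (cases "t \<in> ?J")
          case True
          then have t: "exp a \<le> ln R + t" "ln R + t < exp (a + 1)" by auto
          then have pos: "ln R + t > 0" using less_le_trans[OF exp_gt_zero] by blast
          then have "a \<le> ln (ln R + t)" "ln (ln R + t) < a + 1"
            using t by (simp_all add: ln_ge_iff ln_less_iff_exp)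
          moreover have "1 / exp (a + 1) \<le> w t" using t pos by (simp add: w_def frac_le)
          ultimately show ?thesis using True by (simp add: ennreal_leI)
        qed simp
      qed
      finally show ?thesis .
    qed
    \<comment> \<open>Here the density is at most exp(-a), and rounding up needs at most exp(a+1) -
      exp a + 1 \<le> exp(a+1) unit intervals, which gives the factor e.\<close>
    show "emeasure \<mu> {a..a + 1} \<le> ennreal (m * exp 1)" if a: "a \<ge> 0" for a
    proof -
      let ?J = "{exp a - ln R..exp (a + 1) - ln R}"
      have ea: "exp a \<ge> 1" "exp (a + 1) = exp a * exp 1" using a by (simp_all add: exp_add)
      define n where "n = nat \<lfloor>exp (a + 1) - exp a\<rfloor> + 1"
      have "exp (a + 1) \<ge> exp a" by simp
      then have n: "exp (a + 1) - exp a < real n" "real n \<le> exp (a + 1) - exp a + 1"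
        unfolding n_def by linarith+
      have "emeasure \<mu> {a..a + 1} \<le> (\<integral>\<^sup>+ t. ennreal (1 / exp a) * indicator ?J t \<partial>radial_measure)"
      proof (subst em, simp, rule nn_integral_mono)
        fix t
        show "ennreal (w t) * indicator {a..a + 1} (ln (ln R + t)) \<le> ennreal (1 / exp a) * indicator ?J t"
        proof (cases "- ln R < t \<and> ln (ln R + t) \<in> {a..a + 1}")
          case True
          then have pos: "ln R + t > 0" by simp
          then have t: "exp a \<le> ln R + t" "ln R + t \<le> exp (a + 1)"
            using True ln_ge_iff[OF pos] ln_le_iff_exp[OF pos] by simp_all
          moreover have "w t \<le> 1 / exp a" using t pos by (simp add: w_def frac_le)
          ultimately show ?thesis by (auto intro: ennreal_leI split: split_indicator)
        qed (auto simp: w_def)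
      qed
      also have "\<dots> = ennreal (1 / exp a) * emeasure radial_measure ?J"
        by (simp add: nn_integral_cmult_indicator)
      also have "\<dots> \<le> ennreal (1 / exp a) * emeasure radial_measure {exp a - ln R..<exp a - ln R + real n}"
        using n(1) by (intro mult_left_mono emeasure_mono) auto
      also have "\<dots> \<le> ennreal (1 / exp a) * ennreal (real n * m)"
        by (rule mult_left_mono, rule emeasure_atLeastLessThan_le[of _ "exp a - ln R"]) (use m in auto)
      also have "\<dots> \<le> ennreal (m * exp 1)"
      proof -
        have "real n \<le> exp a * exp 1" using n(2) ea by linarith
        then have "1 / exp a * (real n * m) \<le> m * exp 1" using m(1) by (simp add: field_simps)
        then show ?thesis using m(1) by (simp add: ennreal_leI flip: ennreal_mult)
      qed
      finally show ?thesis .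
    qed
    show "\<bar>?\<gamma>\<bar> powr p < C" using C p by (simp add: abs_minus_commute add.commute)
  qed (use sm m sets\<mu> in \<open>auto intro: that\<close>)
qed

end

section \<open>The theorem\<close>

theorem mainTheorem15:
  fixes gmul :: "real^'n \<Rightarrow> real^'n \<Rightarrow> real^'n"
    and deg :: "'n::finite \<Rightarrow> nat"
    and N :: "real^'n \<Rightarrow> real"
    and p :: real
  assumes G: "carnot_group gmul deg"
    and N: "hom_norm_fund gmul deg N"
    and p: "p > 1"
    and harm: "Lp_harmonic_on gmul deg p (UNIV - {0}) (Gamma_p deg N p)"
  shows
   "(\<forall>\<beta>::real. \<forall>\<Omega>. open \<Omega> \<and> (\<beta> + hdim deg < 0 \<longrightarrow> 0 \<notin> \<Omega>) \<longrightarrow>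
      (\<forall>(u, g) \<in> Dsp gmul deg p \<Omega> (\<lambda>x. N x powr (p + \<beta>)).
         ennreal ((\<bar>hdim deg + \<beta>\<bar> / p) powr p) *
           wint \<Omega> (\<lambda>x. \<bar>u x\<bar> powr p * N x powr \<beta> * norm (hgrad gmul deg N x) powr p)
         \<le> wint \<Omega> (\<lambda>x. norm (g x) powr p * N x powr (p + \<beta>))) \<and>
      (0 \<in> interior (\<Omega> \<union> {0}) \<longrightarrow>
        (\<forall>C > (\<bar>hdim deg + \<beta>\<bar> / p) powr p.
          \<exists>(u, g) \<in> Dsp gmul deg p \<Omega> (\<lambda>x. N x powr (p + \<beta>)).
            ennreal C *
              wint \<Omega> (\<lambda>x. \<bar>u x\<bar> powr p * N x powr \<beta> * norm (hgrad gmul deg N x) powr p)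
            > wint \<Omega> (\<lambda>x. norm (g x) powr p * N x powr (p + \<beta>)))))
    \<and>
    (\<forall>\<Omega>. open \<Omega> \<and> (hdim deg - p < 0 \<longrightarrow> 0 \<notin> \<Omega>) \<longrightarrow>
      (\<forall>(u, g) \<in> Dsp gmul deg p \<Omega> (\<lambda>x. 1).
         ennreal ((\<bar>hdim deg - p\<bar> / p) powr p) *
           wint \<Omega> (\<lambda>x. \<bar>u x\<bar> powr p / N x powr p * norm (hgrad gmul deg N x) powr p)
         \<le> wint \<Omega> (\<lambda>x. norm (g x) powr p)))
    \<and>
    (hdim deg = p \<longrightarrow>
      (\<forall>R \<beta>::real. R > 0 \<and> \<beta> < -1 \<longrightarrow>
        (\<forall>(u, g) \<in> Dsp gmul deg p {x. N x < R} (\<lambda>x. ln (R / N x) powr (p + \<beta>)).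
           ennreal ((\<bar>\<beta> + 1\<bar> / p) powr p) *
             wint {x. N x < R} (\<lambda>x. \<bar>u x\<bar> powr p / N x powr p * ln (R / N x) powr \<beta>
                                    * norm (hgrad gmul deg N x) powr p)
           \<le> wint {x. N x < R} (\<lambda>x. norm (g x) powr p * ln (R / N x) powr (p + \<beta>))) \<and>
        (\<forall>C > (\<bar>\<beta> + 1\<bar> / p) powr p.
          \<exists>(u, g) \<in> Dsp gmul deg p {x. N x < R} (\<lambda>x. ln (R / N x) powr (p + \<beta>)).
            ennreal C *
              wint {x. N x < R} (\<lambda>x. \<bar>u x\<bar> powr p / N x powr p * ln (R / N x) powr \<beta>
                                     * norm (hgrad gmul deg N x) powr p)
            > wint {x. N x < R} (\<lambda>x. norm (g x) powr p * ln (R / N x) powr (p + \<beta>))))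
      \<and>
      (\<forall>R>0.
        \<forall>(u, g) \<in> Dsp gmul deg p {x. N x < R} (\<lambda>x. 1).
          ennreal (((p - 1) / p) powr p) *
            wint {x. N x < R} (\<lambda>x. \<bar>u x\<bar> powr p / (N x * ln (R / N x)) powr p
                                   * norm (hgrad gmul deg N x) powr p)
          \<le> wint {x. N x < R} (\<lambda>x. norm (g x) powr p)))"
proof -
  interpret carnot_harmonic gmul deg N p
    by unfold_locales (rule G N p harm)+
  have N0: "N x > 0" if "x \<noteq> 0" for x using N_pos[OF that] .
  have power: "ennreal ((\<bar>hdim deg + \<beta>\<bar> / p) powr p) *
           wint \<Omega> (\<lambda>x. \<bar>u x\<bar> powr p * N x powr \<beta> * norm (hgrad gmul deg N x) powr p)
         \<le> wint \<Omega> (\<lambda>x. norm (g x) powr p * N x powr (p + \<beta>))"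
    if "open \<Omega>" "\<beta> + hdim deg < 0 \<longrightarrow> 0 \<notin> \<Omega>" "(u, g) \<in> Dsp gmul deg p \<Omega> (\<lambda>x. N x powr (p + \<beta>))"
    for \<beta> :: real and \<Omega> u g
    using hardy_power[OF that] by (simp only: mult.assoc)
  have power_sharp: "\<exists>(u, g) \<in> Dsp gmul deg p \<Omega> (\<lambda>x. N x powr (p + \<beta>)).
            ennreal C * wint \<Omega> (\<lambda>x. \<bar>u x\<bar> powr p * N x powr \<beta> * norm (hgrad gmul deg N x) powr p)
            > wint \<Omega> (\<lambda>x. norm (g x) powr p * N x powr (p + \<beta>))"
    if sh: "0 \<in> interior (\<Omega> \<union> {0})" "C > (\<bar>hdim deg + \<beta>\<bar> / p) powr p" for \<beta> \<Omega> C
  proof -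
    obtain \<phi> where \<phi>: "test_fn \<Omega> \<phi>"
      "wint \<Omega> (\<lambda>x. norm (grad \<phi> x) powr p * N x powr (p + \<beta>))
      < ennreal C * wint \<Omega> (\<lambda>x. \<bar>\<phi> x\<bar> powr p * (N x powr \<beta> * norm (grad N x) powr p))"
      by (rule hardy_power_sharp[OF sh])
    show ?thesis
      by (rule bexI[OF _ test_fn_in_Dsp[OF \<phi>(1)]]) (use \<phi>(2) in \<open>simp only: split mult.assoc\<close>)
  qed
  have unweighted: "ennreal ((\<bar>hdim deg - p\<bar> / p) powr p) *
           wint \<Omega> (\<lambda>x. \<bar>u x\<bar> powr p / N x powr p * norm (hgrad gmul deg N x) powr p)
         \<le> wint \<Omega> (\<lambda>x. norm (g x) powr p)"
    if \<Omega>: "open \<Omega>" "hdim deg - p < 0 \<longrightarrow> 0 \<notin> \<Omega>" and ug: "(u, g) \<in> Dsp gmul deg p \<Omega> (\<lambda>x. 1)" for \<Omega> u g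
  proof -
    have one: "N x powr (p + - p) = 1" if "x \<noteq> 0" for x using N0[OF that] by simp
    \<comment> \<open>The unweighted inequality is the case \<beta> = -p.\<close>
    have "Dsp gmul deg p \<Omega> (\<lambda>x. 1) = Dsp gmul deg p \<Omega> (\<lambda>x. N x powr (p + - p))"
      by (rule Dsp_cong[of _ 0], rule one[symmetric])
    then have "ennreal ((\<bar>hdim deg + - p\<bar> / p) powr p) *
           wint \<Omega> (\<lambda>x. \<bar>u x\<bar> powr p * N x powr - p * norm (hgrad gmul deg N x) powr p)
         \<le> wint \<Omega> (\<lambda>x. norm (g x) powr p * N x powr (p + - p))"
      using power[of \<Omega> "- p" u g] \<Omega> ug by simp
    moreover have "wint \<Omega> (\<lambda>x. norm (g x) powr p * N x powr (p + - p)) = wint \<Omega> (\<lambda>x. norm (g x) powr p)"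
      by (rule wint_cong[of _ 0], subst one, simp_all)
    moreover have "wint \<Omega> (\<lambda>x. \<bar>u x\<bar> powr p * N x powr - p * norm (hgrad gmul deg N x) powr p)
        = wint \<Omega> (\<lambda>x. \<bar>u x\<bar> powr p / N x powr p * norm (hgrad gmul deg N x) powr p)"
      by (rule wint_cong[of _ 0]) (simp add: powr_minus divide_inverse)
    ultimately show ?thesis by simp
  qed
  have log: "ennreal ((\<bar>\<beta> + 1\<bar> / p) powr p) *
             wint {x. N x < R} (\<lambda>x. \<bar>u x\<bar> powr p / N x powr p * ln (R / N x) powr \<beta>
                                    * norm (hgrad gmul deg N x) powr p)
           \<le> wint {x. N x < R} (\<lambda>x. norm (g x) powr p * ln (R / N x) powr (p + \<beta>))"
    if "hdim deg = p" "R > 0" "\<beta> < -1" "(u, g) \<in> Dsp gmul deg p {x. N x < R} (\<lambda>x. ln (R / N x) powr (p + \<beta>))"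
    for R \<beta> :: real and u g
    using hardy_log[OF that] by (simp add: mult.assoc)
  have log_sharp: "\<exists>(u, g) \<in> Dsp gmul deg p {x. N x < R} (\<lambda>x. ln (R / N x) powr (p + \<beta>)).
            ennreal C *
              wint {x. N x < R} (\<lambda>x. \<bar>u x\<bar> powr p / N x powr p * ln (R / N x) powr \<beta>
                                     * norm (hgrad gmul deg N x) powr p)
            > wint {x. N x < R} (\<lambda>x. norm (g x) powr p * ln (R / N x) powr (p + \<beta>))"
    if sh: "hdim deg = p" "R > 0" "\<beta> < -1" "C > (\<bar>\<beta> + 1\<bar> / p) powr p" for R \<beta> C
  proof -
    obtain \<phi> where \<phi>: "test_fn {x. N x < R} \<phi>"
      "wint {x. N x < R} (\<lambda>x. norm (grad \<phi> x) powr p * ln (R / N x) powr (p + \<beta>))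
      < ennreal C * wint {x. N x < R} (\<lambda>x. \<bar>\<phi> x\<bar> powr p * (1 / N x powr p * ln (R / N x) powr \<beta> * norm (grad N x) powr p))"
      by (rule hardy_log_sharp[OF sh])
    show ?thesis
      by (rule bexI[OF _ test_fn_in_Dsp[OF \<phi>(1)]]) (use \<phi>(2) in \<open>simp add: mult.assoc\<close>)
  qed
  have log_unweighted: "ennreal (((p - 1) / p) powr p) *
            wint {x. N x < R} (\<lambda>x. \<bar>u x\<bar> powr p / (N x * ln (R / N x)) powr p
                                   * norm (hgrad gmul deg N x) powr p)
          \<le> wint {x. N x < R} (\<lambda>x. norm (g x) powr p)"
    if Q: "hdim deg = p" and R: "R > 0" and ug: "(u, g) \<in> Dsp gmul deg p {x. N x < R} (\<lambda>x. 1)" for R u g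
  proof -
    let ?\<Omega> = "{x. N x < R}"
    have l: "ln (R / N x) > 0" if "x \<in> ?\<Omega>" "x \<noteq> 0" for x
      using that N0[OF that(2)] R by (simp add: ln_gt_zero)
    have one: "ln (R / N x) powr (p + - p) = 1" if "x \<in> ?\<Omega>" "x \<noteq> 0" for x using l[OF that] by simp
    \<comment> \<open>Again \<beta> = -p, admissible because p > 1; then |\<beta> + 1| = p -
      1.\<close>
    have "Dsp gmul deg p ?\<Omega> (\<lambda>x. 1) = Dsp gmul deg p ?\<Omega> (\<lambda>x. ln (R / N x) powr (p + - p))"
      by (rule Dsp_cong[of _ 0], rule one[symmetric])
    then have "ennreal ((\<bar>- p + 1\<bar> / p) powr p) *
             wint ?\<Omega> (\<lambda>x. \<bar>u x\<bar> powr p / N x powr p * ln (R / N x) powr - p * norm (hgrad gmul deg N x) powr p)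
           \<le> wint ?\<Omega> (\<lambda>x. norm (g x) powr p * ln (R / N x) powr (p + - p))"
      using ug p by (intro log[OF Q R]) simp_all
    moreover have "wint ?\<Omega> (\<lambda>x. norm (g x) powr p * ln (R / N x) powr (p + - p)) = wint ?\<Omega> (\<lambda>x. norm (g x) powr p)"
      by (rule wint_cong[of _ 0], subst one, simp_all)
    moreover have "wint ?\<Omega> (\<lambda>x. \<bar>u x\<bar> powr p / N x powr p * ln (R / N x) powr - p * norm (hgrad gmul deg N x) powr p)
        = wint ?\<Omega> (\<lambda>x. \<bar>u x\<bar> powr p / (N x * ln (R / N x)) powr p * norm (hgrad gmul deg N x) powr p)"
      by (rule wint_cong[of _ 0]) (use N_nonneg l in \<open>simp add: powr_minus powr_mult less_imp_le divide_inverse\<close>)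
    moreover have "\<bar>- p + 1\<bar> = p - 1" using p by simp
    ultimately show ?thesis by simp
  qed
  show ?thesis
  proof (intro conjI allI impI ballI, goal_cases)
    case (1 \<beta> \<Omega> z)
    then show ?case using power[of \<Omega> \<beta> "fst z" "snd z"] by (simp add: case_prod_beta)
  next
    case (2 \<beta> \<Omega> C)
    then show ?case by (intro power_sharp)
  next
    case (3 \<Omega> z)
    then show ?case using unweighted[of \<Omega> "fst z" "snd z"] by (simp add: case_prod_beta)
  next
    case (4 R \<beta> z)
    then show ?case using log[of R \<beta> "fst z" "snd z"] by (simp add: case_prod_beta)
  next
    case (5 R \<beta> C)
    then show ?case by (intro log_sharp) simp_all
  next
    case (6 R z)
    then show ?case using log_unweighted[of R "fst z" "snd z"] by (simp add: case_prod_beta)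
  qed
qed

end
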